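(* Let $n,d\ge 1$, let $G^\star\in\mathcal{O}(d)^n$, let $\Delta\in\mathbb{R}^{nd\times nd}$ be symmetric, and let $C=G^\star G^{\star\top}+\Delta$. Let $\widehat{G}\in\mathcal{O}(d)^n$ be a global maximizer of $\bar f(G)=\operatorname{tr}(G^\top C G)$ over $\mathcal{O}(d)^n$. Suppose that $\|\Delta\|\le \frac{n^{3/4}}{20 d^{1/2}}$ and $\|\Delta G^\star\|_\infty\le \frac{n}{20}$. Put $\rho_F=\frac{1}{10}\min\{\sqrt{n},\frac{n}{\|\Delta\|}\}$ and $\rho_\infty=\frac14$. Then for any $G\in\mathcal{O}(d)^n$ satisfying $$\operatorname{d}_F([G],[\widehat{G}])\le\rho_F\quad\text{and}\quad \|G\widehat{Q}-\widehat{G}\|_\infty\le\rho_\infty,$$ where $\widehat{Q}\in\mathcal{O}(d)$ satisfies $\operatorname{d}_F([G],[\widehat{G}])=\|G\widehat{Q}-\widehat{G}\|_F$, it holds that $$\operatorname{d}_F([G],[\widehat{G}])\le \operatorname{d}^{\mathcal{Q}}([G],[\widehat{G}])\le\frac{10}{n}\,\|\operatorname{grad} f([G])\|_{[G]}\le\frac{10}{n}\,\|\operatorname{grad}\bar f(G)\|_F,$$ where $f:\mathcal{Q}\to\mathbb{R}$, $f([G])=\operatorname{tr}(G^\top C G)$, on the quotient manifold $\mathcal{Q}=\mathcal{O}(d)^n/\mathcal{O}(d)$, and $\operatorname{d}^{\mathcal{Q}}$ is the Riemannian distance of $\mathcal{Q}$.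
   Context: Block notation: $X\in\mathbb{R}^{nd\times d}$ is written $X=[X_1;\dots;X_n]$ with $d\times d$ blocks $X_i$ stacked in a column; $\mathcal{O}(d)^n$ is the set of such $X$ with every $X_i$ orthogonal. $\|\cdot\|$ is the operator norm, $\|\cdot\|_F$ the Frobenius norm, and $\|X\|_\infty:=\max_i\|X_i\|_F$ for $X\in\mathbb{R}^{nd\times d}$. For $X,Y\in\mathbb{R}^{nd\times d}$, $[X]=\{XQ: Q\in\mathcal{O}(d)\}$ and $\operatorname{d}_F([X],[Y]):=\min_{Q\in\mathcal{O}(d)}\|X-YQ\|_F$. $\mathcal{O}(d)^n$ is a Riemannian submanifold of $\mathbb{R}^{nd\times d}$ with the metric induced by $\langle X,Y\rangle=\operatorname{tr}(X^\top Y)$. $\mathcal{O}(d)$ acts on it by $(G,Q)\mapsto GQ$, and $\mathcal{Q}=\mathcal{O}(d)^n/\mathcal{O}(d)$ is the quotient manifold with projection $\pi(G)=[G]$ and with the Riemannian metric $\langle\cdot,\cdot\rangle_{[G]}$ (norm $\|\cdot\|_{[G]}$) making $\pi$ a Riemannian submersion: the inner product of two tangent vectors at $[G]$ is the Frobenius inner product of their horizontal lifts at $G$, where the horizontal space at $G$ is the orthogonal complement in $\operatorname{T}_G\mathcal{O}(d)^n$ of $\operatorname{T}_G(\pi^{-1}([G]))$. $\operatorname{d}^{\mathcal{Q}}$ is the infimum of lengths of piecewise smooth curves in $\mathcal{Q}$; $\operatorname{grad}$ denotes Riemannian gradients on $\mathcal{Q}$ and on $\mathcal{O}(d)^n$ respectively.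 If $\Delta=0$, $n/\|\Delta\|$ is read as $+\infty$. *)

theory Defs
  imports "HOL-Analysis.Analysis"
begin

section \<open>Stacked block matrices\<close>

text \<open>
  An \<open>nd \<times> d\<close> matrix is an element of \<open>real^'d^('n\<times>'d)\<close> with \<open>n = CARD('n)\<close>, \<open>d = CARD('d)\<close>;
  the row index \<open>(i, a)\<close> is row \<open>a\<close> of the \<open>i\<close>-th block. On all matrix types \<open>norm\<close> is the
  Frobenius norm and \<open>X \<bullet> Y\<close> is \<open>tr (X\<^sup>T Y)\<close>.
\<close>

type_synonym ('n, 'd) stack = "real^'d^('n \<times> 'd)"

definition block :: "('n::finite, 'd::finite) stack \<Rightarrow> 'n \<Rightarrow> real^'d^'d" where
  "block X i = (\<chi> a b. X $ (i, a) $ b)"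

definition norm_inf :: "('n::finite, 'd::finite) stack \<Rightarrow> real" where
  "norm_inf X = Max (range (\<lambda>i. norm (block X i)))"

definition orth_stack :: "('n::finite, 'd::finite) stack set" where
  "orth_stack = {G. \<forall>i. orthogonal_matrix (block G i)}"

definition orbit :: "('n::finite, 'd::finite) stack \<Rightarrow> ('n, 'd) stack set" where
  "orbit X = {X ** Q | Q. orthogonal_matrix Q}"

text \<open>
  The infimum is attained (the orthogonal group is compact), and the value depends on \<open>X\<close>, \<open>Y\<close>
  only through their orbits.
\<close>

definition dF :: "('n::finite, 'd::finite) stack \<Rightarrow> ('n, 'd) stack \<Rightarrow> real" where
  "dF X Y = Inf {norm (X - Y ** Q) | Q. orthogonal_matrix Q}"

definition fbar :: "real^('n \<times> 'd)^('n \<times> 'd) \<Rightarrow> ('n::finite, 'd::finite) stack \<Rightarrow> real" where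
  "fbar C G = trace (transpose G ** C ** G)"

section \<open>Smoothness and embedded submanifolds of Euclidean space\<close>

text \<open>\<open>Ck_on\<close> and \<open>smooth_on\<close> are meant for open sets \<open>S\<close>.\<close>

primrec Ck_on :: "nat \<Rightarrow> 'a::euclidean_space set \<Rightarrow> ('a \<Rightarrow> 'b::euclidean_space) \<Rightarrow> bool" where
  "Ck_on 0 S f \<longleftrightarrow> continuous_on S f"
| "Ck_on (Suc k) S f \<longleftrightarrow> (\<forall>x\<in>S. f differentiable (at x)) \<and>
     (\<forall>v. Ck_on k S (\<lambda>x. frechet_derivative f (at x) v))"

definition smooth_on :: "'a::euclidean_space set \<Rightarrow> ('a \<Rightarrow> 'b::euclidean_space) \<Rightarrow> bool" where
  "smooth_on S f \<longleftrightarrow> (\<forall>k. Ck_on k S f)"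

definition smooth_on_sub :: "'a::euclidean_space set \<Rightarrow> ('a \<Rightarrow> real) \<Rightarrow> bool" where
  "smooth_on_sub M F \<longleftrightarrow>
     (\<forall>x\<in>M. \<exists>U E. open U \<and> x \<in> U \<and> smooth_on U E \<and> (\<forall>y\<in>U \<inter> M. E y = F y))"

definition curve_at :: "'a::euclidean_space set \<Rightarrow> 'a \<Rightarrow> (real \<Rightarrow> 'a) \<Rightarrow> bool" where
  "curve_at M x \<gamma> \<longleftrightarrow>
     \<gamma> 0 = x \<and> (\<exists>e>0. smooth_on {-e<..<e} \<gamma> \<and> \<gamma> ` {-e<..<e} \<subseteq> M)"

definition velocity :: "(real \<Rightarrow> 'a::euclidean_space) \<Rightarrow> 'a" where
  "velocity \<gamma> = vector_derivative \<gamma> (at 0)"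

definition tangent :: "'a::euclidean_space set \<Rightarrow> 'a \<Rightarrow> 'a set" where
  "tangent M x = {velocity \<gamma> | \<gamma>. curve_at M x \<gamma>}"

text \<open>
  The Riemannian gradient for the induced metric: the tangent vector representing the
  differential, the latter being computed along curves in the submanifold.
\<close>

definition grad_sub :: "'a::euclidean_space set \<Rightarrow> ('a \<Rightarrow> real) \<Rightarrow> 'a \<Rightarrow> 'a" where
  "grad_sub M F x = (THE v. v \<in> tangent M x \<and>
     (\<forall>\<gamma>. curve_at M x \<gamma> \<longrightarrow>
        ((\<lambda>t. F (\<gamma> t)) has_real_derivative (v \<bullet> velocity \<gamma>)) (at 0)))"

section \<open>The quotient manifold\<close>

type_synonym ('n, 'd) qpoint = "('n, 'd) stack set"

definition quot :: "('n::finite, 'd::finite) qpoint set" where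
  "quot = orbit ` orth_stack"

text \<open>
  The smooth structure of the quotient is given by its algebra of smooth functions: \<open>h\<close> is smooth
  iff its pullback along the projection \<open>orbit\<close> is smooth (this characterises the quotient manifold
  structure). A map from an open interval to the quotient is smooth iff its composition
  with every smooth function is.
\<close>

definition smooth_fun_Q :: "(('n::finite, 'd::finite) qpoint \<Rightarrow> real) \<Rightarrow> bool" where
  "smooth_fun_Q h \<longleftrightarrow> smooth_on_sub orth_stack (\<lambda>G. h (orbit G))"

definition smooth_curve_Q :: "real set \<Rightarrow> (real \<Rightarrow> ('n::finite, 'd::finite) qpoint) \<Rightarrow> bool" where
  "smooth_curve_Q J c \<longleftrightarrow>
     c ` J \<subseteq> quot \<and> (\<forall>h. smooth_fun_Q h \<longrightarrow> smooth_on J (\<lambda>t. h (c t)))"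

text \<open>
  Tangent vectors are velocities of smooth curves, identified with the derivations
  \<open>h \<mapsto> (h \<circ> c)'(t)\<close> on smooth functions. Setting the value to \<open>0\<close> on non-smooth functions makes
  equality of tangent vectors plain equality.
\<close>

type_synonym ('n, 'd) qtangent = "(('n, 'd) qpoint \<Rightarrow> real) \<Rightarrow> real"

definition velocity_Q ::
  "(real \<Rightarrow> ('n::finite, 'd::finite) qpoint) \<Rightarrow> real \<Rightarrow> ('n, 'd) qtangent" where
  "velocity_Q c t = (\<lambda>h. if smooth_fun_Q h then deriv (\<lambda>s. h (c s)) t else 0)"

definition tangent_Q :: "('n::finite, 'd::finite) qpoint \<Rightarrow> ('n, 'd) qtangent set" where
  "tangent_Q p = {velocity_Q c 0 | c. c 0 = p \<and> (\<exists>e>0. smooth_curve_Q {-e<..<e} c)}"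

text \<open>The differential of the projection at \<open>G\<close>, applied to a vector tangent to \<open>orth_stack\<close>.\<close>

definition dproj :: "('n::finite, 'd::finite) stack \<Rightarrow> ('n, 'd) stack \<Rightarrow> ('n, 'd) qtangent" where
  "dproj G v = (THE \<xi>. \<forall>\<gamma>. curve_at orth_stack G \<gamma> \<and> velocity \<gamma> = v \<longrightarrow>
     \<xi> = velocity_Q (\<lambda>t. orbit (\<gamma> t)) 0)"

definition fibre :: "('n::finite, 'd::finite) stack \<Rightarrow> ('n, 'd) stack set" where
  "fibre G = {H \<in> orth_stack. orbit H = orbit G}"

definition horizontal :: "('n::finite, 'd::finite) stack \<Rightarrow> ('n, 'd) stack set" where
  "horizontal G = {v \<in> tangent orth_stack G. \<forall>w\<in>tangent (fibre G) G. v \<bullet> w = 0}"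

definition hlift :: "('n::finite, 'd::finite) stack \<Rightarrow> ('n, 'd) qtangent \<Rightarrow> ('n, 'd) stack" where
  "hlift G \<xi> = (THE v. v \<in> horizontal G \<and> dproj G v = \<xi>)"

text \<open>
  Quantities defined through a representative \<open>G \<in> p\<close> use \<open>the_elem\<close> of the set of values over all
  representatives; this set is a singleton because the value is independent of \<open>G\<close>.
\<close>

definition inner_Q ::
  "('n::finite, 'd::finite) qpoint \<Rightarrow> ('n, 'd) qtangent \<Rightarrow> ('n, 'd) qtangent \<Rightarrow> real" where
  "inner_Q p \<xi> \<eta> = the_elem ((\<lambda>G. hlift G \<xi> \<bullet> hlift G \<eta>) ` p)"

definition norm_Q :: "('n::finite, 'd::finite) qpoint \<Rightarrow> ('n, 'd) qtangent \<Rightarrow> real" where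
  "norm_Q p \<xi> = sqrt (inner_Q p \<xi> \<xi>)"

definition f_Q :: "real^('n \<times> 'd)^('n \<times> 'd) \<Rightarrow> ('n::finite, 'd::finite) qpoint \<Rightarrow> real" where
  "f_Q C p = the_elem (fbar C ` p)"

text \<open>For smooth \<open>h\<close>, \<open>\<eta> h\<close> is the differential of \<open>h\<close> at \<open>p\<close> applied to \<open>\<eta>\<close>.\<close>

definition grad_Q ::
  "(('n::finite, 'd::finite) qpoint \<Rightarrow> real) \<Rightarrow> ('n, 'd) qpoint \<Rightarrow> ('n, 'd) qtangent" where
  "grad_Q h p = (THE \<xi>. \<xi> \<in> tangent_Q p \<and> (\<forall>\<eta>\<in>tangent_Q p. inner_Q p \<xi> \<eta> = \<eta> h))"

text \<open>A curve on a closed interval is smooth if it extends smoothly to an open neighbourhood.\<close>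

definition smooth_segment_Q ::
  "real \<Rightarrow> real \<Rightarrow> (real \<Rightarrow> ('n::finite, 'd::finite) qpoint) \<Rightarrow> bool" where
  "smooth_segment_Q s t c \<longleftrightarrow>
     (\<exists>e>0. \<exists>c'. smooth_curve_Q {s-e<..<t+e} c' \<and> (\<forall>u\<in>{s..t}. c' u = c u))"

definition piecewise_smooth_Q ::
  "real \<Rightarrow> real \<Rightarrow> (real \<Rightarrow> ('n::finite, 'd::finite) qpoint) \<Rightarrow> bool" where
  "piecewise_smooth_Q a b c \<longleftrightarrow>
     (\<exists>N \<tau>. \<tau> 0 = a \<and> \<tau> N = b \<and>
        (\<forall>k<N. \<tau> k < \<tau> (Suc k) \<and> smooth_segment_Q (\<tau> k) (\<tau> (Suc k)) c))"

text \<open>At the finitely many breakpoints the integrand may be meaningless; this does not affect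
  the integral.\<close>

definition length_Q :: "real \<Rightarrow> real \<Rightarrow> (real \<Rightarrow> ('n::finite, 'd::finite) qpoint) \<Rightarrow> real" where
  "length_Q a b c = integral {a..b} (\<lambda>t. norm_Q (c t) (velocity_Q c t))"

text \<open>The distance is \<open>\<infinity>\<close> between points in different components.\<close>

definition dist_Q :: "('n::finite, 'd::finite) qpoint \<Rightarrow> ('n, 'd) qpoint \<Rightarrow> ereal" where
  "dist_Q p q = Inf {ereal (length_Q a b c) | a b c.
     a < b \<and> piecewise_smooth_Q a b c \<and> c a = p \<and> c b = q}"

end

(*
  Both inequalities between distances reduce to curves in O(d)^n, because normalising one block
  to the identity is a global section of the quotient map: every smooth curve of the quotient lifts,
  and its speed is the norm of the horizontal part of the velocity of the lift. Cancelling the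
  vertical part to first order by a rotation shows that d_F grows no faster than length. Conversely,
  joining G_i to Ghat_i by the Cayley path bounds the quotient distance by 8/7 |G - Ghat|, where G is
  rotated into alignment with Ghat.

  It remains to bound the gradient from below by a multiple of n |X| for X = Ghat - G. We test it
  with the tangential part W of X. With the symmetric multipliers D_i = (C Ghat)_i Ghat_i^T,

    <C G, W> = 1/2 sum <D_i X_i, X_i> - <C X, X> + 1/2 sum <G_i^T (C G)_i, X_i^T X_i>,

  and the outer two sums are close to n |X|^2 because D_i is close to n I, while the middle term is
  small because Ghat^T X = X^T X / 2 for aligned pairs. That D_i is close to n I follows from D_i being
  n times an orthogonal matrix up to noise, and from optimality of Ghat under reflections of one block,
  which rules out eigenvalues near -n.
*)

theory Submission
  imports Defs
begin

section \<open>Matrices and their blocks\<close>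

text \<open>The exponent 3/4 in the noise bound permits a direct blockwise argument. With r =
  n^(1/4) it puts \<open>Ghat\<close> within r / 5 of the aligned signal, so \<Delta> applied to
  their difference has norm at most (r^3 / 20) (r / 5) = n / 100. Each block of \<Delta>
  \<open>Ghat\<close> is then controlled by the bound for \<Delta> \<open>Gstar\<close>, although
  \<open>Ghat\<close> depends on \<Delta>.

  Rotating \<open>Gstar\<close> leaves \<open>C\<close> unchanged and rotating \<open>G\<close>
  leaves its orbit unchanged, so both may be aligned with \<open>Ghat\<close>.

  Tangent vectors of the quotient are derivations, so enough test functions are required: the
  coordinates of the section are smooth on the quotient; they lift smooth curves and separate
  horizontal vectors. Cayley curves are convenient because the derivative of a resolvent is a
  polynomial in it, which gives all orders of smoothness by induction.

  As G^T C G is symmetric, the gradient at G is already horizontal, hence the last inequality is an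
  equality. Testing with W gives 0.52 n |X|^2; the factor 2 in the gradient makes this 1.04 n |X|,
  with ample room between 8/7 and 10.\<close>

lemma inner_matrix_sum:
  fixes A B :: "real^'b^'a"
  shows "A \<bullet> B = (\<Sum>i\<in>UNIV. \<Sum>j\<in>UNIV. A $ i $ j * B $ i $ j)"
  by (simp add: inner_vec_def)

lemma inner_transpose:
  fixes A B :: "real^'b^'a"
  shows "transpose A \<bullet> transpose B = A \<bullet> B"
  unfolding inner_matrix_sum transpose_def by (subst sum.swap) simp

lemma norm_transpose: "norm (transpose A) = norm (A :: real^'b^'a)"
  by (simp add: norm_eq_sqrt_inner inner_transpose)

lemma inner_mult_left:
  fixes A :: "real^'m^'n" and B :: "real^'k^'m"
  shows "(A ** B) \<bullet> C = B \<bullet> (transpose A ** C)"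
proof -
  have "(A ** B) \<bullet> C = (\<Sum>i\<in>UNIV. \<Sum>j\<in>UNIV. \<Sum>k\<in>UNIV. A $ i $ k * B $ k $ j * C $ i $ j)"
    by (simp add: inner_matrix_sum matrix_matrix_mult_def sum_distrib_right)
  also have "\<dots> = (\<Sum>i\<in>UNIV. \<Sum>k\<in>UNIV. \<Sum>j\<in>UNIV. A $ i $ k * B $ k $ j * C $ i $ j)"
    by (intro sum.cong refl, subst sum.swap) simp
  also have "\<dots> = (\<Sum>k\<in>UNIV. \<Sum>i\<in>UNIV. \<Sum>j\<in>UNIV. A $ i $ k * B $ k $ j * C $ i $ j)"
    by (subst sum.swap) simp
  also have "\<dots> = (\<Sum>k\<in>UNIV. \<Sum>j\<in>UNIV. \<Sum>i\<in>UNIV. A $ i $ k * B $ k $ j * C $ i $ j)"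
    by (intro sum.cong refl, subst sum.swap) simp
  also have "\<dots> = B \<bullet> (transpose A ** C)"
    by (simp add: inner_matrix_sum matrix_matrix_mult_def sum_distrib_left transpose_def mult_ac)
  finally show ?thesis .
qed

lemma inner_mult_right:
  fixes A :: "real^'m^'n" and B :: "real^'k^'m"
  shows "(A ** B) \<bullet> C = A \<bullet> (C ** transpose B)"
proof -
  have "(A ** B) \<bullet> C = transpose (A ** B) \<bullet> transpose C"
    by (simp add: inner_transpose)
  also have "\<dots> = transpose A \<bullet> (B ** transpose C)"
    by (simp add: matrix_transpose_mul inner_mult_left)
  also have "\<dots> = A \<bullet> transpose (B ** transpose C)"
    by (metis inner_transpose transpose_transpose)
  finally show ?thesis by (simp add: matrix_transpose_mul)
qed

lemma trace_transpose_mult: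
  fixes A B :: "real^'b^'a"
  shows "trace (transpose A ** B) = A \<bullet> B"
  unfolding inner_matrix_sum trace_def matrix_matrix_mult_def transpose_def
  by (subst sum.swap) simp

lemma bounded_bilinear_matrix_mult:
  "bounded_bilinear ((**) :: real^'m^'n \<Rightarrow> real^'k^'m \<Rightarrow> real^'k^'n)"
proof -
  have "bilinear ((**) :: real^'m^'n \<Rightarrow> real^'k^'m \<Rightarrow> real^'k^'n)"
    unfolding bilinear_def
    by (auto intro!: linearI simp: vec_eq_iff matrix_matrix_mult_def sum.distrib algebra_simps sum_distrib_left)
  then show ?thesis by (simp add: bilinear_conv_bounded_bilinear)
qed

interpretation mm: bounded_bilinear "(**) :: real^'m^'n \<Rightarrow> real^'k^'m \<Rightarrow> real^'k^'n"
  by (rule bounded_bilinear_matrix_mult)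

lemma bounded_linear_transpose: "bounded_linear (transpose :: real^'m^'n \<Rightarrow> real^'n^'m)"
  by (intro linear_conv_bounded_linear[THEN iffD1] linearI) (auto simp: transpose_def vec_eq_iff)

lemmas transpose_linear_simps =
  linear_add[OF bounded_linear.linear[OF bounded_linear_transpose]]
  linear_diff[OF bounded_linear.linear[OF bounded_linear_transpose]]
  linear_neg[OF bounded_linear.linear[OF bounded_linear_transpose]]
  linear_sum[OF bounded_linear.linear[OF bounded_linear_transpose]]
  linear_0[OF bounded_linear.linear[OF bounded_linear_transpose]]
  transpose_scalar

lemmas mm_simps = mm.add_left mm.add_right mm.diff_left mm.diff_right mm.minus_left mm.minus_right
  mm.scaleR_left mm.scaleR_right transpose_linear_simps matrix_transpose_mul

lemma norm_columns: "(norm X)\<^sup>2 = (\<Sum>j\<in>UNIV. (norm (column j X))\<^sup>2)" for X :: "real^'k^'n"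
proof -
  have "(norm X)\<^sup>2 = (\<Sum>i\<in>UNIV. \<Sum>j\<in>UNIV. X $ i $ j * X $ i $ j)"
    by (simp add: power2_norm_eq_inner inner_matrix_sum)
  also have "\<dots> = (\<Sum>j\<in>UNIV. \<Sum>i\<in>UNIV. X $ i $ j * X $ i $ j)"
    by (rule sum.swap)
  also have "\<dots> = (\<Sum>j\<in>UNIV. (norm (column j X))\<^sup>2)"
    by (simp add: power2_norm_eq_inner inner_vec_def column_def)
  finally show ?thesis .
qed

lemma column_matrix_mult: "column j (M ** X) = M *v column j X"
  by (simp add: column_def matrix_matrix_mult_def matrix_vector_mult_def vec_eq_iff)

text \<open>Frobenius norms split over columns, so a bound on vectors passes to matrices with no
  dimensional factor. This is how the operator norm of \<Delta> meets Frobenius norms of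
  stacks.\<close>

lemma norm_mult_le_of_vector:
  fixes M :: "real^'m^'n" and X :: "real^'k^'m"
  assumes "\<And>v. norm (M *v v) \<le> c * norm v" "0 \<le> c"
  shows "norm (M ** X) \<le> c * norm X"
proof -
  have "(norm (M ** X))\<^sup>2 = (\<Sum>j\<in>UNIV. (norm (M *v column j X))\<^sup>2)"
    by (simp add: norm_columns column_matrix_mult)
  also have "\<dots> \<le> (\<Sum>j\<in>UNIV. (c * norm (column j X))\<^sup>2)"
    by (intro sum_mono power_mono assms) auto
  also have "\<dots> = (c * norm X)\<^sup>2"
    by (simp add: power_mult_distrib norm_columns[of X] sum_distrib_left)
  finally show ?thesis
    by (rule power2_le_imp_le) (use assms in auto)
qed

lemma norm_matrix_vector_le: "norm (M *v v) \<le> norm M * norm (v::real^'m)" for M :: "real^'m^'n"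
proof -
  have "(norm (M *v v))\<^sup>2 = (\<Sum>i\<in>UNIV. (M $ i \<bullet> v)\<^sup>2)"
    unfolding power2_norm_eq_inner inner_vec_def[of "M *v v"]
    by (simp add: matrix_vector_mul_component power2_eq_square)
  also have "\<dots> \<le> (\<Sum>i\<in>UNIV. (norm (M $ i) * norm v)\<^sup>2)"
    by (intro sum_mono) (metis Cauchy_Schwarz_ineq2 abs_le_square_iff abs_mult abs_norm_cancel)
  also have "\<dots> = (norm M * norm v)\<^sup>2"
    by (simp add: power_mult_distrib sum_distrib_right[symmetric] power2_norm_eq_inner inner_vec_def[of M])
  finally show ?thesis
    by (rule power2_le_imp_le) auto
qed

lemma norm_matrix_mult_le: "norm (A ** B) \<le> norm A * norm B"
  for A :: "real^'m^'n" and B :: "real^'k^'m"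
  by (rule norm_mult_le_of_vector[OF norm_matrix_vector_le]) auto

lemma norm_orthogonal_mult:
  fixes Q :: "real^'n^'n" and X :: "real^'k^'n"
  assumes "orthogonal_matrix Q"
  shows "norm (Q ** X) = norm X"
  using assms by (simp add: norm_eq_sqrt_inner inner_mult_left matrix_mul_assoc orthogonal_matrix)

lemma norm_mult_orthogonal:
  fixes Q :: "real^'n^'n" and X :: "real^'n^'k"
  assumes "orthogonal_matrix Q"
  shows "norm (X ** Q) = norm X"
  using norm_orthogonal_mult[of "transpose Q" "transpose X"] assms
  by (metis matrix_transpose_mul norm_transpose orthogonal_matrix_transpose)

lemma norm_orthogonal_vector:
  fixes Q :: "real^'n^'n"
  assumes "orthogonal_matrix Q"
  shows "norm (Q *v v) = norm v"
  using assms by (intro orthogonal_transformation_norm) (simp add: orthogonal_transformation_matrix)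

lemma orth_tr:
  fixes Q :: "real^'n^'n"
  assumes "orthogonal_matrix Q"
  shows "transpose Q ** Q = mat 1" "Q ** transpose Q = mat 1"
    "A ** transpose Q ** Q = A" "B ** Q ** transpose Q = B"
  using assms by (auto simp: orthogonal_matrix_def simp flip: matrix_mul_assoc)

lemma orthogonal_matrix_mult:
  fixes A B :: "real^'n^'n"
  assumes "orthogonal_matrix A" "orthogonal_matrix B"
  shows "orthogonal_matrix (A ** B)"
  unfolding orthogonal_matrix by (simp add: mm_simps matrix_mul_assoc orth_tr assms)

section \<open>Skew matrices, the tangent space of the orthogonal group at the identity\<close>

abbreviation skew :: "real^'n^'n \<Rightarrow> bool" where
  "skew A \<equiv> transpose A = - A"

lemma skew_inner_zero:
  fixes A :: "real^'n^'n"
  assumes "skew A" shows "v \<bullet> (A *v v) = 0"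
proof -
  have "v \<bullet> (A *v v) = (transpose A *v v) \<bullet> v"
    by (simp add: dot_lmul_matrix)
  also have "\<dots> = - ((A *v v) \<bullet> v)"
    unfolding assms using matrix_vector_mult_diff_rdistrib[of 0 A v] by simp
  finally show ?thesis by (simp add: inner_commute)
qed

text \<open>Testing against \<open>Z - transpose Z\<close> forces its norm to vanish. In this form,
  first-order optimality over rotations becomes symmetry.\<close>

lemma symmetric_if_orthogonal_to_skew:
  fixes Z :: "real^'n^'n"
  assumes "\<And>A. skew A \<Longrightarrow> Z \<bullet> A = 0"
  shows "transpose Z = Z"
proof -
  let ?A = "Z - transpose Z"
  have sk: "skew ?A" by (simp add: mm_simps)
  then have "Z \<bullet> ?A = 0" by (rule assms)
  moreover have "transpose Z \<bullet> ?A = - (Z \<bullet> ?A)"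
    using inner_transpose[of Z ?A] sk by (metis inner_minus_right minus_equation_iff)
  ultimately have "?A \<bullet> ?A = 0" by (simp add: inner_diff_left)
  then show ?thesis by simp
qed

section \<open>Stacks as families of square blocks\<close>

definition stack_of :: "('n \<Rightarrow> real^'d^'d) \<Rightarrow> ('n::finite, 'd::finite) stack" where
  "stack_of f = (\<chi> p. f (fst p) $ snd p)"

lemma block_stack_of [simp]: "block (stack_of f) i = f i"
  by (simp add: block_def stack_of_def vec_eq_iff)

lemma stack_eq_iff: "X = Y \<longleftrightarrow> (\<forall>i. block X i = block Y i)"
  by (auto simp: block_def vec_eq_iff)

lemma bounded_linear_block: "bounded_linear (\<lambda>X. block X i)"
  by (intro linear_conv_bounded_linear[THEN iffD1] linearI) (auto simp: block_def vec_eq_iff)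

definition embed_block :: "'n \<Rightarrow> real^'d^'d \<Rightarrow> ('n::finite, 'd::finite) stack" where
  "embed_block i A = (\<chi> p. if fst p = i then A $ snd p else 0)"

lemma block_embed_block [simp]: "block (embed_block i A) j = (if j = i then A else 0)"
  by (simp add: block_def embed_block_def vec_eq_iff)

lemma bounded_linear_embed_block: "bounded_linear (embed_block i)"
  by (intro linear_conv_bounded_linear[THEN iffD1] linearI) (auto simp: embed_block_def vec_eq_iff)

text \<open>As a sum of linear embeddings, a curve assembled from block curves inherits smoothness
  and derivatives from the rules for sums and bounded linear maps.\<close>

lemma stack_of_eq_sum: "stack_of f = (\<Sum>i\<in>UNIV. embed_block i (f i))"
  by (simp add: vec_eq_iff stack_of_def embed_block_def sum_component if_distrib[where f="\<lambda>x. x $ _"] cong: if_cong)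

lemmas block_linear_simps [simp] =
  linear_add[OF bounded_linear.linear[OF bounded_linear_block]]
  linear_diff[OF bounded_linear.linear[OF bounded_linear_block]]
  linear_neg[OF bounded_linear.linear[OF bounded_linear_block]]
  linear_scale[OF bounded_linear.linear[OF bounded_linear_block]]
  linear_0[OF bounded_linear.linear[OF bounded_linear_block]]

lemma block_mult [simp]: "block (X ** Q) i = block X i ** Q"
  by (simp add: block_def matrix_matrix_mult_def vec_eq_iff)

lemma sum_UNIV_prod:
  fixes f :: "'a::finite \<times> 'b::finite \<Rightarrow> 'c::comm_monoid_add"
  shows "(\<Sum>p\<in>UNIV. f p) = (\<Sum>i\<in>UNIV. \<Sum>j\<in>UNIV. f (i, j))"
  by (metis UNIV_Times_UNIV sum.cartesian_product')

lemma inner_blocks: "X \<bullet> Y = (\<Sum>i\<in>UNIV. block X i \<bullet> block Y i)"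
  for X Y :: "('n::finite, 'd::finite) stack"
  by (simp add: inner_vec_def block_def sum_UNIV_prod)

lemma norm_blocks: "(norm X)\<^sup>2 = (\<Sum>i\<in>UNIV. (norm (block X i))\<^sup>2)"
  by (simp add: power2_norm_eq_inner inner_blocks[of X])

lemma norm_block_le: "norm (block X i) \<le> norm X"
proof -
  have "(norm (block X i))\<^sup>2 \<le> (norm X)\<^sup>2"
    unfolding norm_blocks by (rule member_le_sum) auto
  then show ?thesis by (rule power2_le_imp_le) auto
qed

lemma norm_le_norm_inf: "norm (block X i) \<le> norm_inf X"
  unfolding norm_inf_def by (rule Max_ge) auto

lemma transpose_mult_blocks:
  "transpose X ** Y = (\<Sum>i\<in>UNIV. transpose (block X i) ** block Y i)"
  for X Y :: "('n::finite, 'd::finite) stack"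
  by (simp add: vec_eq_iff block_def matrix_matrix_mult_def transpose_def sum_component sum_UNIV_prod)

lemma orth_stackD: "G \<in> orth_stack \<Longrightarrow> orthogonal_matrix (block G i)"
  by (simp add: orth_stack_def)

lemma orth_stack_mult: "G \<in> orth_stack \<Longrightarrow> orthogonal_matrix Q \<Longrightarrow> G ** Q \<in> orth_stack"
  by (simp add: orth_stack_def orthogonal_matrix_mult)

lemma orth_stack_gram:
  "G \<in> orth_stack \<Longrightarrow> transpose G ** G = real CARD('n) *\<^sub>R mat 1"
  for G :: "('n::finite, 'd::finite) stack"
  by (simp add: transpose_mult_blocks orth_tr orth_stackD sum_constant_scaleR del: sum_constant)

section \<open>Calculus of smooth functions\<close>

lemma Ck_on_cong:
  assumes "open S" "\<And>x. x \<in> S \<Longrightarrow> f x = g x"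
  shows "Ck_on k S f \<longleftrightarrow> Ck_on k S g"
  using assms(2)
proof (induction k arbitrary: f g)
  case 0
  then show ?case by (auto cong: continuous_on_cong)
next
  case (Suc k)
  have one: "Ck_on (Suc k) S b"
    if ab: "\<And>x. x \<in> S \<Longrightarrow> a x = b x" and a: "Ck_on (Suc k) S a" for a b :: "'a \<Rightarrow> 'b"
  proof -
    have d: "b differentiable (at x)" if "x \<in> S" for x
    proof -
      from a that obtain D where "(a has_derivative D) (at x)"
        by (auto simp: differentiable_def)
      from has_derivative_transform_within_open[OF this assms(1) that ab] show ?thesis
        by (auto simp: differentiable_def)
    qed
    have e: "frechet_derivative a (at x) = frechet_derivative b (at x)" if "x \<in> S" for x
      using a that by (intro frechet_derivative_transform_within_open[OF _ assms(1) that ab]) auto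
    have "Ck_on k S (\<lambda>x. frechet_derivative b (at x) v)" for v
      using a e Suc.IH[of "\<lambda>x. frechet_derivative a (at x) v" "\<lambda>x. frechet_derivative b (at x) v"]
      by simp
    with d show ?thesis by simp
  qed
  show ?case
    using one[of f g] one[of g f] Suc.prems by (auto simp del: Ck_on.simps)
qed

text \<open>Frees the inductions from \<open>frechet_derivative\<close>: by uniqueness of
  derivatives, any family of derivatives on the open set may serve.\<close>

lemma Ck_on_Suc_iff:
  assumes "open S"
  shows "Ck_on (Suc k) S f \<longleftrightarrow>
    (\<exists>f'. (\<forall>x\<in>S. (f has_derivative f' x) (at x)) \<and> (\<forall>v. Ck_on k S (\<lambda>x. f' x v)))"
proof
  assume "Ck_on (Suc k) S f"
  then show "\<exists>f'. (\<forall>x\<in>S. (f has_derivative f' x) (at x)) \<and> (\<forall>v. Ck_on k S (\<lambda>x. f' x v))"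
    by (intro exI[of _ "\<lambda>x. frechet_derivative f (at x)"]) (simp add: frechet_derivative_works)
next
  assume "\<exists>f'. (\<forall>x\<in>S. (f has_derivative f' x) (at x)) \<and> (\<forall>v. Ck_on k S (\<lambda>x. f' x v))"
  then obtain f' where f': "\<forall>x\<in>S. (f has_derivative f' x) (at x)" "\<forall>v. Ck_on k S (\<lambda>x. f' x v)"
    by blast
  have "Ck_on k S (\<lambda>x. frechet_derivative f (at x) v)" for v
  proof -
    have "frechet_derivative f (at x) v = f' x v" if "x \<in> S" for x
      using frechet_derivative_at[of f "f' x" x] f'(1) that by simp
    from Ck_on_cong[OF assms this] f'(2) show ?thesis by simp
  qed
  then show "Ck_on (Suc k) S f" using f'(1) by (auto simp: differentiable_def)
qed

lemma Ck_on_SucI: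
  assumes "open S" "\<And>x. x \<in> S \<Longrightarrow> (f has_derivative f' x) (at x)"
    "\<And>v. Ck_on k S (\<lambda>x. f' x v)"
  shows "Ck_on (Suc k) S f"
  unfolding Ck_on_Suc_iff[OF assms(1)] using assms(2,3) by blast

lemma Ck_on_SucE:
  assumes "open S" "Ck_on (Suc k) S f"
  obtains f' where "\<And>x. x \<in> S \<Longrightarrow> (f has_derivative f' x) (at x)"
    "\<And>v. Ck_on k S (\<lambda>x. f' x v)"
  using assms unfolding Ck_on_Suc_iff[OF assms(1)] by blast

lemma Ck_on_SucD: "open S \<Longrightarrow> Ck_on (Suc k) S f \<Longrightarrow> Ck_on k S f"
proof (induction k arbitrary: f)
  case 0
  then show ?case
    by (auto intro!: differentiable_imp_continuous_on simp: differentiable_on_def differentiable_at_withinI)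
next
  case (Suc k)
  from Suc.prems show ?case
    by (auto intro: Suc.IH)
qed

lemma Ck_on_subset: "S \<subseteq> T \<Longrightarrow> Ck_on k T f \<Longrightarrow> Ck_on k S f"
  by (induction k arbitrary: f) (auto intro: continuous_on_subset)

lemma Ck_on_const: "Ck_on k S (\<lambda>x. c)"
  by (induction k arbitrary: c) auto

lemma Ck_on_bounded_linear:
  assumes "open S" "bounded_linear L" "Ck_on k S f"
  shows "Ck_on k S (\<lambda>x. L (f x))"
  using assms(3)
proof (induction k arbitrary: f)
  case 0
  then show ?case using bounded_linear.continuous_on[OF assms(2)] by simp
next
  case (Suc k)
  from Ck_on_SucE[OF assms(1) Suc.prems] obtain f' where
    f': "\<And>x. x \<in> S \<Longrightarrow> (f has_derivative f' x) (at x)" "\<And>v. Ck_on k S (\<lambda>x. f' x v)" by blast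
  show ?case
    by (rule Ck_on_SucI[OF assms(1), where f' = "\<lambda>x v. L (f' x v)"])
       (auto intro!: bounded_linear.has_derivative[OF assms(2)] f' Suc.IH)
qed

lemma Ck_on_add:
  assumes "open S" "Ck_on k S f" "Ck_on k S g"
  shows "Ck_on k S (\<lambda>x. f x + g x)"
  using assms(2,3)
proof (induction k arbitrary: f g)
  case 0
  then show ?case by (auto intro: continuous_intros)
next
  case (Suc k)
  from Ck_on_SucE[OF assms(1) Suc.prems(1)] obtain f' where
    f': "\<And>x. x \<in> S \<Longrightarrow> (f has_derivative f' x) (at x)" "\<And>v. Ck_on k S (\<lambda>x. f' x v)" by blast
  from Ck_on_SucE[OF assms(1) Suc.prems(2)] obtain g' where
    g': "\<And>x. x \<in> S \<Longrightarrow> (g has_derivative g' x) (at x)" "\<And>v. Ck_on k S (\<lambda>x. g' x v)" by blast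
  show ?case
    by (rule Ck_on_SucI[OF assms(1), where f' = "\<lambda>x v. f' x v + g' x v"])
       (auto intro!: has_derivative_add f' g' Suc.IH)
qed

lemma Ck_on_sum:
  assumes "open S" "\<And>i. i \<in> I \<Longrightarrow> Ck_on k S (f i)"
  shows "Ck_on k S (\<lambda>x. \<Sum>i\<in>I. f i x)"
  using assms(2)
  by (induction I rule: infinite_finite_induct) (auto intro: Ck_on_const Ck_on_add[OF assms(1)])

lemma Ck_on_bilinear:
  assumes "open S" "bounded_bilinear B" "Ck_on k S f" "Ck_on k S g"
  shows "Ck_on k S (\<lambda>x. B (f x) (g x))"
  using assms(3,4)
proof (induction k arbitrary: f g)
  case 0
  then show ?case using bounded_bilinear.continuous_on[OF assms(2)] by auto
next
  case (Suc k)
  from Ck_on_SucE[OF assms(1) Suc.prems(1)] obtain f' where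
    f': "\<And>x. x \<in> S \<Longrightarrow> (f has_derivative f' x) (at x)" "\<And>v. Ck_on k S (\<lambda>x. f' x v)" by blast
  from Ck_on_SucE[OF assms(1) Suc.prems(2)] obtain g' where
    g': "\<And>x. x \<in> S \<Longrightarrow> (g has_derivative g' x) (at x)" "\<And>v. Ck_on k S (\<lambda>x. g' x v)" by blast
  show ?case
  proof (rule Ck_on_SucI[OF assms(1), where f' = "\<lambda>x v. B (f x) (g' x v) + B (f' x v) (g x)"])
    show "((\<lambda>x. B (f x) (g x)) has_derivative (\<lambda>v. B (f x) (g' x v) + B (f' x v) (g x))) (at x)"
      if "x \<in> S" for x
      by (rule bounded_bilinear.FDERIV[OF assms(2) f'(1)[OF that] g'(1)[OF that]])
    show "Ck_on k S (\<lambda>x. B (f x) (g' x v) + B (f' x v) (g x))" for v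
      by (rule Ck_on_add[OF assms(1) Suc.IH[OF Ck_on_SucD[OF assms(1) Suc.prems(1)] g'(2)]
            Suc.IH[OF f'(2) Ck_on_SucD[OF assms(1) Suc.prems(2)]]])
  qed
qed

lemma Ck_on_compose:
  fixes g :: "'a::euclidean_space \<Rightarrow> 'b::euclidean_space" and f :: "'b \<Rightarrow> 'c::euclidean_space"
  assumes "open S" "open U" "Ck_on k S g" "Ck_on k U f" "g ` S \<subseteq> U"
  shows "Ck_on k S (\<lambda>x. f (g x))"
  using assms(3-5)
proof (induction k arbitrary: f g)
  case 0
  then show ?case by (auto intro: continuous_on_compose2)
next
  case (Suc k)
  from Ck_on_SucE[OF assms(1) Suc.prems(1)] obtain g' where
    g': "\<And>x. x \<in> S \<Longrightarrow> (g has_derivative g' x) (at x)" "\<And>v. Ck_on k S (\<lambda>x. g' x v)" by blast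
  from Ck_on_SucE[OF assms(2) Suc.prems(2)] obtain f' where
    f': "\<And>x. x \<in> U \<Longrightarrow> (f has_derivative f' x) (at x)" "\<And>v. Ck_on k U (\<lambda>x. f' x v)" by blast
  have gk: "Ck_on k S g" using Ck_on_SucD[OF assms(1) Suc.prems(1)] .
  show ?case
  \<comment> \<open>\<open>Ck_on\<close> differentiates in a fixed direction \<open>v\<close>, but
    the chain rule evaluates the derivative of \<open>f\<close> in the direction
    \<open>g' x v\<close>, which varies with \<open>x\<close>. Expanding that direction in
    \<open>Basis\<close> leaves only fixed directions, to which the induction hypothesis
    applies.\<close>
  proof (rule Ck_on_SucI[OF assms(1), where f' = "\<lambda>x v. \<Sum>b\<in>Basis. (g' x v \<bullet> b) *\<^sub>R f' (g x) b"])
    fix x assume x: "x \<in> S"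
    then have fx: "(f has_derivative f' (g x)) (at (g x))" using f'(1) Suc.prems(3) by auto
    have lin: "linear (f' (g x))" using fx has_derivative_linear by blast
    have "f' (g x) (g' x v) = (\<Sum>b\<in>Basis. (g' x v \<bullet> b) *\<^sub>R f' (g x) b)" for v
    proof -
      have "f' (g x) (g' x v) = f' (g x) (\<Sum>b\<in>Basis. (g' x v \<bullet> b) *\<^sub>R b)"
        by (simp add: euclidean_representation)
      then show ?thesis by (simp add: linear_sum[OF lin] linear_scale[OF lin])
    qed
    then show "((\<lambda>x. f (g x)) has_derivative (\<lambda>v. \<Sum>b\<in>Basis. (g' x v \<bullet> b) *\<^sub>R f' (g x) b)) (at x)"
      using has_derivative_compose[OF g'(1)[OF x] fx] by simp
  next
    fix v
    show "Ck_on k S (\<lambda>x. \<Sum>b\<in>Basis. (g' x v \<bullet> b) *\<^sub>R f' (g x) b)"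
      by (intro Ck_on_sum[OF assms(1)] Ck_on_bilinear[OF assms(1) bounded_bilinear_scaleR]
          Ck_on_bounded_linear[OF assms(1) bounded_linear_inner_left] g'
          Suc.IH[OF gk f'(2)] Suc.prems)
  qed
qed

lemma smooth_on_const: "smooth_on S (\<lambda>x. c)"
  by (simp add: smooth_on_def Ck_on_const)

lemma smooth_on_ident: "open S \<Longrightarrow> smooth_on S (\<lambda>x. x)"
  unfolding smooth_on_def
proof
  fix k assume S: "open S"
  show "Ck_on k S (\<lambda>x. x)"
  proof (cases k)
    case (Suc m)
    then show ?thesis
      by (auto intro!: Ck_on_SucI[OF S, where f' = "\<lambda>x v. v"] Ck_on_const)
  qed (simp add: continuous_on_id)
qed

lemma smooth_on_bounded_linear:
  assumes "open S" "bounded_linear L" "smooth_on S f"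
  shows "smooth_on S (\<lambda>x. L (f x))"
  using assms by (auto simp: smooth_on_def intro: Ck_on_bounded_linear)

lemma smooth_on_add:
  assumes "open S" "smooth_on S f" "smooth_on S g"
  shows "smooth_on S (\<lambda>x. f x + g x)"
  using assms by (auto simp: smooth_on_def intro: Ck_on_add)

lemma smooth_on_sum:
  assumes "open S" "\<And>i. i \<in> I \<Longrightarrow> smooth_on S (f i)"
  shows "smooth_on S (\<lambda>x. \<Sum>i\<in>I. f i x)"
  using assms by (auto simp: smooth_on_def intro: Ck_on_sum)

lemma smooth_on_bilinear:
  assumes "open S" "bounded_bilinear B" "smooth_on S f" "smooth_on S g"
  shows "smooth_on S (\<lambda>x. B (f x) (g x))"
  using assms by (auto simp: smooth_on_def intro: Ck_on_bilinear)

lemma smooth_on_compose: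
  assumes "open S" "open U" "smooth_on S g" "smooth_on U f" "g ` S \<subseteq> U"
  shows "smooth_on S (\<lambda>x. f (g x))"
  using assms by (auto simp: smooth_on_def intro: Ck_on_compose)

lemma smooth_on_cong:
  assumes "open S" "\<And>x. x \<in> S \<Longrightarrow> f x = g x"
  shows "smooth_on S f \<longleftrightarrow> smooth_on S g"
  using Ck_on_cong[OF assms] by (simp add: smooth_on_def)

lemma smooth_on_subset: "S \<subseteq> T \<Longrightarrow> smooth_on T f \<Longrightarrow> smooth_on S f"
  by (auto simp: smooth_on_def intro: Ck_on_subset)

text \<open>Needed because a smooth function on a submanifold comes with ambient extensions whose
  domains vary from point to point.\<close>

lemma smooth_on_local:
  assumes "open S" "\<And>x. x \<in> S \<Longrightarrow> \<exists>U. open U \<and> x \<in> U \<and> smooth_on U f"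
  shows "smooth_on S f"
proof -
  have "Ck_on k S f" if "\<And>x. x \<in> S \<Longrightarrow> \<exists>U. open U \<and> x \<in> U \<and> Ck_on k U f" for k
    using that
  proof (induction k arbitrary: f)
    case 0
    have "continuous (at x) f" if x: "x \<in> S" for x
    proof -
      from 0 x obtain U where "open U" "x \<in> U" "continuous_on U f" by auto
      then show ?thesis by (simp add: continuous_on_eq_continuous_at)
    qed
    then show ?case by (simp add: continuous_at_imp_continuous_on)
  next
    case (Suc k)
    have d: "f differentiable (at x)" if "x \<in> S" for x
      using Suc.prems[OF that] by auto
    have "Ck_on k S (\<lambda>x. frechet_derivative f (at x) v)" for v
    proof (rule Suc.IH)
      fix x assume "x \<in> S"
      from Suc.prems[OF this] show "\<exists>U. open U \<and> x \<in> U \<and> Ck_on k U (\<lambda>x. frechet_derivative f (at x) v)"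
        by auto
    qed
    with d show ?case by simp
  qed
  moreover have "\<exists>U. open U \<and> x \<in> U \<and> Ck_on k U f" if "x \<in> S" for x k
    using assms(2)[OF that] unfolding smooth_on_def by blast
  ultimately show ?thesis unfolding smooth_on_def by blast
qed

lemma smooth_on_differentiable: "smooth_on S f \<Longrightarrow> x \<in> S \<Longrightarrow> f differentiable (at x)"
  unfolding smooth_on_def using Ck_on.simps(2)[of 0 S f] by blast

lemma smooth_on_has_vector_derivative:
  fixes f :: "real \<Rightarrow> 'a::euclidean_space"
  assumes "smooth_on S f" "x \<in> S"
  shows "(f has_vector_derivative vector_derivative f (at x)) (at x)"
  using smooth_on_differentiable[OF assms] vector_derivative_works by blast

lemma smooth_on_vector_derivative:
  fixes f :: "real \<Rightarrow> 'a::euclidean_space"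
  assumes S: "open S" and f: "smooth_on S f"
  shows "smooth_on S (\<lambda>x. vector_derivative f (at x))"
  unfolding smooth_on_def
proof
  fix k
  have "Ck_on (Suc k) S f" using f by (simp add: smooth_on_def)
  then have "Ck_on k S (\<lambda>x. frechet_derivative f (at x) 1)" by simp
  then show "Ck_on k S (\<lambda>x. vector_derivative f (at x))"
    using Ck_on_cong[OF S, of "\<lambda>x. frechet_derivative f (at x) 1" "\<lambda>x. vector_derivative f (at x)" k]
      frechet_derivative_eq_vector_derivative[OF smooth_on_differentiable[OF f]] by simp
qed

lemma smooth_on_continuous_on: "smooth_on S f \<Longrightarrow> continuous_on S f"
  unfolding smooth_on_def using Ck_on.simps(1) by blast

section \<open>The Cayley transform\<close>

text \<open>The lower bound makes the kernel trivial, and a square matrix with trivial kernel is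
  invertible; the same bound then controls the inverse.\<close>

lemma matrix_inverse_if_vector_bound:
  fixes M :: "real^'n^'n"
  assumes "\<And>v. c * norm v \<le> norm (M *v v)" "c > 0"
  shows "matrix_inv M ** M = mat 1" "M ** matrix_inv M = mat 1"
    "norm (matrix_inv M *v v) \<le> norm v / c"
proof -
  have "M *v x = 0 \<Longrightarrow> x = 0" for x
    using assms(1)[of x] assms(2) by (simp add: mult_le_0_iff)
  then obtain B where "B ** M = mat 1"
    using matrix_left_invertible_ker by blast
  then have inv: "invertible M"
    unfolding invertible_def using matrix_left_right_inverse by blast
  then show 1: "matrix_inv M ** M = mat 1" "M ** matrix_inv M = mat 1"
    using someI_ex[OF inv[unfolded invertible_def]] by (auto simp: matrix_inv_def)
  have "c * norm (matrix_inv M *v v) \<le> norm v"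
    using assms(1)[of "matrix_inv M *v v"] by (simp add: matrix_vector_mul_assoc 1)
  then show "norm (matrix_inv M *v v) \<le> norm v / c"
    using assms(2) by (simp add: field_simps)
qed

text \<open>The Cayley transform \<open>(I - t S)\<^sup>-\<^sup>1 (I + t S)\<close> equals \<open>2 R - I\<close> for the resolvent
  \<open>R = (I - t S)\<^sup>-\<^sup>1\<close>.\<close>

definition resolvent :: "real^'n^'n \<Rightarrow> real \<Rightarrow> real^'n^'n" where
  "resolvent S t = matrix_inv (mat 1 - t *\<^sub>R S)"

definition cayley :: "real^'n^'n \<Rightarrow> real \<Rightarrow> real^'n^'n" where
  "cayley S t = 2 *\<^sub>R resolvent S t - mat 1"

text \<open>Multiplying the second hypothesis by R^T on the left and \<open>R\<close> on the right
  gives 2 R^T R = R + R^T, which cancels everything but the identity in (2 R - I)^T (2 R -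
  I).\<close>

lemma cayley_orthogonal_aux:
  fixes M R :: "real^'n^'n"
  assumes "M ** R = mat 1" "M + transpose M = 2 *\<^sub>R mat 1"
  shows "orthogonal_matrix (2 *\<^sub>R R - mat 1)"
proof -
  have "transpose R ** transpose M = mat 1"
    using assms(1) by (metis matrix_transpose_mul transpose_mat)
  then have "transpose R ** (M + transpose M) ** R = transpose R + R"
    by (simp add: mm_simps assms(1) flip: matrix_mul_assoc)
  then have "2 *\<^sub>R (transpose R ** R) = transpose R + R"
    unfolding assms(2) by (simp add: mm_simps)
  then show ?thesis
    unfolding orthogonal_matrix by (simp add: mm_simps)
qed

context
  fixes S :: "real^'n^'n"
  assumes S: "skew S"
begin

text \<open>\<open>S *v v\<close> is orthogonal to \<open>v\<close>, so Pythagoras applies. Hence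
  the resolvent exists for every \<open>t\<close> and is a contraction, and the Cayley curve is
  defined on the whole line.\<close>

lemma norm_resolvent_denom: "norm v \<le> norm ((mat 1 - t *\<^sub>R S) *v v)"
proof -
  have "(mat 1 - t *\<^sub>R S) *v v = v - t *\<^sub>R (S *v v)"
    by (simp add: matrix_vector_mult_diff_rdistrib scaleR_matrix_vector_assoc)
  then have "(norm ((mat 1 - t *\<^sub>R S) *v v))\<^sup>2 = (norm v)\<^sup>2 + t\<^sup>2 * (norm (S *v v))\<^sup>2"
    using skew_inner_zero[OF S, of v]
    unfolding power2_norm_eq_inner
    by (simp add: inner_diff_left inner_diff_right inner_commute power2_eq_square)
  then have "(norm v)\<^sup>2 \<le> (norm ((mat 1 - t *\<^sub>R S) *v v))\<^sup>2" by simp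
  then show ?thesis by (rule power2_le_imp_le) auto
qed

lemma resolvent_inverse:
  "resolvent S t ** (mat 1 - t *\<^sub>R S) = mat 1" "(mat 1 - t *\<^sub>R S) ** resolvent S t = mat 1"
  "norm (resolvent S t *v v) \<le> norm v"
  using matrix_inverse_if_vector_bound[of 1 "mat 1 - t *\<^sub>R S"] norm_resolvent_denom
  by (auto simp: resolvent_def)

lemma norm_resolvent_mult: "norm (resolvent S t ** X) \<le> norm X"
  using norm_mult_le_of_vector[of "resolvent S t" 1 X] resolvent_inverse(3) by simp

lemma resolvent_commute: "resolvent S t ** S = S ** resolvent S t"
proof -
  have "resolvent S t ** S = resolvent S t ** S ** ((mat 1 - t *\<^sub>R S) ** resolvent S t)"
    by (simp add: resolvent_inverse)
  also have "\<dots> = resolvent S t ** (S ** (mat 1 - t *\<^sub>R S)) ** resolvent S t"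
    by (simp add: matrix_mul_assoc)
  also have "S ** (mat 1 - t *\<^sub>R S) = (mat 1 - t *\<^sub>R S) ** S"
    by (simp add: mm_simps)
  finally show ?thesis by (simp add: resolvent_inverse matrix_mul_assoc)
qed

lemma resolvent_diff:
  "resolvent S s - resolvent S t = (s - t) *\<^sub>R (resolvent S s ** S ** resolvent S t)"
proof -
  have "resolvent S s - resolvent S t
      = resolvent S s ** ((mat 1 - t *\<^sub>R S) ** resolvent S t)
        - (resolvent S s ** (mat 1 - s *\<^sub>R S)) ** resolvent S t"
    by (simp add: resolvent_inverse)
  also have "\<dots> = resolvent S s ** ((mat 1 - t *\<^sub>R S) - (mat 1 - s *\<^sub>R S)) ** resolvent S t"
    by (simp only: mm.diff_left mm.diff_right matrix_mul_assoc)
  also have "(mat 1 - t *\<^sub>R S) - (mat 1 - s *\<^sub>R S) = (s - t) *\<^sub>R S"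
    by (simp add: scaleR_diff_left)
  finally show ?thesis by (simp add: mm_simps)
qed

text \<open>By the resolvent identity the difference quotient equals R_s S R_t exactly. Together
  with the contraction bound the same identity yields continuity of the resolvent, which then
  identifies the limit.\<close>

lemma resolvent_has_vector_derivative:
  "(resolvent S has_vector_derivative (resolvent S t ** S ** resolvent S t)) (at t)"
proof -
  let ?R = "resolvent S"
  have b: "norm (?R s ** S ** ?R t) \<le> norm S * norm (?R t)" for s
    using norm_resolvent_mult[of s "S ** ?R t"] norm_matrix_mult_le[of S "?R t"]
    by (simp add: matrix_mul_assoc)
  have "((\<lambda>s. ?R s - ?R t) \<longlongrightarrow> 0) (at t)"
  proof (rule Lim_null_comparison)
    show "\<forall>\<^sub>F s in at t. norm (?R s - ?R t) \<le> \<bar>s - t\<bar> * (norm S * norm (?R t))"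
      unfolding resolvent_diff by (auto intro!: eventuallyI mult_left_mono b)
    have "((\<lambda>s. \<bar>s - t\<bar> * (norm S * norm (?R t))) \<longlongrightarrow> \<bar>t - t\<bar> * (norm S * norm (?R t))) (at t)"
      by (intro tendsto_intros)
    then show "((\<lambda>s. \<bar>s - t\<bar> * (norm S * norm (?R t))) \<longlongrightarrow> 0) (at t)" by simp
  qed
  then have "(?R \<longlongrightarrow> ?R t) (at t)" by (simp add: LIM_zero_iff)
  then have "((\<lambda>s. ?R s ** S ** ?R t) \<longlongrightarrow> ?R t ** S ** ?R t) (at t)"
    by (intro mm.tendsto tendsto_const)
  then have lim: "((\<lambda>s. norm (?R s ** S ** ?R t - ?R t ** S ** ?R t)) \<longlongrightarrow> 0) (at t)"
    by (simp add: LIM_zero_iff tendsto_norm_zero_iff)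
  have "norm (?R s - ?R t - (s - t) *\<^sub>R (?R t ** S ** ?R t)) / norm (s - t)
      = norm (?R s ** S ** ?R t - ?R t ** S ** ?R t)" if "s \<noteq> t" for s
    unfolding resolvent_diff scaleR_right_diff_distrib[symmetric] using that by simp
  then have "((\<lambda>s. norm (?R s - ?R t - (s - t) *\<^sub>R (?R t ** S ** ?R t)) / norm (s - t)) \<longlongrightarrow> 0) (at t)"
    using lim by (subst Lim_cong_within) auto
  then show ?thesis
    unfolding has_vector_derivative_def has_derivative_iff_norm
    by (auto intro: bounded_linear_scaleR_left)
qed

lemma smooth_resolvent: "smooth_on UNIV (resolvent S)"
  unfolding smooth_on_def
proof
  fix k
  show "Ck_on k UNIV (resolvent S)"
  proof (induction k)
    case 0
    then show ?case
      by (auto intro!: continuous_at_imp_continuous_on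
          has_vector_derivative_continuous[OF resolvent_has_vector_derivative])
  next
    case (Suc k)
    have c: "Ck_on k UNIV (\<lambda>t. resolvent S t ** S ** resolvent S t)"
      by (intro Ck_on_bilinear[OF _ bounded_bilinear_matrix_mult] Suc.IH Ck_on_const) auto
    show ?case
    proof (rule Ck_on_SucI)
      show "(resolvent S has_derivative (\<lambda>v. v *\<^sub>R (resolvent S t ** S ** resolvent S t))) (at t)" for t
        using resolvent_has_vector_derivative by (simp add: has_vector_derivative_def)
      show "Ck_on k UNIV (\<lambda>t. v *\<^sub>R (resolvent S t ** S ** resolvent S t))" for v
        by (rule Ck_on_bounded_linear[OF _ bounded_linear_scaleR_right c]) auto
    qed auto
  qed
qed

lemma orthogonal_cayley: "orthogonal_matrix (cayley S t)"
  unfolding cayley_def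
  by (rule cayley_orthogonal_aux[OF resolvent_inverse(2)]) (simp add: mm_simps S scaleR_2)

lemma cayley_0: "cayley S 0 = mat 1"
proof -
  have "resolvent S 0 = mat 1"
    using resolvent_inverse(1)[of 0] by simp
  then show ?thesis by (simp add: cayley_def scaleR_2)
qed

lemma cayley_has_vector_derivative:
  "(cayley S has_vector_derivative 2 *\<^sub>R (resolvent S t ** S ** resolvent S t)) (at t)"
proof -
  have "((\<lambda>t. 2 *\<^sub>R resolvent S t - mat 1) has_vector_derivative
      2 *\<^sub>R (resolvent S t ** S ** resolvent S t) - 0) (at t)"
    by (intro has_vector_derivative_diff has_vector_derivative_const
        bounded_linear.has_vector_derivative[OF bounded_linear_scaleR_right] resolvent_has_vector_derivative)
  then show ?thesis by (simp add: cayley_def[abs_def])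
qed

lemma smooth_cayley: "smooth_on UNIV (cayley S)"
proof -
  have "smooth_on UNIV (\<lambda>t. 2 *\<^sub>R resolvent S t + (- mat 1))"
    by (intro smooth_on_add smooth_on_bounded_linear[OF _ bounded_linear_scaleR_right]
        smooth_resolvent smooth_on_const) auto
  then show ?thesis by (simp add: cayley_def[abs_def])
qed

text \<open>Commuting brings both resolvents to the left of \<open>S\<close>, where the contraction
  bound applies twice.\<close>

lemma norm_cayley_derivative: "norm (vector_derivative (cayley S) (at t)) \<le> 2 * norm S"
proof -
  have "resolvent S t ** S ** resolvent S t = resolvent S t ** (resolvent S t ** S)"
    by (simp add: resolvent_commute matrix_mul_assoc)
  then have "norm (resolvent S t ** S ** resolvent S t) \<le> norm S"
    using norm_resolvent_mult[of t S] norm_resolvent_mult[of t "resolvent S t ** S"] by simp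
  then show ?thesis
    by (simp add: vector_derivative_at[OF cayley_has_vector_derivative])
qed

end

lemma orthogonal_curve_exists:
  fixes A :: "real^'n^'n"
  assumes "skew A"
  obtains c where "smooth_on UNIV c" "\<And>t. orthogonal_matrix (c t)" "c 0 = mat 1"
    "(c has_vector_derivative A) (at 0)"
proof
  \<comment> \<open>The factor 1/2 compensates the velocity 2 S of the Cayley curve at 0.\<close>
  have sk: "skew ((1/2) *\<^sub>R A)" using assms by (simp add: mm_simps)
  show "smooth_on UNIV (cayley ((1/2) *\<^sub>R A))" "\<And>t. orthogonal_matrix (cayley ((1/2) *\<^sub>R A) t)"
    "cayley ((1/2) *\<^sub>R A) 0 = mat 1"
    by (auto intro!: smooth_cayley orthogonal_cayley cayley_0 sk)
  have "resolvent ((1/2) *\<^sub>R A) 0 = mat 1"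
    using resolvent_inverse(1)[OF sk, of 0] by simp
  then show "(cayley ((1/2) *\<^sub>R A) has_vector_derivative A) (at 0)"
    using cayley_has_vector_derivative[OF sk, of 0] by simp
qed

text \<open>Inverts the Cayley transform. Near the identity R = (Q + I) / 2 is invertible, and S = I
  - R^-1 is the skew matrix whose resolvent at 1 is R, so its Cayley curve reaches \<open>Q\<close>
  at time 1.\<close>

lemma orthogonal_path_exists:
  fixes Q :: "real^'n^'n"
  assumes Q: "orthogonal_matrix Q" and near: "norm (Q - mat 1) \<le> 1/4"
  obtains c where "smooth_on UNIV c" "\<And>t. orthogonal_matrix (c t)" "c 0 = mat 1" "c 1 = Q"
    "\<And>t. norm (vector_derivative c (at t)) \<le> 8/7 * norm (Q - mat 1)"
proof -
  define R where "R = (1/2) *\<^sub>R (Q + mat 1)"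
  have R2: "2 *\<^sub>R R - mat 1 = Q" by (simp add: R_def)
  \<comment> \<open>\<open>R\<close> differs from the identity by half of \<open>Q - mat 1\<close>,
    hence by at most 1/8; the inverse is therefore bounded by 8/7.\<close>
  have lower: "7/8 * norm v \<le> norm (R *v v)" for v
  proof -
    have "R *v v = v + (1/2) *\<^sub>R ((Q - mat 1) *v v)"
      by (simp add: R_def matrix_vector_mult_add_rdistrib matrix_vector_mult_diff_rdistrib
          scaleR_right_diff_distrib algebra_simps flip: scaleR_matrix_vector_assoc)
        (simp add: vec_eq_iff)
    moreover have "norm ((Q - mat 1) *v v) \<le> 1/4 * norm v"
      using norm_matrix_vector_le[of "Q - mat 1" v] near mult_right_mono[OF near, of "norm v"] by simp
    ultimately show ?thesis
      using norm_triangle_ineq4[of "R *v v" "(1/2) *\<^sub>R ((Q - mat 1) *v v)"] by simp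
  qed
  define M where "M = matrix_inv R"
  have M: "M ** R = mat 1" "R ** M = mat 1" "norm (M *v v) \<le> 8/7 * norm v" for v
    using matrix_inverse_if_vector_bound[of "7/8" R] lower by (auto simp: M_def mult.commute)
  have tM: "transpose M ** transpose R = mat 1"
    using M(2) by (metis matrix_transpose_mul transpose_mat)
  \<comment> \<open>Orthogonality of \<open>Q\<close> in terms of \<open>R\<close>. Multiplied by
    M^T and M, where M = R^-1, it becomes M + M^T = 2 I, that is, skewness of I - M.\<close>
  have "4 *\<^sub>R (transpose R ** R) = 2 *\<^sub>R (transpose R + R)"
    using Q by (simp add: R_def mm_simps orth_tr algebra_simps)
  then have e1: "4 *\<^sub>R (transpose M ** (transpose R ** R) ** M) = 2 *\<^sub>R (transpose M ** (transpose R + R) ** M)"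
    by (metis mm.scaleR_left mm.scaleR_right)
  have e2: "transpose M ** (transpose R ** R) ** M = mat 1"
    by (simp add: matrix_mul_assoc tM M)
  have e3: "transpose M ** (transpose R + R) ** M = M + transpose M"
    by (simp add: mm_simps matrix_mul_assoc tM) (simp add: M flip: matrix_mul_assoc)
  have MM: "M + transpose M = 2 *\<^sub>R mat 1"
  proof -
    have "2 *\<^sub>R (M + transpose M) = 2 *\<^sub>R (2 *\<^sub>R mat 1)"
      using e1 e2 e3 by simp
    then show ?thesis by (simp only: scaleR_cancel_left) simp
  qed
  define S where "S = mat 1 - M"
  have sk: "skew S" using MM by (simp add: S_def mm_simps scaleR_2 algebra_simps)
  have res: "resolvent S 1 = R"
  proof -
    have "resolvent S 1 ** M = mat 1" using resolvent_inverse(1)[OF sk, of 1] by (simp add: S_def)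
    then have "resolvent S 1 ** (M ** R) = R" by (simp add: matrix_mul_assoc)
    then show ?thesis by (simp add: M)
  qed
  have "S = M ** (R - mat 1)" by (simp add: S_def mm_simps M)
  also have "R - mat 1 = (1/2) *\<^sub>R (Q - mat 1)"
    by (simp add: R_def vec_eq_iff algebra_simps)
  finally have "norm S \<le> 8/7 * norm ((1/2) *\<^sub>R (Q - mat 1))"
    using norm_mult_le_of_vector[OF M(3), of "(1/2) *\<^sub>R (Q - mat 1)"] by simp
  then have nS: "2 * norm S \<le> 8/7 * norm (Q - mat 1)" by simp
  show thesis
  proof (rule that[of "cayley S"])
    show "cayley S 1 = Q" by (simp add: cayley_def res R2)
    show "norm (vector_derivative (cayley S) (at t)) \<le> 8/7 * norm (Q - mat 1)" for t
      using norm_cayley_derivative[OF sk, of t] nS by linarith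
  qed (auto intro: smooth_cayley orthogonal_cayley cayley_0 sk)
qed

section \<open>Tangent, vertical and horizontal spaces\<close>

lemma curve_at_velocity:
  "curve_at M x \<gamma> \<Longrightarrow> (\<gamma> has_vector_derivative velocity \<gamma>) (at 0)"
  unfolding curve_at_def velocity_def
  by (auto intro: smooth_on_has_vector_derivative)

lemma curve_atE:
  assumes "curve_at M x \<gamma>"
  obtains e where "e > 0" "\<And>t. t \<in> {-e<..<e} \<Longrightarrow> \<gamma> t \<in> M" "\<gamma> 0 = x"
  using assms unfolding curve_at_def image_subset_iff by blast

lemma curve_at_UNIV:
  assumes "smooth_on UNIV \<gamma>" "\<And>t. \<gamma> t \<in> M" "\<gamma> 0 = x"
  shows "curve_at M x \<gamma>"
  unfolding curve_at_def using assms
  by (auto intro!: exI[of _ 1] intro: smooth_on_subset)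

text \<open>Tangent vectors are velocities at time 0; shifting time makes the velocity at any other
  time a tangent vector as well.\<close>

lemma curve_at_translate:
  fixes \<gamma> :: "real \<Rightarrow> 'a::euclidean_space"
  assumes "open J" "t \<in> J" "smooth_on J \<gamma>" "\<And>s. s \<in> J \<Longrightarrow> \<gamma> s \<in> M"
  shows "curve_at M (\<gamma> t) (\<lambda>s. \<gamma> (t + s))"
    "velocity (\<lambda>s. \<gamma> (t + s)) = vector_derivative \<gamma> (at t)"
proof -
  from assms obtain e where e: "e > 0" "ball t e \<subseteq> J"
    using open_contains_ball by blast
  have im: "(\<lambda>s. t + s) ` {-e<..<e} \<subseteq> J"
  proof
    fix r assume "r \<in> (\<lambda>s. t + s) ` {-e<..<e}"
    then have "r \<in> ball t e" by (auto simp: dist_real_def)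
    then show "r \<in> J" using e(2) by blast
  qed
  have "smooth_on {-e<..<e} (\<lambda>s. \<gamma> (t + s))"
    by (rule smooth_on_compose[OF _ assms(1) _ assms(3) im])
       (auto intro!: smooth_on_add smooth_on_const smooth_on_ident)
  then show "curve_at M (\<gamma> t) (\<lambda>s. \<gamma> (t + s))"
    unfolding curve_at_def using e(1) im assms(4) by auto
  have "(\<gamma> has_vector_derivative vector_derivative \<gamma> (at t)) (at (t + 0))"
    using smooth_on_has_vector_derivative[OF assms(3,2)] by simp
  then have "((\<lambda>s. \<gamma> (t + s)) has_vector_derivative vector_derivative \<gamma> (at t)) (at 0)"
    using vector_diff_chain_at[of "\<lambda>s. t + s" 1 0 \<gamma> "vector_derivative \<gamma> (at t)"]
      has_vector_derivative_add[OF has_vector_derivative_const has_vector_derivative_id, of t "at 0"]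
    by (simp add: o_def)
  then show "velocity (\<lambda>s. \<gamma> (t + s)) = vector_derivative \<gamma> (at t)"
    unfolding velocity_def by (rule vector_derivative_at)
qed

lemma tangent_curve_exists:
  fixes G v :: "('n::finite, 'd::finite) stack"
  assumes G: "G \<in> orth_stack" and v: "\<And>i. skew (transpose (block G i) ** block v i)"
  obtains \<gamma> where "smooth_on UNIV \<gamma>" "\<And>t. \<gamma> t \<in> orth_stack" "\<gamma> 0 = G"
    "(\<gamma> has_vector_derivative v) (at 0)"
proof -
  have "\<exists>c. smooth_on UNIV c \<and> (\<forall>t. orthogonal_matrix (c t)) \<and> c 0 = mat 1 \<and>
      (c has_vector_derivative (transpose (block G i) ** block v i)) (at 0)" for i
    using orthogonal_curve_exists[OF v[of i]] by metis
  then obtain c where c: "\<And>i. smooth_on UNIV (c i)" "\<And>i t. orthogonal_matrix (c i t)"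
    "\<And>i. c i 0 = mat 1"
    "\<And>i. (c i has_vector_derivative (transpose (block G i) ** block v i)) (at 0)"
    by metis
  define \<gamma> where "\<gamma> = (\<lambda>t. stack_of (\<lambda>i. block G i ** c i t))"
  have v_eq: "stack_of (\<lambda>i. block G i ** (transpose (block G i) ** block v i)) = v"
    by (simp add: stack_eq_iff matrix_mul_assoc orth_tr orth_stackD[OF G])
  show thesis
  proof (rule that[of \<gamma>])
    show "smooth_on UNIV \<gamma>"
      unfolding \<gamma>_def stack_of_eq_sum
      by (intro smooth_on_sum smooth_on_bounded_linear[OF _ bounded_linear_embed_block]
          smooth_on_bounded_linear[OF _ mm.bounded_linear_right] c) auto
    show "\<gamma> t \<in> orth_stack" for t
      using c(2) orth_stackD[OF G] by (simp add: \<gamma>_def orth_stack_def orthogonal_matrix_mult)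
    show "\<gamma> 0 = G" by (simp add: \<gamma>_def stack_eq_iff c(3))
    have "(\<gamma> has_vector_derivative
        (\<Sum>i\<in>UNIV. embed_block i (block G i ** (transpose (block G i) ** block v i)))) (at 0)"
      unfolding \<gamma>_def stack_of_eq_sum
      by (intro has_vector_derivative_sum bounded_linear.has_vector_derivative[OF bounded_linear_embed_block]
          bounded_linear.has_vector_derivative[OF mm.bounded_linear_right] c)
    then show "(\<gamma> has_vector_derivative v) (at 0)"
      unfolding stack_of_eq_sum[symmetric] v_eq .
  qed
qed

lemma tangent_orth_stack:
  fixes G v :: "('n::finite, 'd::finite) stack"
  assumes G: "G \<in> orth_stack"
  shows "v \<in> tangent orth_stack G \<longleftrightarrow> (\<forall>i. skew (transpose (block G i) ** block v i))"
proof
  assume "\<forall>i. skew (transpose (block G i) ** block v i)"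
  with tangent_curve_exists[OF G, of v] obtain \<gamma> where \<gamma>: "smooth_on UNIV \<gamma>"
    "\<And>t. \<gamma> t \<in> orth_stack" "\<gamma> 0 = G" "(\<gamma> has_vector_derivative v) (at 0)"
    by metis
  have "curve_at orth_stack G \<gamma>" "velocity \<gamma> = v"
    using \<gamma> by (auto intro: curve_at_UNIV vector_derivative_at simp: velocity_def)
  then show "v \<in> tangent orth_stack G" unfolding tangent_def by blast
next
  assume "v \<in> tangent orth_stack G"
  then obtain \<gamma> where \<gamma>: "curve_at orth_stack G \<gamma>" "v = velocity \<gamma>"
    unfolding tangent_def by blast
  then obtain e where e: "e > 0" "\<And>t. t \<in> {-e<..<e} \<Longrightarrow> \<gamma> t \<in> orth_stack" "\<gamma> 0 = G"
    using curve_atE by metis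
  show "\<forall>i. skew (transpose (block G i) ** block v i)"
  proof
    fix i
    let ?B = "\<lambda>t. block (\<gamma> t) i"
    have B: "(?B has_vector_derivative block v i) (at 0)"
      using bounded_linear.has_vector_derivative[OF bounded_linear_block curve_at_velocity[OF \<gamma>(1)]] \<gamma>(2)
      by simp
    have "((\<lambda>t. transpose (?B t) ** ?B t) has_vector_derivative
        (transpose (?B 0) ** block v i + transpose (block v i) ** ?B 0)) (at 0)"
      by (rule mm.has_vector_derivative[OF
          bounded_linear.has_vector_derivative[OF bounded_linear_transpose B] B])
    then have "((\<lambda>t. mat 1) has_vector_derivative
        (transpose (?B 0) ** block v i + transpose (block v i) ** ?B 0)) (at 0)"
      by (rule has_vector_derivative_transform_within_open[where S = "{-e<..<e}"])
         (use e in \<open>auto simp: orth_tr orth_stackD\<close>)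
    from vector_derivative_unique_at[OF this has_vector_derivative_const]
    show "skew (transpose (block G i) ** block v i)"
      by (simp add: mm_simps e(3) eq_neg_iff_add_eq_0 add.commute)
  qed
qed

section \<open>Orbits, fibres and horizontal vectors\<close>

lemma orbit_mult:
  assumes "orthogonal_matrix Q"
  shows "orbit (X ** Q) = orbit X"
proof -
  have "\<exists>Q'. X ** Q ** R = X ** Q' \<and> orthogonal_matrix Q'" if "orthogonal_matrix R" for R
    using that assms by (metis matrix_mul_assoc orthogonal_matrix_mult)
  moreover have "\<exists>Q'. X ** R = X ** Q ** Q' \<and> orthogonal_matrix Q'" if "orthogonal_matrix R" for R
    using that assms
    by (intro exI[of _ "transpose Q ** R"]) (simp add: orthogonal_matrix_mult matrix_mul_assoc orth_tr)
  ultimately show ?thesis unfolding orbit_def by blast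
qed

lemma orbit_self: "X \<in> orbit X"
  unfolding orbit_def using orthogonal_matrix_id matrix_mul_rid by (auto intro!: exI[of _ "mat 1"])

lemma orbit_in_quot: "G \<in> orth_stack \<Longrightarrow> orbit G \<in> quot"
  by (simp add: quot_def)

lemma tangent_fibre:
  fixes G w :: "('n::finite, 'd::finite) stack"
  assumes G: "G \<in> orth_stack"
  shows "w \<in> tangent (fibre G) G \<longleftrightarrow> (\<exists>A. skew A \<and> w = G ** A)"
proof
  assume "\<exists>A. skew A \<and> w = G ** A"
  then obtain A where A: "skew A" "w = G ** A" by blast
  from orthogonal_curve_exists[OF A(1)] obtain c where
    c: "smooth_on UNIV c" "\<And>t. orthogonal_matrix (c t)" "c 0 = mat 1" "(c has_vector_derivative A) (at 0)"
    by metis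
  have "curve_at (fibre G) G (\<lambda>t. G ** c t)"
    by (rule curve_at_UNIV)
       (auto simp: fibre_def orbit_mult orth_stack_mult G c intro!: smooth_on_bounded_linear[OF _ mm.bounded_linear_right])
  moreover have "((\<lambda>t. G ** c t) has_vector_derivative w) (at 0)"
    unfolding A(2) by (rule bounded_linear.has_vector_derivative[OF mm.bounded_linear_right c(4)])
  then have "velocity (\<lambda>t. G ** c t) = w" unfolding velocity_def by (rule vector_derivative_at)
  ultimately show "w \<in> tangent (fibre G) G" unfolding tangent_def by blast
next
  fix i :: 'n
  assume "w \<in> tangent (fibre G) G"
  then obtain \<gamma> where \<gamma>: "curve_at (fibre G) G \<gamma>" "w = velocity \<gamma>"
    unfolding tangent_def by blast
  then obtain e where e: "e > 0" "\<And>t. t \<in> {-e<..<e} \<Longrightarrow> \<gamma> t \<in> fibre G" "\<gamma> 0 = G"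
    using curve_atE by metis
  have "curve_at orth_stack G \<gamma>"
    using \<gamma>(1) unfolding curve_at_def fibre_def by auto
  then have "w \<in> tangent orth_stack G" unfolding tangent_def \<gamma>(2) by blast
  then have sk: "skew (transpose (block G i) ** block w i)"
    using tangent_orth_stack[OF G] by simp
  \<comment> \<open>Every point of the fibre has the form \<open>G ** Q\<close>, and
    \<open>?T\<close> fixes such points. Being linear, it also fixes velocities of curves in the
    fibre, which exhibits the factor \<open>A\<close> as
    \<open>transpose (block G i) ** block w i\<close> for an arbitrary block
    \<open>i\<close>.\<close>
  let ?T = "\<lambda>X. G ** (transpose (block G i) ** block X i)"
  have bl: "bounded_linear ?T"
    by (rule bounded_linear_compose[OF mm.bounded_linear_right
        bounded_linear_compose[OF mm.bounded_linear_right bounded_linear_block]])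
  have T: "?T (\<gamma> t) = \<gamma> t" if "t \<in> {-e<..<e}" for t
  proof -
    have "\<gamma> t \<in> orbit G" using e(2)[OF that] orbit_self[of "\<gamma> t"] by (simp add: fibre_def)
    then obtain Q where "\<gamma> t = G ** Q" unfolding orbit_def by blast
    then show ?thesis by (simp add: matrix_mul_assoc orth_tr orth_stackD[OF G] flip: matrix_mul_assoc)
        (simp add: matrix_mul_assoc orth_tr orth_stackD[OF G])
  qed
  have "((\<lambda>t. ?T (\<gamma> t)) has_vector_derivative ?T w) (at 0)"
    unfolding \<gamma>(2) by (rule bounded_linear.has_vector_derivative[OF bl curve_at_velocity[OF \<gamma>(1)]])
  then have "(\<gamma> has_vector_derivative ?T w) (at 0)"
    by (rule has_vector_derivative_transform_within_open[where S = "{-e<..<e}"]) (use e T in auto)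
  then have "w = ?T w"
    using curve_at_velocity[OF \<gamma>(1)] \<gamma>(2) vector_derivative_unique_at by blast
  then show "\<exists>A. skew A \<and> w = G ** A" using sk by blast
qed

text \<open>Orthogonality to all vertical vectors makes G^T v symmetric, while tangency makes it a
  sum of skew matrices; together they force it to vanish.\<close>

lemma horizontal_iff:
  fixes G v :: "('n::finite, 'd::finite) stack"
  assumes G: "G \<in> orth_stack"
  shows "v \<in> horizontal G \<longleftrightarrow>
    (\<forall>i. skew (transpose (block G i) ** block v i)) \<and> transpose G ** v = 0"
proof -
  have in1: "v \<bullet> (G ** A) = (transpose G ** v) \<bullet> A" for A
    by (metis inner_commute inner_mult_left)
  have "(\<forall>A. skew A \<longrightarrow> (transpose G ** v) \<bullet> A = 0) \<longleftrightarrow> transpose G ** v = 0"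
    if "\<forall>i. skew (transpose (block G i) ** block v i)"
  proof
    assume "\<forall>A. skew A \<longrightarrow> (transpose G ** v) \<bullet> A = 0"
    then have "transpose (transpose G ** v) = transpose G ** v"
      by (intro symmetric_if_orthogonal_to_skew) auto
    moreover have "skew (transpose G ** v)"
      unfolding transpose_mult_blocks using that by (simp add: transpose_linear_simps sum_negf)
    ultimately show "transpose G ** v = 0"
      by (metis add_eq_0_iff2 scaleR_2 scaleR_eq_0_iff zero_neq_numeral)
  qed simp
  then show ?thesis
    unfolding horizontal_def mem_Collect_eq tangent_orth_stack[OF G] Ball_def tangent_fibre[OF G]
    using in1 by metis
qed

text \<open>Since G^T G = n I, the factor 1/n makes the subtracted term the orthogonal projection of
  \<open>v\<close> onto the matrices \<open>G ** A\<close>; for tangent \<open>v\<close> this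
  \<open>A\<close> is skew.\<close>

definition hproj :: "('n::finite, 'd::finite) stack \<Rightarrow> ('n, 'd) stack \<Rightarrow> ('n, 'd) stack" where
  "hproj G v = v - (1 / real CARD('n)) *\<^sub>R (G ** (transpose G ** v))"

lemma hproj_vertical_part:
  fixes G v :: "('n::finite, 'd::finite) stack"
  assumes "G \<in> orth_stack" "v \<in> tangent orth_stack G"
  obtains A where "skew A" "hproj G v = v - G ** A"
proof
  show "skew ((1 / real CARD('n)) *\<^sub>R (transpose G ** v))"
    unfolding transpose_mult_blocks using assms(2)[unfolded tangent_orth_stack[OF assms(1)]]
    by (simp add: transpose_linear_simps sum_negf)
  show "hproj G v = v - G ** ((1 / real CARD('n)) *\<^sub>R (transpose G ** v))"
    by (simp add: hproj_def mm_simps)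
qed

lemma hproj_horizontal:
  fixes G v :: "('n::finite, 'd::finite) stack"
  assumes G: "G \<in> orth_stack" and v: "v \<in> tangent orth_stack G"
  shows "hproj G v \<in> horizontal G"
proof -
  obtain A where A: "skew A" "hproj G v = v - G ** A" using hproj_vertical_part[OF G v] .
  have "skew (transpose (block G i) ** block (hproj G v) i)" for i
    using v[unfolded tangent_orth_stack[OF G]] A
    by (simp add: mm.diff_right matrix_mul_assoc orth_tr orth_stackD[OF G] transpose_linear_simps)
  moreover have "transpose G ** hproj G v = 0"
    by (simp add: hproj_def mm.diff_right mm.scaleR_right)
       (simp add: matrix_mul_assoc orth_stack_gram[OF G] mm.scaleR_left)
  ultimately show ?thesis by (simp add: horizontal_iff[OF G])
qed

lemma norm_hproj_le:
  fixes G v :: "('n::finite, 'd::finite) stack"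
  assumes G: "G \<in> orth_stack" and v: "v \<in> tangent orth_stack G"
  shows "norm (hproj G v) \<le> norm v"
proof -
  obtain A where A: "skew A" "hproj G v = v - G ** A" using hproj_vertical_part[OF G v] .
  have "hproj G v \<bullet> (G ** A) = 0"
    using hproj_horizontal[OF G v] tangent_fibre[OF G] A(1) by (auto simp: horizontal_def)
  then have "v \<bullet> v = hproj G v \<bullet> hproj G v + (G ** A) \<bullet> (G ** A)"
    unfolding A(2) by (simp add: inner_diff_left inner_diff_right inner_commute)
  then show ?thesis by (simp add: norm_eq_sqrt_inner)
qed

section \<open>Tangent vectors and metric of the quotient\<close>

lemma smooth_fun_Q_along_curve:
  fixes h :: "('n::finite, 'd::finite) qpoint \<Rightarrow> real"
  assumes h: "smooth_fun_Q h" and J: "open J" and \<gamma>: "smooth_on J \<gamma>" "\<And>t. t \<in> J \<Longrightarrow> \<gamma> t \<in> orth_stack"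
  shows "smooth_on J (\<lambda>t. h (orbit (\<gamma> t)))"
proof (rule smooth_on_local[OF J])
  fix t assume t: "t \<in> J"
  obtain U E where U: "open U" "\<gamma> t \<in> U" "smooth_on U E" "\<forall>y\<in>U \<inter> orth_stack. E y = h (orbit y)"
    using h \<gamma>(2)[OF t] unfolding smooth_fun_Q_def smooth_on_sub_def by blast
  let ?V = "J \<inter> \<gamma> -` U"
  have V: "open ?V"
    by (rule continuous_open_preimage[OF smooth_on_continuous_on[OF \<gamma>(1)] J U(1)])
  have "smooth_on ?V (\<lambda>t. E (\<gamma> t))"
    by (rule smooth_on_compose[OF V U(1) smooth_on_subset[OF _ \<gamma>(1)] U(3)]) auto
  then have "smooth_on ?V (\<lambda>t. h (orbit (\<gamma> t)))"
    using smooth_on_cong[OF V, of "\<lambda>t. E (\<gamma> t)" "\<lambda>t. h (orbit (\<gamma> t))"] U(4) \<gamma>(2) by auto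
  then show "\<exists>V. open V \<and> t \<in> V \<and> smooth_on V (\<lambda>t. h (orbit (\<gamma> t)))"
    using V t U(2) by blast
qed

lemma smooth_curve_Q_orbit:
  assumes "open J" "smooth_on J \<gamma>" "\<And>t. t \<in> J \<Longrightarrow> \<gamma> t \<in> orth_stack"
  shows "smooth_curve_Q J (\<lambda>t. orbit (\<gamma> t))"
  unfolding smooth_curve_Q_def using smooth_fun_Q_along_curve[OF _ assms] assms(3) orbit_in_quot by auto

text \<open>The differential of the pullback of \<open>h\<close>. It comes from a local ambient
  extension, so only its values on tangent vectors are determined by \<open>h\<close>; elsewhere
  they depend on the choice.\<close>

definition diff_Q ::
  "(('n::finite, 'd::finite) qpoint \<Rightarrow> real) \<Rightarrow> ('n, 'd) stack \<Rightarrow> ('n, 'd) stack \<Rightarrow> real" where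
  "diff_Q h G = (SOME D. linear D \<and> (\<forall>\<gamma>. curve_at orth_stack G \<gamma> \<longrightarrow>
     ((\<lambda>t. h (orbit (\<gamma> t))) has_real_derivative D (velocity \<gamma>)) (at 0)))"

lemma diff_Q:
  fixes h :: "('n::finite, 'd::finite) qpoint \<Rightarrow> real"
  assumes h: "smooth_fun_Q h" and G: "G \<in> orth_stack"
  shows "linear (diff_Q h G)"
    "curve_at orth_stack G \<gamma> \<Longrightarrow>
      ((\<lambda>t. h (orbit (\<gamma> t))) has_real_derivative diff_Q h G (velocity \<gamma>)) (at 0)"
proof -
  obtain U E where U: "open U" "G \<in> U" "smooth_on U E" "\<forall>y\<in>U \<inter> orth_stack. E y = h (orbit y)"
    using h G unfolding smooth_fun_Q_def smooth_on_sub_def by blast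
  define D where "D = frechet_derivative E (at G)"
  have D: "(E has_derivative D) (at G)"
    unfolding D_def using smooth_on_differentiable[OF U(3,2)] frechet_derivative_works by blast
  have lin: "linear D" using D has_derivative_linear by blast
  have "((\<lambda>t. h (orbit (\<gamma> t))) has_real_derivative D (velocity \<gamma>)) (at 0)"
    if \<gamma>: "curve_at orth_stack G \<gamma>" for \<gamma>
  proof -
    obtain e where e: "e > 0" "\<gamma> 0 = G" "smooth_on {-e<..<e} \<gamma>" "\<forall>t\<in>{-e<..<e}. \<gamma> t \<in> orth_stack"
      using \<gamma> unfolding curve_at_def image_subset_iff by blast
    let ?V = "{-e<..<e} \<inter> \<gamma> -` U"
    have V: "open ?V"
      by (rule continuous_open_preimage[OF smooth_on_continuous_on[OF e(3)] _ U(1)]) auto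
    have "((\<lambda>t. E (\<gamma> t)) has_derivative (\<lambda>s. D (s *\<^sub>R velocity \<gamma>))) (at 0)"
      by (rule has_derivative_compose[where g = E])
         (use curve_at_velocity[OF \<gamma>] D e(2) in \<open>auto simp: has_vector_derivative_def\<close>)
    then have "((\<lambda>t. E (\<gamma> t)) has_real_derivative D (velocity \<gamma>)) (at 0)"
      unfolding has_real_derivative_iff_has_vector_derivative has_vector_derivative_def
      by (simp add: linear_scale[OF lin])
    then show ?thesis
      by (rule has_field_derivative_transform_within_open[OF _ V]) (use e U in auto)
  qed
  with lin have "\<exists>D. linear D \<and> (\<forall>\<gamma>. curve_at orth_stack G \<gamma> \<longrightarrow>
     ((\<lambda>t. h (orbit (\<gamma> t))) has_real_derivative D (velocity \<gamma>)) (at 0))" by blast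
  from someI_ex[OF this] show "linear (diff_Q h G)"
    "curve_at orth_stack G \<gamma> \<Longrightarrow>
      ((\<lambda>t. h (orbit (\<gamma> t))) has_real_derivative diff_Q h G (velocity \<gamma>)) (at 0)"
    unfolding diff_Q_def by blast+
qed

lemma velocity_Q_curve:
  assumes "G \<in> orth_stack" "curve_at orth_stack G \<gamma>"
  shows "velocity_Q (\<lambda>t. orbit (\<gamma> t)) 0 = (\<lambda>h. if smooth_fun_Q h then diff_Q h G (velocity \<gamma>) else 0)"
  unfolding velocity_Q_def using diff_Q(2)[OF _ assms] DERIV_imp_deriv by fastforce

text \<open>Tangency of \<open>v\<close> supplies a curve realising it, so the condition in
  \<open>dproj\<close> is not vacuous and determines a unique value.\<close>

lemma dproj_eq:
  assumes G: "G \<in> orth_stack" and v: "v \<in> tangent orth_stack G"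
  shows "dproj G v = (\<lambda>h. if smooth_fun_Q h then diff_Q h G v else 0)"
  unfolding dproj_def
proof (rule the_equality)
  show "\<forall>\<gamma>. curve_at orth_stack G \<gamma> \<and> velocity \<gamma> = v \<longrightarrow>
      (\<lambda>h. if smooth_fun_Q h then diff_Q h G v else 0) = velocity_Q (\<lambda>t. orbit (\<gamma> t)) 0"
    using velocity_Q_curve[OF G] by auto
next
  fix \<xi> assume a: "\<forall>\<gamma>. curve_at orth_stack G \<gamma> \<and> velocity \<gamma> = v \<longrightarrow> \<xi> = velocity_Q (\<lambda>t. orbit (\<gamma> t)) 0"
  obtain \<gamma> where "curve_at orth_stack G \<gamma>" "velocity \<gamma> = v"
    using v unfolding tangent_def by blast
  then show "\<xi> = (\<lambda>h. if smooth_fun_Q h then diff_Q h G v else 0)"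
    using a velocity_Q_curve[OF G] by auto
qed

lemma velocity_Q_curve_dproj:
  assumes G: "G \<in> orth_stack" and \<gamma>: "curve_at orth_stack G \<gamma>"
  shows "velocity \<gamma> \<in> tangent orth_stack G"
    "velocity_Q (\<lambda>t. orbit (\<gamma> t)) 0 = dproj G (velocity \<gamma>)"
proof -
  show "velocity \<gamma> \<in> tangent orth_stack G" using \<gamma> unfolding tangent_def by blast
  from velocity_Q_curve[OF G \<gamma>] dproj_eq[OF G this]
  show "velocity_Q (\<lambda>t. orbit (\<gamma> t)) 0 = dproj G (velocity \<gamma>)" by simp
qed

lemma tangent_orth_stack_diff:
  fixes G v w :: "('n::finite, 'd::finite) stack"
  assumes "G \<in> orth_stack" "v \<in> tangent orth_stack G" "w \<in> tangent orth_stack G"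
  shows "v - w \<in> tangent orth_stack G"
  using assms by (auto simp: tangent_orth_stack mm.diff_right transpose_linear_simps)

text \<open>A vertical vector is the velocity of a curve inside one fibre, along which the orbit is
  constant.\<close>

lemma diff_Q_vertical:
  fixes G :: "('n::finite, 'd::finite) stack"
  assumes h: "smooth_fun_Q h" and G: "G \<in> orth_stack" and A: "skew A"
  shows "diff_Q h G (G ** A) = 0"
proof -
  have "G ** A \<in> tangent (fibre G) G" using tangent_fibre[OF G] A by blast
  then obtain \<gamma> where \<gamma>: "curve_at (fibre G) G \<gamma>" "G ** A = velocity \<gamma>"
    unfolding tangent_def by blast
  obtain e where e: "e > 0" "\<And>t. t \<in> {-e<..<e} \<Longrightarrow> \<gamma> t \<in> fibre G" "\<gamma> 0 = G"
    using curve_atE[OF \<gamma>(1)] by metis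
  have c: "curve_at orth_stack G \<gamma>"
    using \<gamma>(1) unfolding curve_at_def fibre_def by auto
  have "((\<lambda>t. h (orbit (\<gamma> t))) has_real_derivative diff_Q h G (G ** A)) (at 0)"
    unfolding \<gamma>(2) by (rule diff_Q(2)[OF h G c])
  then have "((\<lambda>t. h (orbit G)) has_real_derivative diff_Q h G (G ** A)) (at 0)"
    by (rule has_field_derivative_transform_within_open[where S = "{-e<..<e}"])
       (use e in \<open>auto simp: fibre_def\<close>)
  then show ?thesis using DERIV_unique DERIV_const by blast
qed

lemma horizontal_tangent: "v \<in> horizontal G \<Longrightarrow> v \<in> tangent orth_stack G"
  by (simp add: horizontal_def)

lemma dproj_hproj:
  fixes G :: "('n::finite, 'd::finite) stack"
  assumes G: "G \<in> orth_stack" and v: "v \<in> tangent orth_stack G"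
  shows "dproj G (hproj G v) = dproj G v"
proof -
  obtain A where A: "skew A" "hproj G v = v - G ** A" using hproj_vertical_part[OF G v] .
  have "diff_Q h G (hproj G v) = diff_Q h G v" if "smooth_fun_Q h" for h
    using linear_diff[OF diff_Q(1)[OF that G]] diff_Q_vertical[OF that G A(1)] A(2) by simp
  then show ?thesis
    unfolding dproj_eq[OF G v] dproj_eq[OF G horizontal_tangent[OF hproj_horizontal[OF G v]]]
    by auto
qed

text \<open>Normalising one block to the identity gives a global section of the quotient map; \<open>undefined\<close>
  serves as an arbitrary block index.\<close>

definition section_Q :: "('n::finite, 'd::finite) qpoint \<Rightarrow> ('n, 'd) stack" where
  "section_Q p = the_elem ((\<lambda>G. G ** transpose (block G undefined)) ` p)"

lemma section_Q_orbit:
  fixes G :: "('n::finite, 'd::finite) stack"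
  shows "section_Q (orbit G) = G ** transpose (block G undefined)"
proof -
  have "(\<lambda>H. H ** transpose (block H undefined)) ` orbit G = {G ** transpose (block G undefined)}"
  proof (intro equalityI subsetI)
    fix X assume "X \<in> (\<lambda>H. H ** transpose (block H undefined)) ` orbit G"
    then obtain Q where "orthogonal_matrix Q" "X = (G ** Q) ** transpose (block (G ** Q) undefined)"
      unfolding orbit_def by blast
    then show "X \<in> {G ** transpose (block G undefined)}"
      by (simp add: mm_simps matrix_mul_assoc orth_tr)
  qed (use orbit_self in blast)
  then show ?thesis by (simp add: section_Q_def)
qed

lemma section_Q_props:
  fixes p :: "('n::finite, 'd::finite) qpoint"
  assumes "p \<in> quot"
  shows "section_Q p \<in> orth_stack" "orbit (section_Q p) = p"
proof -
  from assms obtain G where "G \<in> orth_stack" "p = orbit G" unfolding quot_def by blast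
  then show "section_Q p \<in> orth_stack" "orbit (section_Q p) = p"
    by (auto simp: section_Q_orbit orbit_mult orth_stack_mult orth_stackD)
qed

text \<open>In terms of \<open>G\<close> each coordinate of the section is a polynomial, which
  serves as its own ambient extension.\<close>

lemma smooth_fun_Q_section: "smooth_fun_Q (\<lambda>p. section_Q p \<bullet> (B :: ('n::finite, 'd::finite) stack))"
proof -
  have "smooth_on UNIV (\<lambda>G::('n, 'd) stack. (G ** transpose (block G undefined)) \<bullet> B)"
    by (intro smooth_on_bounded_linear[OF _ bounded_linear_inner_left]
        smooth_on_bilinear[OF _ bounded_bilinear_matrix_mult] smooth_on_ident
        smooth_on_bounded_linear[OF _ bounded_linear_transpose]
        smooth_on_bounded_linear[OF _ bounded_linear_block]) auto
  then show ?thesis unfolding smooth_fun_Q_def smooth_on_sub_def section_Q_orbit by blast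
qed

text \<open>Smoothness in the quotient speaks only of real functions along the curve; applied to the
  coordinates of the section it yields a smooth lift.\<close>

lemma smooth_section_along_curve:
  fixes c :: "real \<Rightarrow> ('n::finite, 'd::finite) qpoint"
  assumes "open J" "smooth_curve_Q J c"
  shows "smooth_on J (\<lambda>t. section_Q (c t))"
proof -
  have "smooth_on J (\<lambda>t. \<Sum>B\<in>Basis. (section_Q (c t) \<bullet> B) *\<^sub>R B)"
    using assms smooth_fun_Q_section unfolding smooth_curve_Q_def
    by (intro smooth_on_sum smooth_on_bounded_linear[OF _ bounded_linear_scaleR_left]) auto
  then show ?thesis by (simp add: euclidean_representation)
qed

text \<open>The coordinates of the section are the test functions. If their derivatives along u = v
  - w all vanish, then G_j^T u_j is the same matrix for every \<open>j\<close>. These matrices add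
  up to G^T u, which is 0 by horizontality, so each of them is 0.\<close>

lemma dproj_horizontal_inj:
  fixes G v w :: "('n::finite, 'd::finite) stack"
  assumes G: "G \<in> orth_stack" and v: "v \<in> horizontal G" "w \<in> horizontal G"
    and eq: "dproj G v = dproj G w"
  shows "v = w"
proof -
  let ?i = "undefined :: 'n"
  let ?u = "v - w"
  have ut: "?u \<in> tangent orth_stack G"
    by (intro tangent_orth_stack_diff G horizontal_tangent v)
  then obtain \<gamma> where \<gamma>: "curve_at orth_stack G \<gamma>" "?u = velocity \<gamma>"
    unfolding tangent_def by blast
  let ?D = "G ** transpose (block ?u ?i) + ?u ** transpose (block G ?i)"
  have "diff_Q h G ?u = 0" if h: "smooth_fun_Q h" for h
    using fun_cong[OF eq, of h] h linear_diff[OF diff_Q(1)[OF h G]]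
    by (simp add: dproj_eq[OF G horizontal_tangent] v)
  then have "((\<lambda>t. section_Q (orbit (\<gamma> t)) \<bullet> B) has_real_derivative 0) (at 0)" for B
    using diff_Q(2)[OF smooth_fun_Q_section G \<gamma>(1), of B] smooth_fun_Q_section[of B] \<gamma>(2) by simp
  moreover have "((\<lambda>t. section_Q (orbit (\<gamma> t)) \<bullet> B) has_real_derivative ?D \<bullet> B) (at 0)" for B
  proof -
    have "((\<lambda>t. \<gamma> t ** transpose (block (\<gamma> t) ?i)) has_vector_derivative
        \<gamma> 0 ** transpose (block ?u ?i) + ?u ** transpose (block (\<gamma> 0) ?i)) (at 0)"
      unfolding \<gamma>(2)
      by (rule mm.has_vector_derivative[OF curve_at_velocity[OF \<gamma>(1)]
          bounded_linear.has_vector_derivative[OF bounded_linear_transpose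
          bounded_linear.has_vector_derivative[OF bounded_linear_block curve_at_velocity[OF \<gamma>(1)]]]])
    moreover have "\<gamma> 0 = G" using \<gamma>(1) by (simp add: curve_at_def)
    ultimately show ?thesis
      unfolding section_Q_orbit has_real_derivative_iff_has_vector_derivative
      using bounded_linear.has_vector_derivative[OF bounded_linear_inner_left] by auto
  qed
  ultimately have "?D \<bullet> B = 0" for B using DERIV_unique by blast
  then have D0: "?D = 0" using inner_eq_zero_iff by blast
  have blk: "transpose (block G j) ** block ?u j = - (transpose (block ?u ?i) ** block G ?i)" for j
  proof -
    have "transpose (block G j) ** block ?D j ** block G ?i = 0"
      unfolding D0 by simp
    then have "transpose (block ?u ?i) ** block G ?i + transpose (block G j) ** block ?u j = 0"
      by (simp only: block_linear_simps block_mult mm.add_left mm.add_right matrix_mul_assoc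
          orth_tr orth_stackD[OF G] matrix_mul_lid)
    then show ?thesis by (simp add: eq_neg_iff_add_eq_0 add.commute)
  qed
  have "transpose G ** ?u = 0"
    using v[unfolded horizontal_iff[OF G]] by (simp add: mm.diff_right)
  then have "real CARD('n) *\<^sub>R (transpose (block ?u ?i) ** block G ?i) = 0"
    unfolding transpose_mult_blocks blk by (simp add: sum_constant_scaleR del: sum_constant)
  then have "transpose (block ?u ?i) ** block G ?i = 0" by simp
  then have "block G j ** (transpose (block G j) ** block ?u j) = 0" for j
    unfolding blk by simp
  then have "block ?u j = 0" for j by (simp only: matrix_mul_assoc orth_tr orth_stackD[OF G] matrix_mul_lid)
  then have "?u = 0" by (subst stack_eq_iff) simp
  then show ?thesis by simp
qed

lemma hlift_dproj:
  assumes "G \<in> orth_stack" "v \<in> horizontal G"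
  shows "hlift G (dproj G v) = v"
  unfolding hlift_def using assms dproj_horizontal_inj by (intro the_equality) auto

text \<open>Right multiplication by \<open>Q\<close> preserves orbits and inner products, so the
  lifts at different representatives correspond. This makes the metric independent of the
  representative.\<close>

lemma horizontal_mult:
  fixes G v :: "('n::finite, 'd::finite) stack"
  assumes G: "G \<in> orth_stack" and Q: "orthogonal_matrix Q" and v: "v \<in> horizontal G"
  shows "v ** Q \<in> horizontal (G ** Q)" "dproj (G ** Q) (v ** Q) = dproj G v"
proof -
  have sk: "skew (transpose Q ** A ** Q)" if "skew A" for A
    using that by (simp add: mm_simps matrix_mul_assoc)
  show "v ** Q \<in> horizontal (G ** Q)"
    using v sk unfolding horizontal_iff[OF G] horizontal_iff[OF orth_stack_mult[OF G Q]]
    by (auto simp: matrix_transpose_mul matrix_mul_assoc) (simp add: mm.zero_left mm.zero_right flip: matrix_mul_assoc)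
  obtain \<gamma> where \<gamma>: "curve_at orth_stack G \<gamma>" "v = velocity \<gamma>"
    using horizontal_tangent[OF v] unfolding tangent_def by blast
  have c: "curve_at orth_stack (G ** Q) (\<lambda>t. \<gamma> t ** Q)"
    using \<gamma>(1) Q unfolding curve_at_def
    by (auto simp: orth_stack_mult image_subset_iff intro!: smooth_on_bounded_linear[OF _ mm.bounded_linear_left])
  have "velocity (\<lambda>t. \<gamma> t ** Q) = v ** Q"
    unfolding velocity_def \<gamma>(2)
    by (rule vector_derivative_at[OF bounded_linear.has_vector_derivative[OF mm.bounded_linear_left
          curve_at_velocity[OF \<gamma>(1), unfolded velocity_def]]])
  then have "dproj (G ** Q) (v ** Q) = velocity_Q (\<lambda>t. orbit (\<gamma> t ** Q)) 0"
    using velocity_Q_curve_dproj(2)[OF orth_stack_mult[OF G Q] c] by simp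
  then show "dproj (G ** Q) (v ** Q) = dproj G v"
    using velocity_Q_curve_dproj(2)[OF G \<gamma>(1)] \<gamma>(2) by (simp add: orbit_mult Q)
qed

lemma inner_Q_dproj:
  fixes G v w :: "('n::finite, 'd::finite) stack"
  assumes G: "G \<in> orth_stack" and v: "v \<in> horizontal G" and w: "w \<in> horizontal G"
  shows "inner_Q (orbit G) (dproj G v) (dproj G w) = v \<bullet> w"
proof -
  have "hlift H (dproj G v) \<bullet> hlift H (dproj G w) = v \<bullet> w" if "H \<in> orbit G" for H
  proof -
    from that obtain Q where Q: "orthogonal_matrix Q" "H = G ** Q" unfolding orbit_def by blast
    have "hlift H (dproj G v) = v ** Q" "hlift H (dproj G w) = w ** Q"
      unfolding Q(2) using horizontal_mult[OF G Q(1)] v w hlift_dproj[OF orth_stack_mult[OF G Q(1)]]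
      by metis+
    then show ?thesis by (simp add: inner_mult_right orth_tr[OF Q(1)])
  qed
  then have "(\<lambda>H. hlift H (dproj G v) \<bullet> hlift H (dproj G w)) ` orbit G = {v \<bullet> w}"
    using orbit_self[of G] by auto
  then show ?thesis by (simp add: inner_Q_def)
qed

lemma norm_Q_dproj:
  fixes G v :: "('n::finite, 'd::finite) stack"
  assumes G: "G \<in> orth_stack" and v: "v \<in> tangent orth_stack G"
  shows "norm_Q (orbit G) (dproj G v) = norm (hproj G v)"
  using inner_Q_dproj[OF G hproj_horizontal[OF G v] hproj_horizontal[OF G v]]
  by (simp add: norm_Q_def dproj_hproj[OF G v] norm_eq_sqrt_inner)

text \<open>Expresses speed in the quotient through any lift, horizontal or not, so that lifts
  obtained from the section can be used.\<close>

lemma velocity_Q_lift: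
  fixes \<gamma> :: "real \<Rightarrow> ('n::finite, 'd::finite) stack"
  assumes J: "open J" "t \<in> J" and \<gamma>: "smooth_on J \<gamma>" "\<And>s. s \<in> J \<Longrightarrow> \<gamma> s \<in> orth_stack"
    and c: "\<And>s. s \<in> J \<Longrightarrow> c s = orbit (\<gamma> s)"
  shows "vector_derivative \<gamma> (at t) \<in> tangent orth_stack (\<gamma> t)"
    "velocity_Q c t = dproj (\<gamma> t) (vector_derivative \<gamma> (at t))"
    "norm_Q (c t) (velocity_Q c t) = norm (hproj (\<gamma> t) (vector_derivative \<gamma> (at t)))"
proof -
  note tr = curve_at_translate[OF J \<gamma>]
  have G: "\<gamma> t \<in> orth_stack" using \<gamma>(2) J(2) .
  show tang: "vector_derivative \<gamma> (at t) \<in> tangent orth_stack (\<gamma> t)"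
    using velocity_Q_curve_dproj(1)[OF G tr(1)] tr(2) by simp
  have "deriv (\<lambda>s. h (c s)) t = deriv (\<lambda>s. h (orbit (\<gamma> (t + s)))) 0" for h :: "('n, 'd) qpoint \<Rightarrow> real"
  proof -
    have "deriv (\<lambda>s. h (c s)) t = deriv (\<lambda>s. h (orbit (\<gamma> s))) t"
      using J c by (intro deriv_cong_ev) (auto simp: eventually_nhds)
    also have "\<dots> = deriv (\<lambda>s. h (orbit (\<gamma> (t + s)))) 0"
      using DERIV_shift[of "\<lambda>s. h (orbit (\<gamma> s))" _ 0 t] by (simp add: deriv_def add.commute)
    finally show ?thesis .
  qed
  then have "velocity_Q c t = velocity_Q (\<lambda>s. orbit (\<gamma> (t + s))) 0"
    unfolding velocity_Q_def by auto
  then show "velocity_Q c t = dproj (\<gamma> t) (vector_derivative \<gamma> (at t))"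
    using velocity_Q_curve_dproj(2)[OF G tr(1)] tr(2) by simp
  then show "norm_Q (c t) (velocity_Q c t) = norm (hproj (\<gamma> t) (vector_derivative \<gamma> (at t)))"
    using norm_Q_dproj[OF G tang] c[OF J(2)] by simp
qed

lemma tangent_Q_orbit:
  fixes G :: "('n::finite, 'd::finite) stack"
  assumes G: "G \<in> orth_stack"
  shows "tangent_Q (orbit G) = dproj G ` horizontal G"
proof (intro equalityI subsetI)
  fix \<xi> assume "\<xi> \<in> dproj G ` horizontal G"
  then obtain v where v: "v \<in> horizontal G" "\<xi> = dproj G v" by blast
  then obtain \<gamma> where \<gamma>: "curve_at orth_stack G \<gamma>" "v = velocity \<gamma>"
    using horizontal_tangent unfolding tangent_def by blast
  obtain e where e: "e > 0" "\<gamma> 0 = G" "smooth_on {-e<..<e} \<gamma>" "\<gamma> ` {-e<..<e} \<subseteq> orth_stack"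
    using \<gamma>(1) unfolding curve_at_def by blast
  have "smooth_curve_Q {-e<..<e} (\<lambda>t. orbit (\<gamma> t))"
    by (rule smooth_curve_Q_orbit[OF _ e(3)]) (use e(4) in auto)
  moreover have "\<xi> = velocity_Q (\<lambda>t. orbit (\<gamma> t)) 0"
    using velocity_Q_curve_dproj(2)[OF G \<gamma>(1)] v(2) \<gamma>(2) by simp
  ultimately show "\<xi> \<in> tangent_Q (orbit G)"
    unfolding tangent_Q_def using e(1,2) by blast
next
  fix \<xi> assume "\<xi> \<in> tangent_Q (orbit G)"
  then obtain c e where c: "\<xi> = velocity_Q c 0" "c 0 = orbit G" "e > 0" "smooth_curve_Q {-e<..<e} c"
    unfolding tangent_Q_def by blast
  \<comment> \<open>The section starts at the normalised representative of the orbit; multiplication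
    by the fixed block of \<open>G\<close> moves the lift so that it starts at
    \<open>G\<close>.\<close>
  define \<gamma> where "\<gamma> = (\<lambda>t. section_Q (c t) ** block G undefined)"
  have quot: "c t \<in> quot" if "t \<in> {-e<..<e}" for t
    using c(4) that unfolding smooth_curve_Q_def by blast
  have O: "orthogonal_matrix (block G undefined)" using orth_stackD[OF G] .
  have sm: "smooth_on {-e<..<e} \<gamma>"
    unfolding \<gamma>_def
    by (intro smooth_on_bounded_linear[OF _ mm.bounded_linear_left] smooth_section_along_curve c(4)) auto
  have st: "\<gamma> t \<in> orth_stack" "c t = orbit (\<gamma> t)" if "t \<in> {-e<..<e}" for t
    using section_Q_props[OF quot[OF that]] O by (auto simp: \<gamma>_def orth_stack_mult orbit_mult)
  have g0: "\<gamma> 0 = G"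
    by (simp add: \<gamma>_def c(2) section_Q_orbit orth_tr[OF O])
  have z: "0 \<in> {-e<..<e}" using c(3) by simp
  have op: "open {-e<..<e}" by simp
  have "vector_derivative \<gamma> (at 0) \<in> tangent orth_stack G" "\<xi> = dproj G (vector_derivative \<gamma> (at 0))"
    using velocity_Q_lift(1,2)[OF op z sm st] c(1) g0 by auto
  then show "\<xi> \<in> dproj G ` horizontal G"
    using dproj_hproj[OF G] hproj_horizontal[OF G] by (metis image_eqI)
qed

section \<open>Gradients and upper bounds for the distance\<close>

lemma fbar_inner: "fbar C G = G \<bullet> (C ** G)"
  by (simp add: fbar_def trace_transpose_mult flip: matrix_mul_assoc)

lemma fbar_mult_orthogonal: "orthogonal_matrix Q \<Longrightarrow> fbar C (G ** Q) = fbar C G"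
  by (simp add: fbar_inner inner_mult_right matrix_mul_assoc orth_tr)

lemma f_Q_orbit: "f_Q C (orbit G) = fbar C G"
proof -
  have "fbar C ` orbit G = {fbar C G}"
    using orbit_self[of G] by (auto simp: orbit_def fbar_mult_orthogonal intro!: image_eqI[of _ _ G])
  then show ?thesis by (simp add: f_Q_def)
qed

lemma smooth_f_Q: "smooth_fun_Q (f_Q C :: ('n::finite, 'd::finite) qpoint \<Rightarrow> real)"
proof -
  have "smooth_on UNIV (\<lambda>G::('n, 'd) stack. G \<bullet> (C ** G))"
    by (intro smooth_on_bilinear[OF _ bounded_bilinear_inner] smooth_on_ident
        smooth_on_bounded_linear[OF _ mm.bounded_linear_right]) auto
  then show ?thesis unfolding smooth_fun_Q_def smooth_on_sub_def f_Q_orbit fbar_inner by blast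
qed

lemma fbar_has_derivative_along_curve:
  assumes sym: "transpose C = C" and \<gamma>: "(\<gamma> has_vector_derivative v) (at t)"
  shows "((\<lambda>t. fbar C (\<gamma> t)) has_real_derivative (2 *\<^sub>R (C ** \<gamma> t)) \<bullet> v) (at t)"
proof -
  have "((\<lambda>t. \<gamma> t \<bullet> (C ** \<gamma> t)) has_vector_derivative (\<gamma> t \<bullet> (C ** v) + v \<bullet> (C ** \<gamma> t))) (at t)"
    by (rule bounded_bilinear.has_vector_derivative[OF bounded_bilinear_inner \<gamma>
        bounded_linear.has_vector_derivative[OF mm.bounded_linear_right \<gamma>]])
  moreover have "\<gamma> t \<bullet> (C ** v) = (C ** \<gamma> t) \<bullet> v"
    using inner_mult_left[of C v "\<gamma> t"] sym by (simp add: inner_commute)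
  ultimately show ?thesis
    by (simp add: has_real_derivative_iff_has_vector_derivative fbar_inner inner_commute)
qed

text \<open>Orthogonal projection onto the tangent space of the product of orthogonal groups.\<close>

definition tproj :: "('n::finite, 'd::finite) stack \<Rightarrow> ('n, 'd) stack \<Rightarrow> ('n, 'd) stack" where
  "tproj G X = stack_of (\<lambda>i. (1/2) *\<^sub>R (block X i - block G i ** transpose (block X i) ** block G i))"

lemma tproj_skew_part:
  fixes G X :: "('n::finite, 'd::finite) stack"
  assumes G: "G \<in> orth_stack"
  shows "transpose (block G i) ** block (tproj G X) i =
    (1/2) *\<^sub>R (transpose (block G i) ** block X i - transpose (block X i) ** block G i)"
  by (simp add: tproj_def mm_simps matrix_mul_assoc orth_tr orth_stackD[OF G])

lemma tproj_tangent:
  fixes G X :: "('n::finite, 'd::finite) stack"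
  assumes G: "G \<in> orth_stack"
  shows "tproj G X \<in> tangent orth_stack G"
  unfolding tangent_orth_stack[OF G] tproj_skew_part[OF G]
  by (simp add: mm_simps flip: scaleR_minus_right)

text \<open>Both halves of the projection contribute equally: after multiplication by G_i^T the
  factor from \<open>w\<close> is skew, so transposing it only changes the sign.\<close>

lemma inner_tproj:
  fixes G X w :: "('n::finite, 'd::finite) stack"
  assumes G: "G \<in> orth_stack" and w: "w \<in> tangent orth_stack G"
  shows "tproj G X \<bullet> w = X \<bullet> w"
proof -
  have "(block G i ** transpose (block X i) ** block G i) \<bullet> block w i = - (block X i \<bullet> block w i)" for i
  proof -
    note O = orth_stackD[OF G, of i]
    have "(block G i ** transpose (block X i) ** block G i) \<bullet> block w i
        = (transpose (block X i) ** block G i) \<bullet> (transpose (block G i) ** block w i)"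
      by (simp add: inner_mult_left flip: matrix_mul_assoc)
    also have "\<dots> = (transpose (block G i) ** block X i) \<bullet> transpose (transpose (block G i) ** block w i)"
      using inner_transpose[of "transpose (block X i) ** block G i" "transpose (block G i) ** block w i"]
      by (simp add: matrix_transpose_mul)
    also have "\<dots> = - ((transpose (block G i) ** block X i) \<bullet> (transpose (block G i) ** block w i))"
      using w[unfolded tangent_orth_stack[OF G]] by simp
    also have "\<dots> = - (block X i \<bullet> block w i)"
      by (simp add: inner_mult_left matrix_mul_assoc orth_tr[OF O])
    finally show ?thesis .
  qed
  then show ?thesis
    unfolding inner_blocks[of _ w] by (intro sum.cong) (auto simp: tproj_def inner_diff_left)
qed

lemma norm_tproj_le:
  fixes G X :: "('n::finite, 'd::finite) stack"
  assumes G: "G \<in> orth_stack"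
  shows "norm (tproj G X) \<le> norm X"
proof -
  have "(norm (tproj G X))\<^sup>2 = X \<bullet> tproj G X"
    using inner_tproj[OF G tproj_tangent[OF G]] by (simp add: power2_norm_eq_inner)
  also have "\<dots> \<le> norm X * norm (tproj G X)" by (rule norm_cauchy_schwarz)
  finally show ?thesis
    by (cases "tproj G X = 0") (auto simp: power2_eq_square)
qed

lemma tproj_horizontal:
  fixes G X :: "('n::finite, 'd::finite) stack"
  assumes G: "G \<in> orth_stack" and sym: "transpose (transpose G ** X) = transpose G ** X"
  shows "tproj G X \<in> horizontal G"
proof -
  have "transpose G ** tproj G X = (1/2) *\<^sub>R (transpose G ** X - transpose X ** G)"
    unfolding transpose_mult_blocks tproj_skew_part[OF G]
    by (simp only: scaleR_sum_right[symmetric] sum_subtractf)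
  also have "\<dots> = 0" using sym by (simp add: matrix_transpose_mul)
  finally show ?thesis
    using tproj_tangent[OF G] by (simp add: horizontal_iff[OF G] tangent_orth_stack[OF G])
qed

lemma grad_sub_fbar:
  fixes G :: "('n::finite, 'd::finite) stack"
  assumes G: "G \<in> orth_stack" and sym: "transpose C = C"
  shows "grad_sub orth_stack (fbar C) G = tproj G (2 *\<^sub>R (C ** G))"
  unfolding grad_sub_def
proof (rule the_equality)
  have d: "((\<lambda>t. fbar C (\<gamma> t)) has_real_derivative tproj G (2 *\<^sub>R (C ** G)) \<bullet> velocity \<gamma>) (at 0)"
    if "curve_at orth_stack G \<gamma>" for \<gamma>
    using fbar_has_derivative_along_curve[OF sym curve_at_velocity[OF that]] that
      inner_tproj[OF G velocity_Q_curve_dproj(1)[OF G that], of "2 *\<^sub>R (C ** G)"]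
    by (simp add: curve_at_def)
  with tproj_tangent[OF G] show "tproj G (2 *\<^sub>R (C ** G)) \<in> tangent orth_stack G \<and>
     (\<forall>\<gamma>. curve_at orth_stack G \<gamma> \<longrightarrow>
       ((\<lambda>t. fbar C (\<gamma> t)) has_real_derivative tproj G (2 *\<^sub>R (C ** G)) \<bullet> velocity \<gamma>) (at 0))" by blast
  fix v assume v: "v \<in> tangent orth_stack G \<and> (\<forall>\<gamma>. curve_at orth_stack G \<gamma> \<longrightarrow>
       ((\<lambda>t. fbar C (\<gamma> t)) has_real_derivative v \<bullet> velocity \<gamma>) (at 0))"
  \<comment> \<open>Two candidates are compared along a curve whose velocity is their
    difference.\<close>
  let ?u = "v - tproj G (2 *\<^sub>R (C ** G))"
  have "?u \<in> tangent orth_stack G"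
    using tangent_orth_stack_diff[OF G _ tproj_tangent[OF G]] v by blast
  then obtain \<gamma> where \<gamma>: "curve_at orth_stack G \<gamma>" "?u = velocity \<gamma>" unfolding tangent_def by blast
  have "v \<bullet> ?u = tproj G (2 *\<^sub>R (C ** G)) \<bullet> ?u"
    using DERIV_unique d[OF \<gamma>(1)] v \<gamma> by metis
  then have "?u \<bullet> ?u = 0" by (simp add: inner_diff_left)
  then show "v = tproj G (2 *\<^sub>R (C ** G))" by simp
qed

text \<open>Horizontal lifts turn the defining equation of \<open>grad_Q\<close> into an identity of
  inner products on \<open>horizontal G\<close>, which the projected Euclidean gradient
  solves.\<close>

lemma norm_grad_Q_fbar:
  fixes G :: "('n::finite, 'd::finite) stack"
  assumes G: "G \<in> orth_stack" and sym: "transpose C = C"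
  shows "norm_Q (orbit G) (grad_Q (f_Q C) (orbit G)) = norm (tproj G (2 *\<^sub>R (C ** G)))"
proof -
  let ?g = "tproj G (2 *\<^sub>R (C ** G))"
  have g: "?g \<in> horizontal G"
    by (rule tproj_horizontal[OF G]) (simp add: mm_simps sym matrix_mul_assoc)
  have h: "dproj G v (f_Q C) = ?g \<bullet> v" if v: "v \<in> horizontal G" for v
  proof -
    obtain \<gamma> where \<gamma>: "curve_at orth_stack G \<gamma>" "v = velocity \<gamma>"
      using horizontal_tangent[OF v] unfolding tangent_def by blast
    have "((\<lambda>t. fbar C (\<gamma> t)) has_real_derivative (2 *\<^sub>R (C ** \<gamma> 0)) \<bullet> v) (at 0)"
      unfolding \<gamma>(2) by (rule fbar_has_derivative_along_curve[OF sym curve_at_velocity[OF \<gamma>(1)]])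
    moreover have "((\<lambda>t. fbar C (\<gamma> t)) has_real_derivative diff_Q (f_Q C) G v) (at 0)"
      using diff_Q(2)[OF smooth_f_Q G \<gamma>(1)] \<gamma>(2) by (simp add: f_Q_orbit)
    moreover have "\<gamma> 0 = G" using \<gamma>(1) by (simp add: curve_at_def)
    ultimately have "diff_Q (f_Q C) G v = (2 *\<^sub>R (C ** G)) \<bullet> v" using DERIV_unique by blast
    then show ?thesis
      by (simp add: dproj_eq[OF G horizontal_tangent[OF v]] smooth_f_Q inner_tproj[OF G horizontal_tangent[OF v]])
  qed
  have "grad_Q (f_Q C) (orbit G) = dproj G ?g"
    unfolding grad_Q_def
  proof (rule the_equality)
    show "dproj G ?g \<in> tangent_Q (orbit G) \<and>
      (\<forall>\<eta>\<in>tangent_Q (orbit G). inner_Q (orbit G) (dproj G ?g) \<eta> = \<eta> (f_Q C))"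
      unfolding tangent_Q_orbit[OF G] using g h inner_Q_dproj[OF G g] by auto
    fix \<xi> assume \<xi>: "\<xi> \<in> tangent_Q (orbit G) \<and>
      (\<forall>\<eta>\<in>tangent_Q (orbit G). inner_Q (orbit G) \<xi> \<eta> = \<eta> (f_Q C))"
    then obtain v where v: "v \<in> horizontal G" "\<xi> = dproj G v"
      unfolding tangent_Q_orbit[OF G] by blast
    have "v \<bullet> w = ?g \<bullet> w" if w: "w \<in> horizontal G" for w
      using \<xi> inner_Q_dproj[OF G v(1) w] h[OF w] w v(2) unfolding tangent_Q_orbit[OF G] by auto
    from this[OF v(1)] this[OF g] have "(v - ?g) \<bullet> (v - ?g) = 0"
      by (simp add: inner_diff_left inner_diff_right inner_commute)
    then show "\<xi> = dproj G ?g" using v(2) by simp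
  qed
  then show ?thesis
    using inner_Q_dproj[OF G g g] by (simp add: norm_Q_def norm_eq_sqrt_inner)
qed

section \<open>Upper bound for the quotient distance\<close>

lemma dist_Q_le_smooth_path:
  fixes \<gamma> :: "real \<Rightarrow> ('n::finite, 'd::finite) stack"
  assumes \<gamma>: "smooth_on UNIV \<gamma>" "\<And>t. \<gamma> t \<in> orth_stack"
    and L: "\<And>t. norm (vector_derivative \<gamma> (at t)) \<le> L"
  shows "dist_Q (orbit (\<gamma> 0)) (orbit (\<gamma> 1)) \<le> ereal L"
proof -
  let ?c = "\<lambda>t. orbit (\<gamma> t)"
  have sc: "smooth_curve_Q J ?c" if "open J" for J
    by (rule smooth_curve_Q_orbit[OF that smooth_on_subset[OF _ \<gamma>(1)]]) (use \<gamma>(2) in auto)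
  have "smooth_segment_Q 0 1 ?c"
    unfolding smooth_segment_Q_def using sc by (intro exI[of _ 1] conjI exI[of _ ?c]) auto
  then have ps: "piecewise_smooth_Q 0 1 ?c"
    unfolding piecewise_smooth_Q_def
    by (intro exI[of _ 1] exI[of _ real]) auto
  let ?g = "\<lambda>t. norm_Q (?c t) (velocity_Q ?c t)"
  have g: "?g t \<le> L" for t
  proof -
    note lift = velocity_Q_lift[OF open_UNIV UNIV_I \<gamma>(1) \<gamma>(2) refl, of t]
    show ?thesis
      using lift(3) norm_hproj_le[OF \<gamma>(2) lift(1)] L[of t] by simp
  qed
  have "0 \<le> L" using L[of 0] norm_ge_zero by (rule order_trans[rotated])
  have "length_Q 0 1 ?c \<le> L"
  proof (cases "?g integrable_on {0..1}")
    case True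
    have "integral {0..1} ?g \<le> integral {0..1::real} (\<lambda>_. L)"
      using g by (intro Henstock_Kurzweil_Integration.integral_le True) auto
    then show ?thesis by (simp add: length_Q_def)
  next
    \<comment> \<open>The integral of a function that is not integrable is 0 by convention, so
      \<open>0 \<le> L\<close> settles this case.\<close>
    case False
    then show ?thesis using \<open>0 \<le> L\<close> by (simp add: length_Q_def not_integrable_integral)
  qed
  then have "ereal (length_Q 0 1 ?c) \<le> ereal L" by simp
  moreover have "dist_Q (?c 0) (?c 1) \<le> ereal (length_Q 0 1 ?c)"
    unfolding dist_Q_def using ps
    by (intro Inf_lower CollectI exI[of _ "0::real"] exI[of _ "1::real"] exI[of _ ?c]) auto
  ultimately show ?thesis by (rule order_trans[rotated])
qed

text \<open>The Cayley paths of all blocks run simultaneously over the unit interval, so the squares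
  of their speed bounds add up to the squared Frobenius norm.\<close>

lemma dist_Q_le_norm_diff:
  fixes G H :: "('n::finite, 'd::finite) stack"
  assumes G: "G \<in> orth_stack" and H: "H \<in> orth_stack"
    and near: "\<And>i. norm (block H i - block G i) \<le> 1/4"
  shows "dist_Q (orbit G) (orbit H) \<le> ereal (8/7 * norm (H - G))"
proof -
  have diff: "transpose (block G i) ** block H i - mat 1 = transpose (block G i) ** (block H i - block G i)" for i
    by (simp add: mm.diff_right orth_tr orth_stackD[OF G])
  have nQ: "norm (transpose (block G i) ** block H i - mat 1) = norm (block H i - block G i)" for i
    unfolding diff by (simp add: norm_orthogonal_mult orth_stackD[OF G])
  have "\<exists>c. smooth_on UNIV c \<and> (\<forall>t. orthogonal_matrix (c t)) \<and> c 0 = mat 1 \<and>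
      c 1 = transpose (block G i) ** block H i \<and>
      (\<forall>t. norm (vector_derivative c (at t)) \<le> 8/7 * norm (block H i - block G i))" for i
    using orthogonal_path_exists[of "transpose (block G i) ** block H i"] near[of i] nQ[of i]
      orthogonal_matrix_mult[of "transpose (block G i)" "block H i"] orth_stackD[OF G] orth_stackD[OF H]
    by (metis orthogonal_matrix_transpose)
  then obtain c where c: "\<And>i. smooth_on UNIV (c i)" "\<And>i t. orthogonal_matrix (c i t)"
    "\<And>i. c i 0 = mat 1" "\<And>i. c i 1 = transpose (block G i) ** block H i"
    "\<And>i t. norm (vector_derivative (c i) (at t)) \<le> 8/7 * norm (block H i - block G i)"
    by metis
  define \<gamma> where "\<gamma> = (\<lambda>t. stack_of (\<lambda>i. block G i ** c i t))"
  have sm: "smooth_on UNIV \<gamma>"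
    unfolding \<gamma>_def stack_of_eq_sum
    by (intro smooth_on_sum smooth_on_bounded_linear[OF _ bounded_linear_embed_block]
        smooth_on_bounded_linear[OF _ mm.bounded_linear_right] c) auto
  have st: "\<gamma> t \<in> orth_stack" for t
    using c(2) orth_stackD[OF G] by (simp add: \<gamma>_def orth_stack_def orthogonal_matrix_mult)
  have "norm (vector_derivative \<gamma> (at t)) \<le> 8/7 * norm (H - G)" for t
  proof -
    have "(\<gamma> has_vector_derivative
        (\<Sum>i\<in>UNIV. embed_block i (block G i ** vector_derivative (c i) (at t)))) (at t)"
      unfolding \<gamma>_def stack_of_eq_sum
      by (intro has_vector_derivative_sum bounded_linear.has_vector_derivative[OF bounded_linear_embed_block]
          bounded_linear.has_vector_derivative[OF mm.bounded_linear_right]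
          smooth_on_has_vector_derivative[OF c(1)]) auto
    then have vd: "vector_derivative \<gamma> (at t) = stack_of (\<lambda>i. block G i ** vector_derivative (c i) (at t))"
      unfolding stack_of_eq_sum[symmetric] by (rule vector_derivative_at)
    have "(norm (vector_derivative \<gamma> (at t)))\<^sup>2 = (\<Sum>i\<in>UNIV. (norm (vector_derivative (c i) (at t)))\<^sup>2)"
      unfolding vd norm_blocks by (simp add: norm_orthogonal_mult orth_stackD[OF G])
    also have "\<dots> \<le> (\<Sum>i\<in>UNIV. (8/7 * norm (block H i - block G i))\<^sup>2)"
      by (intro sum_mono power_mono c) auto
    also have "\<dots> = (8/7 * norm (H - G))\<^sup>2"
      unfolding power_mult_distrib sum_distrib_left[symmetric] by (simp add: norm_blocks[of "H - G"])
    finally show ?thesis by (rule power2_le_imp_le) auto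
  qed
  from dist_Q_le_smooth_path[OF sm st this]
  have "dist_Q (orbit (\<gamma> 0)) (orbit (\<gamma> 1)) \<le> ereal (8/7 * norm (H - G))" .
  moreover have "\<gamma> 0 = G" "\<gamma> 1 = H"
    by (auto simp: \<gamma>_def stack_eq_iff c(3,4) matrix_mul_assoc orth_tr orth_stackD[OF G])
  ultimately show ?thesis by simp
qed

section \<open>Lower bound for the distance\<close>

lemma dF_bdd: "bdd_below {norm (X - Y ** Q) | Q. orthogonal_matrix Q}"
  by (rule bdd_belowI[of _ 0]) auto

lemma dF_le: "orthogonal_matrix Q \<Longrightarrow> dF X Y \<le> norm (X - Y ** Q)"
  unfolding dF_def by (rule cInf_lower[OF _ dF_bdd]) auto

lemma dF_approx:
  assumes "e > 0"
  obtains Q where "orthogonal_matrix Q" "norm (X - Y ** Q) < dF X Y + e"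
proof -
  have "{norm (X - Y ** Q) | Q. orthogonal_matrix Q} \<noteq> {}"
    using orthogonal_matrix_id by blast
  moreover have "Inf {norm (X - Y ** Q) | Q. orthogonal_matrix Q} < dF X Y + e"
    using assms by (simp add: dF_def)
  ultimately show thesis using that cInf_lessD by (smt (verit, best) mem_Collect_eq)
qed

lemma dF_triangle: "dF X Z \<le> dF X Y + dF Y Z"
proof (rule field_le_epsilon)
  fix e :: real assume "e > 0"
  then have e: "e/2 > 0" by simp
  obtain Q where Q: "orthogonal_matrix Q" "norm (X - Y ** Q) < dF X Y + e/2" using dF_approx[OF e] .
  obtain R where R: "orthogonal_matrix R" "norm (Y - Z ** R) < dF Y Z + e/2" using dF_approx[OF e] .
  have "X - Z ** (R ** Q) = (X - Y ** Q) + (Y - Z ** R) ** Q"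
    by (simp add: mm.diff_left matrix_mul_assoc)
  then have "norm (X - Z ** (R ** Q)) \<le> norm (X - Y ** Q) + norm ((Y - Z ** R) ** Q)"
    by (simp only: norm_triangle_ineq)
  then have "norm (X - Z ** (R ** Q)) \<le> norm (X - Y ** Q) + norm (Y - Z ** R)"
    by (simp only: norm_mult_orthogonal[OF Q(1)])
  then show "dF X Z \<le> dF X Y + dF Y Z + e"
    using dF_le[OF orthogonal_matrix_mult[OF R(1) Q(1)], of X Z] Q(2) R(2) by simp
qed

lemma dF_le_mult_left: "orthogonal_matrix Q \<Longrightarrow> dF X Y \<le> norm (X ** Q - Y)"
proof -
  assume Q: "orthogonal_matrix Q"
  have "X ** Q - Y = (X - Y ** transpose Q) ** Q"
    by (simp add: mm.diff_left orth_tr Q)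
  then show ?thesis
    using dF_le[of "transpose Q" X Y] Q by (simp add: norm_mult_orthogonal[OF Q])
qed

text \<open>Points with the same orbit have \<open>dF\<close> at most 0, so the triangle inequality
  exchanges representatives.\<close>

lemma dF_orbit_eq:
  fixes X X' Y Y' :: "('n::finite, 'd::finite) stack"
  assumes "orbit X = orbit X'" "orbit Y = orbit Y'"
  shows "dF X Y = dF X' Y'"
proof -
  have z: "dF A B \<le> 0" if "orbit A = orbit B" for A B :: "('n, 'd) stack"
  proof -
    have "A \<in> orbit B" using orbit_self[of A] that by simp
    then obtain Q where "orthogonal_matrix Q" "A = B ** Q" unfolding orbit_def by blast
    then show ?thesis using dF_le[of Q A B] by simp
  qed
  then show ?thesis
    using z[OF assms(1)] z[OF assms(1)[symmetric]] z[OF assms(2)] z[OF assms(2)[symmetric]]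
      dF_triangle[of X Y X'] dF_triangle[of X' Y Y'] dF_triangle[of X' Y' X] dF_triangle[of X Y' Y]
    by linarith
qed

section \<open>From first-order estimates to length\<close>

lemma continuous_on_speed:
  fixes \<gamma> :: "real \<Rightarrow> ('n::finite, 'd::finite) stack"
  assumes "open J" "smooth_on J \<gamma>"
  shows "continuous_on J (\<lambda>t. norm (hproj (\<gamma> t) (vector_derivative \<gamma> (at t))))"
  unfolding hproj_def
  by (intro continuous_intros mm.continuous_on bounded_linear.continuous_on[OF bounded_linear_transpose]
      smooth_on_continuous_on smooth_on_vector_derivative assms)

text \<open>If \<open>G ** A\<close> is the vertical part of the velocity, the rotation
  \<open>c\<close> with velocity \<open>- A\<close> is free for \<open>dF\<close> and leaves a curve
  with horizontal velocity. Both argument orders are kept, for use to the right and to the left of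
  \<open>x\<close>.\<close>

lemma dF_local_estimate:
  fixes \<gamma> :: "real \<Rightarrow> ('n::finite, 'd::finite) stack"
  assumes J: "open J" "x \<in> J" and \<gamma>: "smooth_on J \<gamma>" "\<And>s. s \<in> J \<Longrightarrow> \<gamma> s \<in> orth_stack"
    and e: "e > 0"
  obtains d where "d > 0"
    "\<And>w. \<bar>w - x\<bar> < d \<Longrightarrow> dF (\<gamma> x) (\<gamma> w) \<le> (norm (hproj (\<gamma> x) (vector_derivative \<gamma> (at x))) + e) * \<bar>w - x\<bar>"
    "\<And>w. \<bar>w - x\<bar> < d \<Longrightarrow> dF (\<gamma> w) (\<gamma> x) \<le> (norm (hproj (\<gamma> x) (vector_derivative \<gamma> (at x))) + e) * \<bar>w - x\<bar>"
proof -
  let ?v = "vector_derivative \<gamma> (at x)"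
  have G: "\<gamma> x \<in> orth_stack" using \<gamma>(2) J(2) .
  have tang: "?v \<in> tangent orth_stack (\<gamma> x)"
    using velocity_Q_lift(1)[OF J \<gamma> refl] .
  obtain A where A: "skew A" "hproj (\<gamma> x) ?v = ?v - \<gamma> x ** A" using hproj_vertical_part[OF G tang] .
  have "skew (- A)" using A(1) by (simp add: transpose_linear_simps)
  from orthogonal_curve_exists[OF this] obtain c where
    c: "\<And>t. orthogonal_matrix (c t)" "c 0 = mat 1" "(c has_vector_derivative - A) (at 0)" by metis
  define \<phi> where "\<phi> = (\<lambda>w. \<gamma> w ** c (w - x))"
  have "((\<lambda>w. w - x) has_vector_derivative 1) (at x)"
    using has_vector_derivative_diff[OF has_vector_derivative_id has_vector_derivative_const, of x "at x"] by simp
  then have "((\<lambda>w. c (w - x)) has_vector_derivative - A) (at x)"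
    using vector_diff_chain_at[of "\<lambda>w. w - x" 1 x c "- A"] c(3) by (simp add: o_def)
  from mm.has_vector_derivative[OF smooth_on_has_vector_derivative[OF \<gamma>(1) J(2)] this]
  have "(\<phi> has_vector_derivative hproj (\<gamma> x) ?v) (at x)"
    by (simp add: \<phi>_def c(2) A(2) mm.minus_right)
  then have "(\<phi> has_derivative (\<lambda>s. s *\<^sub>R hproj (\<gamma> x) ?v)) (at x)"
    by (simp add: has_vector_derivative_def)
  then obtain d where d: "d > 0" "\<And>w. norm (w - x) < d \<Longrightarrow>
      norm (\<phi> w - \<phi> x - (w - x) *\<^sub>R hproj (\<gamma> x) ?v) \<le> e * norm (w - x)"
    using e unfolding has_derivative_at_alt by blast
  have est: "norm (\<gamma> w ** c (w - x) - \<gamma> x) \<le> (norm (hproj (\<gamma> x) ?v) + e) * \<bar>w - x\<bar>"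
    if "\<bar>w - x\<bar> < d" for w
  proof -
    have "\<phi> w - \<phi> x = (\<phi> w - \<phi> x - (w - x) *\<^sub>R hproj (\<gamma> x) ?v) + (w - x) *\<^sub>R hproj (\<gamma> x) ?v" by simp
    then have "norm (\<phi> w - \<phi> x) \<le> e * \<bar>w - x\<bar> + \<bar>w - x\<bar> * norm (hproj (\<gamma> x) ?v)"
      using norm_triangle_ineq[of "\<phi> w - \<phi> x - (w - x) *\<^sub>R hproj (\<gamma> x) ?v" "(w - x) *\<^sub>R hproj (\<gamma> x) ?v"]
        d(2)[of w] that by simp
    then show ?thesis by (simp add: \<phi>_def c(2) algebra_simps)
  qed
  show thesis
  proof (rule that[OF d(1)])
    fix w assume w: "\<bar>w - x\<bar> < d"
    show "dF (\<gamma> x) (\<gamma> w) \<le> (norm (hproj (\<gamma> x) ?v) + e) * \<bar>w - x\<bar>"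
      using dF_le[OF c(1), of "\<gamma> x" "\<gamma> w" "w - x"] est[OF w] by (simp add: norm_minus_commute)
    show "dF (\<gamma> w) (\<gamma> x) \<le> (norm (hproj (\<gamma> x) ?v) + e) * \<bar>w - x\<bar>"
      using dF_le_mult_left[OF c(1), of "\<gamma> w" "\<gamma> x" "w - x"] est[OF w] by simp
  qed
qed

text \<open>A bisection argument: the estimate with slack \<open>e\<close> per unit of time is
  additive over adjacent intervals and holds on all short intervals around each point.\<close>

lemma dF_le_integral_speed:
  fixes \<gamma> :: "real \<Rightarrow> ('n::finite, 'd::finite) stack"
  assumes J: "open J" "{a..b} \<subseteq> J" and \<gamma>: "smooth_on J \<gamma>" "\<And>s. s \<in> J \<Longrightarrow> \<gamma> s \<in> orth_stack"
    and ab: "a \<le> b"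
  shows "dF (\<gamma> a) (\<gamma> b) \<le> integral {a..b} (\<lambda>t. norm (hproj (\<gamma> t) (vector_derivative \<gamma> (at t))))"
proof -
  define \<nu> where "\<nu> = (\<lambda>t. norm (hproj (\<gamma> t) (vector_derivative \<gamma> (at t))))"
  have cont: "continuous_on {a..b} \<nu>"
    unfolding \<nu>_def by (rule continuous_on_subset[OF continuous_on_speed[OF J(1) \<gamma>(1)] J(2)])
  have int: "\<nu> integrable_on {u..w}" if "a \<le> u" "w \<le> b" for u w
    using cont that by (intro integrable_continuous_interval) (auto intro: continuous_on_subset)
  have main: "dF (\<gamma> a) (\<gamma> b) \<le> integral {a..b} \<nu> + e * (b - a)" if e: "e > 0" for e
  proof -
    define P where "P = (\<lambda>u w. a \<le> u \<and> u \<le> w \<and> w \<le> b \<longrightarrow>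
      dF (\<gamma> u) (\<gamma> w) \<le> integral {u..w} \<nu> + e * (w - u))"
    have "P a b"
    proof (rule Bolzano[OF ab])
      fix u v w assume 1: "P u v" "P v w" "u \<le> v" "v \<le> w"
      show "P u w"
        unfolding P_def
      proof
        assume h: "a \<le> u \<and> u \<le> w \<and> w \<le> b"
        have "integral {u..v} \<nu> + integral {v..w} \<nu> = integral {u..w} \<nu>"
          using 1 h by (intro Henstock_Kurzweil_Integration.integral_combine int) auto
        moreover have "dF (\<gamma> u) (\<gamma> v) \<le> integral {u..v} \<nu> + e * (v - u)"
          "dF (\<gamma> v) (\<gamma> w) \<le> integral {v..w} \<nu> + e * (w - v)"
          using 1 h by (auto simp: P_def)
        ultimately show "dF (\<gamma> u) (\<gamma> w) \<le> integral {u..w} \<nu> + e * (w - u)"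
          using dF_triangle[of "\<gamma> u" "\<gamma> w" "\<gamma> v"] by (simp add: algebra_simps)
      qed
    next
      fix x assume 2: "a \<le> x" "x \<le> b"
      have xJ: "x \<in> J" using 2 J(2) by auto
      \<comment> \<open>One half of the slack absorbs the first-order error of \<open>dF\<close>,
        the other half the variation of the speed near \<open>x\<close>.\<close>
      have e2: "e/2 > 0" using e by simp
      obtain d1 where d1: "d1 > 0"
        "\<And>w. \<bar>w - x\<bar> < d1 \<Longrightarrow> dF (\<gamma> x) (\<gamma> w) \<le> (\<nu> x + e/2) * \<bar>w - x\<bar>"
        "\<And>w. \<bar>w - x\<bar> < d1 \<Longrightarrow> dF (\<gamma> w) (\<gamma> x) \<le> (\<nu> x + e/2) * \<bar>w - x\<bar>"
        using dF_local_estimate[OF J(1) xJ \<gamma> e2] unfolding \<nu>_def by metis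
      have "\<exists>d>0. \<forall>t\<in>{a..b}. dist t x < d \<longrightarrow> dist (\<nu> t) (\<nu> x) < e/2"
        using cont[unfolded continuous_on_iff, rule_format, of x "e/2"] 2 e2 by auto
      then obtain d2 where d2: "d2 > 0" "\<And>t. t \<in> {a..b} \<Longrightarrow> \<bar>t - x\<bar> < d2 \<Longrightarrow> \<bar>\<nu> t - \<nu> x\<bar> < e/2"
        unfolding dist_real_def by blast
      show "\<exists>d>0. \<forall>u w. u \<le> x \<and> x \<le> w \<and> w - u < d \<longrightarrow> P u w"
        unfolding P_def
      proof (intro exI[of _ "min d1 d2"] conjI allI impI)
        show "min d1 d2 > 0" using d1(1) d2(1) by simp
        fix u w assume h: "u \<le> x \<and> x \<le> w \<and> w - u < min d1 d2" "a \<le> u \<and> u \<le> w \<and> w \<le> b"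
        have "dF (\<gamma> u) (\<gamma> w) \<le> (\<nu> x + e/2) * \<bar>u - x\<bar> + (\<nu> x + e/2) * \<bar>w - x\<bar>"
          using dF_triangle[of "\<gamma> u" "\<gamma> w" "\<gamma> x"] d1(2)[of w] d1(3)[of u] h by auto
        also have "\<dots> = (\<nu> x + e/2) * (\<bar>u - x\<bar> + \<bar>w - x\<bar>)" by (simp only: distrib_left)
        also have "\<bar>u - x\<bar> + \<bar>w - x\<bar> = w - u" using h by simp
        finally have 1: "dF (\<gamma> u) (\<gamma> w) \<le> (\<nu> x + e/2) * (w - u)" .
        have "integral {u..w} (\<lambda>_. \<nu> x - e/2) \<le> integral {u..w} \<nu>"
        proof (rule Henstock_Kurzweil_Integration.integral_le)
          fix t assume "t \<in> {u..w}"
          then have "\<bar>\<nu> t - \<nu> x\<bar> < e/2" using d2(2)[of t] h by auto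
          then show "\<nu> x - e/2 \<le> \<nu> t" by linarith
        qed (use int h in auto)
        then have "(\<nu> x - e/2) * (w - u) \<le> integral {u..w} \<nu>" using h by (simp add: mult.commute)
        then show "dF (\<gamma> u) (\<gamma> w) \<le> integral {u..w} \<nu> + e * (w - u)"
        proof -
          have "(\<nu> x + e/2) * (w - u) = (\<nu> x - e/2) * (w - u) + e * (w - u)"
            by (simp add: field_simps)
          with 1 \<open>(\<nu> x - e/2) * (w - u) \<le> integral {u..w} \<nu>\<close> show ?thesis by linarith
        qed
      qed
    qed
    then show ?thesis using ab by (simp add: P_def)
  qed
  have "dF (\<gamma> a) (\<gamma> b) \<le> integral {a..b} \<nu>"
  proof (rule field_le_epsilon)
    fix e :: real assume e: "e > 0"
    \<comment> \<open>Adding 1 keeps the denominator positive when \<open>a = b\<close>.\<close>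
    then have "e / (b - a + 1) * (b - a) \<le> e" using ab by (simp add: field_simps)
    with main[of "e / (b - a + 1)"] show "dF (\<gamma> a) (\<gamma> b) \<le> integral {a..b} \<nu> + e"
      using e ab by (simp add: add_nonneg_pos)
  qed
  then show ?thesis by (simp add: \<nu>_def)
qed

lemma dF_le_length_segment:
  fixes c :: "real \<Rightarrow> ('n::finite, 'd::finite) qpoint"
  assumes seg: "smooth_segment_Q s t c" and st: "s < t"
  obtains I where "((\<lambda>u. norm_Q (c u) (velocity_Q c u)) has_integral I) {s..t}"
    "dF (section_Q (c s)) (section_Q (c t)) \<le> I" "c s \<in> quot" "c t \<in> quot"
proof -
  obtain e c' where e: "e > 0" "smooth_curve_Q {s-e<..<t+e} c'" "\<forall>u\<in>{s..t}. c' u = c u"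
    using seg unfolding smooth_segment_Q_def by blast
  let ?J = "{s-e<..<t+e}"
  define \<gamma> where "\<gamma> = (\<lambda>u. section_Q (c' u))"
  have sm: "smooth_on ?J \<gamma>"
    unfolding \<gamma>_def by (rule smooth_section_along_curve[OF _ e(2)]) simp
  have quot: "c' u \<in> quot" if "u \<in> ?J" for u
    using e(2) that unfolding smooth_curve_Q_def by blast
  have st': "\<gamma> u \<in> orth_stack" "c' u = orbit (\<gamma> u)" if "u \<in> ?J" for u
    using section_Q_props[OF quot[OF that]] by (auto simp: \<gamma>_def)
  let ?\<nu> = "\<lambda>u. norm (hproj (\<gamma> u) (vector_derivative \<gamma> (at u)))"
  have sub: "{s..t} \<subseteq> ?J" using e(1) by auto
  have "continuous_on {s..t} ?\<nu>"
    by (rule continuous_on_subset[OF continuous_on_speed[OF _ sm] sub]) simp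
  then have "(?\<nu> has_integral integral {s..t} ?\<nu>) (cbox s t)"
    using integrable_integral[OF integrable_continuous_interval] by simp
  then have "((\<lambda>u. norm_Q (c u) (velocity_Q c u)) has_integral integral {s..t} ?\<nu>) (cbox s t)"
  \<comment> \<open>\<open>c\<close> agrees with its smooth extension only on the closed interval,
    so its two-sided derivative is known only in the interior; the endpoints do not affect the
    integral.\<close>
  proof (rule has_integral_spike_interior)
    fix u assume "u \<in> box s t"
    then have u: "u \<in> {s<..<t}" by simp
    have sm': "smooth_on {s<..<t} \<gamma>" by (rule smooth_on_subset[OF _ sm]) (use e(1) in auto)
    have st2: "\<gamma> v \<in> orth_stack" "c v = orbit (\<gamma> v)" if "v \<in> {s<..<t}" for v
      using st'[of v] e that by auto
    show "norm_Q (c u) (velocity_Q c u) = ?\<nu> u"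
      by (rule velocity_Q_lift(3)[OF open_greaterThanLessThan u sm' st2])
  qed
  moreover have "dF (section_Q (c s)) (section_Q (c t)) \<le> integral {s..t} ?\<nu>"
    using dF_le_integral_speed[OF _ sub sm st'(1)] st e(3) by (simp add: \<gamma>_def)
  moreover have "c s \<in> quot" "c t \<in> quot"
    using quot[of s] quot[of t] e st by auto
  ultimately show thesis using that by auto
qed

lemma dF_le_dist_Q:
  fixes G H :: "('n::finite, 'd::finite) stack"
  shows "ereal (dF G H) \<le> dist_Q (orbit G) (orbit H)"
  unfolding dist_Q_def
proof (rule Inf_greatest)
  fix l assume "l \<in> {ereal (length_Q a b c) |a b c.
     a < b \<and> piecewise_smooth_Q a b c \<and> c a = orbit G \<and> c b = orbit H}"
  then obtain a b c where l: "l = ereal (length_Q a b c)" "a < b" "piecewise_smooth_Q a b c"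
    "c a = orbit G" "c b = orbit H" by blast
  obtain N \<tau> where \<tau>: "\<tau> 0 = a" "\<tau> N = b"
    "\<And>k. k < N \<Longrightarrow> \<tau> k < \<tau> (Suc k)" "\<And>k. k < N \<Longrightarrow> smooth_segment_Q (\<tau> k) (\<tau> (Suc k)) c"
    using l(3) unfolding piecewise_smooth_Q_def by blast
  let ?g = "\<lambda>u. norm_Q (c u) (velocity_Q c u)"
  have ind: "\<tau> 0 \<le> \<tau> k \<and> (\<exists>I. (?g has_integral I) {\<tau> 0..\<tau> k} \<and>
      dF (section_Q (c (\<tau> 0))) (section_Q (c (\<tau> k))) \<le> I)" if "k \<le> N" for k
    using that
  proof (induction k)
    case 0
    have "dF X X \<le> 0" for X :: "('n, 'd) stack"
      using dF_le[OF orthogonal_matrix_id, of X X] by simp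
    then show ?case by (auto intro!: exI[of _ 0])
  next
    case (Suc k)
    then obtain I where I: "\<tau> 0 \<le> \<tau> k" "(?g has_integral I) {\<tau> 0..\<tau> k}"
      "dF (section_Q (c (\<tau> 0))) (section_Q (c (\<tau> k))) \<le> I" by auto
    obtain I' where I': "(?g has_integral I') {\<tau> k..\<tau> (Suc k)}"
      "dF (section_Q (c (\<tau> k))) (section_Q (c (\<tau> (Suc k)))) \<le> I'"
      using dF_le_length_segment[OF \<tau>(4) \<tau>(3), of k] Suc.prems by auto
    have lt: "\<tau> k < \<tau> (Suc k)" using \<tau>(3) Suc.prems by auto
    have "(?g has_integral (I + I')) {\<tau> 0..\<tau> (Suc k)}"
      using has_integral_combine[OF I(1) _ I(2) I'(1)] lt by simp
    moreover have "dF (section_Q (c (\<tau> 0))) (section_Q (c (\<tau> (Suc k)))) \<le> I + I'"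
      using dF_triangle[of "section_Q (c (\<tau> 0))" "section_Q (c (\<tau> (Suc k)))" "section_Q (c (\<tau> k))"]
        I(3) I'(2) by simp
    ultimately show ?case using I(1) lt by auto
  qed
  then obtain I where I: "(?g has_integral I) {a..b}" "dF (section_Q (c a)) (section_Q (c b)) \<le> I"
    using ind[of N] \<tau>(1,2) by auto
  \<comment> \<open>Membership of the endpoints in \<open>quot\<close> is read off the first and the
    last segment; \<open>a < b\<close> guarantees that there is one.\<close>
  have "N > 0" using \<tau>(1,2) l(2) by (cases N) auto
  then have q: "c a \<in> quot" "c b \<in> quot"
    using dF_le_length_segment[OF \<tau>(4) \<tau>(3), of 0] dF_le_length_segment[OF \<tau>(4) \<tau>(3), of "N - 1"] \<tau>(1,2)
    by auto
  then have "dF (section_Q (c a)) (section_Q (c b)) = dF G H"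
    using section_Q_props(2)[OF q(1)] section_Q_props(2)[OF q(2)] l(4,5) by (intro dF_orbit_eq) auto
  then show "ereal (dF G H) \<le> l"
    using I l(1) by (simp add: length_Q_def integral_unique)
qed

section \<open>Maximizers of the objective\<close>

definition outer :: "real^'n \<Rightarrow> real^'n^'n" where
  "outer u = (\<chi> i j. u $ i * u $ j)"

lemma transpose_outer: "transpose (outer u) = outer u"
  by (simp add: outer_def transpose_def vec_eq_iff)

lemma outer_mult_outer: "norm u = 1 \<Longrightarrow> outer u ** outer u = outer u"
proof -
  assume u: "norm u = 1"
  then have "(\<Sum>k\<in>UNIV. u $ k * u $ k) = 1"
    using power2_norm_eq_inner[of u] by (simp add: inner_vec_def)
  moreover have "(outer u ** outer u) $ i $ j = u $ i * u $ j * (\<Sum>k\<in>UNIV. u $ k * u $ k)" for i j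
    by (simp add: outer_def matrix_matrix_mult_def sum_distrib_left mult_ac)
  ultimately show ?thesis by (simp add: outer_def vec_eq_iff)
qed

lemma inner_outer: "Z \<bullet> outer u = u \<bullet> (Z *v u)"
  by (simp add: inner_matrix_sum outer_def inner_vec_def matrix_vector_mult_def sum_distrib_left mult_ac)

lemma orthogonal_householder:
  assumes "norm u = 1"
  shows "orthogonal_matrix (mat 1 - 2 *\<^sub>R outer u)"
  unfolding orthogonal_matrix
  by (simp add: mm_simps transpose_outer outer_mult_outer[OF assms]) (simp add: vec_eq_iff)

lemma unit_vector_cases:
  fixes v :: "'a::real_normed_vector"
  obtains u where "norm u = 1" "v = norm v *\<^sub>R u" | "v = 0"
  by (metis divideR_right norm_eq_zero norm_sgn sgn_div_norm)

text \<open>The optimality behind the polar factorisation: curves of rotations through the identity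
  give symmetry to first order, and comparison with reflections gives nonnegativity.\<close>

lemma symmetric_psd_if_aligned:
  fixes Z :: "real^'n^'n"
  assumes max: "\<And>Q. orthogonal_matrix Q \<Longrightarrow> Z \<bullet> Q \<le> Z \<bullet> mat 1"
  shows "transpose Z = Z" "0 \<le> v \<bullet> (Z *v v)"
proof -
  show "transpose Z = Z"
  proof (rule symmetric_if_orthogonal_to_skew)
    fix A :: "real^'n^'n" assume "skew A"
    from orthogonal_curve_exists[OF this] obtain c where
      c: "\<And>t. orthogonal_matrix (c t)" "c 0 = mat 1" "(c has_vector_derivative A) (at 0)" by metis
    have "((\<lambda>t. Z \<bullet> c t) has_real_derivative Z \<bullet> A) (at 0)"
      unfolding has_real_derivative_iff_has_vector_derivative
      by (rule bounded_linear.has_vector_derivative[OF bounded_linear_inner_right c(3)])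
    then show "Z \<bullet> A = 0"
      by (rule DERIV_local_max[of _ _ _ 1]) (use max c in auto)
  qed
  show "0 \<le> v \<bullet> (Z *v v)"
  proof (cases v rule: unit_vector_cases)
    case (1 u)
    have "0 \<le> u \<bullet> (Z *v u)"
      using max[OF orthogonal_householder[OF 1(1)]] by (simp add: inner_diff_right inner_outer)
    then show ?thesis
      by (subst 1(2), subst (2) 1(2)) (simp add: matrix_vector_mult_scaleR)
  qed simp
qed

text \<open>This is the trace of Z^2 \<le> c Z. The latter follows without eigenvectors by testing
  semidefiniteness on v - Z v / c.\<close>

lemma norm_psd_le_trace:
  fixes Z :: "real^'n^'n"
  assumes sym: "transpose Z = Z" and psd: "\<And>v. 0 \<le> v \<bullet> (Z *v v)"
    and bd: "\<And>v. norm (Z *v v) \<le> c * norm v" and c: "c > 0"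
  shows "(norm Z)\<^sup>2 \<le> c * trace Z"
proof -
  have selfadj: "x \<bullet> (Z *v y) = (Z *v x) \<bullet> y" for x y
    using dot_lmul_matrix[of x Z y] transpose_matrix_vector[of Z x] sym by simp
  have v: "(norm (Z *v v))\<^sup>2 \<le> c * (v \<bullet> (Z *v v))" for v
  proof -
    let ?w = "Z *v v"
    have "?w \<bullet> (Z *v ?w) \<le> norm ?w * norm (Z *v ?w)" by (rule norm_cauchy_schwarz)
    also have "\<dots> \<le> norm ?w * (c * norm ?w)" by (intro mult_left_mono bd) auto
    finally have w: "?w \<bullet> (Z *v ?w) \<le> c * (norm ?w)\<^sup>2" by (simp add: power2_eq_square mult_ac)
    have "0 \<le> (v - (1/c) *\<^sub>R ?w) \<bullet> (Z *v (v - (1/c) *\<^sub>R ?w))" by (rule psd)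
    also have "\<dots> = v \<bullet> ?w - 2 / c * (norm ?w)\<^sup>2 + (1/c)\<^sup>2 * (?w \<bullet> (Z *v ?w))"
      unfolding power2_norm_eq_inner
      by (simp add: matrix_vector_mult_diff_distrib matrix_vector_mult_scaleR inner_diff_left
          inner_diff_right selfadj[of v ?w] power2_eq_square diff_divide_distrib)
    also have "\<dots> \<le> v \<bullet> ?w - 2 / c * (norm ?w)\<^sup>2 + (1/c)\<^sup>2 * (c * (norm ?w)\<^sup>2)"
      by (intro add_left_mono mult_left_mono w) auto
    also have "\<dots> = v \<bullet> ?w - (norm ?w)\<^sup>2 / c"
      using c by (simp add: power2_eq_square field_simps)
    finally show ?thesis using c by (simp add: field_simps)
  qed
  have "(norm Z)\<^sup>2 = (\<Sum>j\<in>UNIV. (norm (Z *v axis j 1))\<^sup>2)"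
    by (simp add: norm_columns matrix_vector_mult_basis)
  also have "\<dots> \<le> (\<Sum>j\<in>UNIV. c * (axis j 1 \<bullet> (Z *v axis j 1)))"
    by (intro sum_mono v)
  also have "\<dots> = c * trace Z"
    by (simp add: trace_def sum_distrib_left matrix_vector_mult_basis inner_axis' column_def)
  finally show ?thesis .
qed

lemma norm_orthogonal_matrix: "orthogonal_matrix Q \<Longrightarrow> (norm Q)\<^sup>2 = real CARD('d)"
  for Q :: "real^'d^'d"
  using trace_transpose_mult[of Q Q] trace_I[where 'n='d and 'a=real]
  by (simp add: power2_norm_eq_inner orth_tr)

lemma orthogonal_maximizer_exists:
  fixes Z :: "real^'d^'d"
  obtains Q where "orthogonal_matrix Q" "\<And>R. orthogonal_matrix R \<Longrightarrow> Z \<bullet> R \<le> Z \<bullet> Q"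
proof -
  let ?O = "{Q :: real^'d^'d. orthogonal_matrix Q}"
  have "closed ?O"
    unfolding orthogonal_matrix
    by (intro closed_Collect_eq mm.continuous_on bounded_linear.continuous_on[OF bounded_linear_transpose]
        continuous_on_id continuous_on_const)
  moreover have "bounded ?O"
  proof (rule boundedI)
    fix Q assume "Q \<in> ?O"
    then show "norm Q \<le> sqrt (real CARD('d))"
      using norm_orthogonal_matrix[of Q] by (metis mem_Collect_eq norm_ge_zero order_refl real_sqrt_unique)
  qed
  ultimately have "compact ?O" by (simp add: compact_eq_bounded_closed)
  moreover have "?O \<noteq> {}" using orthogonal_matrix_id by blast
  moreover have "continuous_on ?O (\<lambda>Q. Z \<bullet> Q)" by (intro continuous_intros)
  ultimately show thesis using continuous_attains_sup[of ?O "\<lambda>Q. Z \<bullet> Q"] that by blast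
qed

lemma norm_orth_stack:
  fixes G :: "('n::finite, 'd::finite) stack"
  assumes "G \<in> orth_stack"
  shows "norm G = sqrt (real CARD('n) * real CARD('d))"
proof -
  have "(norm G)\<^sup>2 = real CARD('n) * real CARD('d)"
    using norm_orthogonal_matrix[OF orth_stackD[OF assms]] by (simp add: norm_blocks)
  then show ?thesis by (metis norm_ge_zero real_sqrt_unique)
qed

text \<open>Orthogonal right factors preserve the norm of \<open>G\<close>, so minimising the
  distance to \<open>H\<close> amounts to maximising the inner product with it.\<close>

lemma aligned_if_norm_minimal:
  fixes G H :: "('n::finite, 'd::finite) stack"
  assumes G: "G \<in> orth_stack" and min: "\<And>Q. orthogonal_matrix Q \<Longrightarrow> norm (G - H) \<le> norm (G ** Q - H)"
    and Q: "orthogonal_matrix Q"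
  shows "(transpose G ** H) \<bullet> Q \<le> (transpose G ** H) \<bullet> mat 1"
proof -
  have sq: "(norm (X - H))\<^sup>2 = (norm X)\<^sup>2 + (norm H)\<^sup>2 - 2 * (H \<bullet> X)" for X
    by (simp add: power2_norm_eq_inner inner_diff_left inner_diff_right inner_commute)
  have "(norm (G - H))\<^sup>2 \<le> (norm (G ** Q - H))\<^sup>2"
    by (intro power_mono min Q) auto
  then have "H \<bullet> (G ** Q) \<le> H \<bullet> G"
    unfolding sq norm_mult_orthogonal[OF Q] by simp
  then show ?thesis
    using inner_mult_left[of G Q H] inner_mult_left[of G "mat 1" H] by (simp add: inner_commute)
qed

lemma norm_le_onorm_mult:
  fixes M :: "real^'m^'n" and X :: "real^'k^'m"
  shows "norm (M ** X) \<le> onorm ((*v) M) * norm X"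
  by (rule norm_mult_le_of_vector)
     (use onorm[OF matrix_vector_mul_bounded_linear] onorm_pos_le[OF matrix_vector_mul_bounded_linear] in auto)

lemma gram_diff:
  fixes X Y :: "('n::finite, 'd::finite) stack"
  assumes "X \<in> orth_stack" "Y \<in> orth_stack"
  shows "transpose (X - Y) ** (X - Y) = (2 * real CARD('n)) *\<^sub>R mat 1 - (transpose X ** Y + transpose Y ** X)"
  using orth_stack_gram[OF assms(1)] orth_stack_gram[OF assms(2)]
  by (simp add: mm_simps algebra_simps) (simp add: scaleR_add_left[symmetric] vec_eq_iff)

text \<open>For aligned configurations \<open>Z = S\<^sup>T H\<close> is positive semidefinite with \<open>Z \<le> n\<close>, so
  \<open>n\<^sup>2 d - \<parallel>Z\<parallel>\<^sup>2 \<ge> n (n d - tr Z) = n \<parallel>H - S\<parallel>\<^sup>2 / 2\<close>, whereas optimality bounds the left-hand side by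
  the noise.\<close>

lemma maximizer_near_signal:
  fixes S H :: "('n::finite, 'd::finite) stack" and \<Delta> :: "real^('n \<times> 'd)^('n \<times> 'd)"
  assumes S: "S \<in> orth_stack" and H: "H \<in> orth_stack" and sym: "transpose \<Delta> = \<Delta>"
    and le: "fbar (S ** transpose S + \<Delta>) S \<le> fbar (S ** transpose S + \<Delta>) H"
    and Z: "transpose (transpose S ** H) = transpose S ** H" "\<And>v. 0 \<le> v \<bullet> ((transpose S ** H) *v v)"
  shows "real CARD('n) * norm (H - S) \<le> 4 * onorm ((*v) \<Delta>) * sqrt (real CARD('n) * real CARD('d))"
    "transpose S ** H = real CARD('n) *\<^sub>R mat 1 - (1/2) *\<^sub>R (transpose (H - S) ** (H - S))"
proof -
  let ?n = "real CARD('n)" and ?d = "real CARD('d)" and ?Z = "transpose S ** H" and ?b = "onorm ((*v) \<Delta>)"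
  let ?E = "H - S"
  have Z1: "transpose H ** S = ?Z" using Z(1) by (simp add: matrix_transpose_mul)
  show ZE: "?Z = ?n *\<^sub>R mat 1 - (1/2) *\<^sub>R (transpose ?E ** ?E)"
    unfolding gram_diff[OF H S] Z1 by (simp add: vec_eq_iff algebra_simps)
  have trI: "trace (mat 1 :: real^'d^'d) = ?d" by (simp add: trace_I)
  have tr: "(norm ?E)\<^sup>2 = 2 * (?n * ?d - trace ?Z)"
  proof -
    have "trace ?Z = ?n * ?d - 1/2 * trace (transpose ?E ** ?E)"
      unfolding ZE trace_sub trI[symmetric] by (simp add: trace_def sum_distrib_left)
    then show ?thesis by (simp add: trace_transpose_mult power2_norm_eq_inner)
  qed
  \<comment> \<open>\<open>?Z\<close> is a sum of n orthogonal matrices, each of which preserves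
    norms.\<close>
  have bd: "norm (?Z *v v) \<le> ?n * norm v" for v
  proof -
    have "?Z *v v = (\<Sum>i\<in>UNIV. (transpose (block S i) ** block H i) *v v)"
      unfolding transpose_mult_blocks
      by (rule linear_sum[where f = "\<lambda>A. A *v v"]) (auto intro!: linearI simp: matrix_vector_mult_add_rdistrib scaleR_matrix_vector_assoc)
    also have "norm \<dots> \<le> (\<Sum>i\<in>UNIV. norm ((transpose (block S i) ** block H i) *v v))" by (rule norm_sum)
    also have "\<dots> = ?n * norm v"
      using orth_stackD[OF S] orth_stackD[OF H]
      by (simp add: norm_orthogonal_vector orthogonal_matrix_mult)
    finally show ?thesis .
  qed
  have f: "fbar (S ** transpose S + \<Delta>) X = (norm (transpose S ** X))\<^sup>2 + X \<bullet> (\<Delta> ** X)" for X :: "('n, 'd) stack"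
    using inner_mult_left[of S "transpose S ** X" X]
    by (simp add: fbar_inner mm.add_left inner_add_right power2_norm_eq_inner matrix_mul_assoc inner_commute)
  have "(norm (transpose S ** S))\<^sup>2 = ?n * (?n * ?d)"
    unfolding orth_stack_gram[OF S] using norm_orthogonal_matrix[of "mat 1 :: real^'d^'d"] orthogonal_matrix_id
    by (simp add: power_mult_distrib power2_eq_square)
  then have "?n * (?n * ?d) - (norm ?Z)\<^sup>2 \<le> H \<bullet> (\<Delta> ** H) - S \<bullet> (\<Delta> ** S)"
    using le unfolding f by simp
  moreover have "?n * (?n * ?d - trace ?Z) \<le> ?n * (?n * ?d) - (norm ?Z)\<^sup>2"
    using norm_psd_le_trace[OF Z bd] by (simp add: algebra_simps)
  \<comment> \<open>Symmetry of \<Delta> factors the difference of the two quadratic forms into a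
    pairing of \<open>?E\<close> with \<Delta> (H + S). This gains a factor \<open>norm ?E\<close>,
    which cancels at the end.\<close>
  moreover have "S \<bullet> (\<Delta> ** H) = H \<bullet> (\<Delta> ** S)"
    using inner_mult_left[of \<Delta> H S] sym by (simp add: inner_commute)
  then have "H \<bullet> (\<Delta> ** H) - S \<bullet> (\<Delta> ** S) = ?E \<bullet> (\<Delta> ** (H + S))"
    by (simp add: mm.add_right inner_diff_left inner_add_right)
  moreover have "?E \<bullet> (\<Delta> ** (H + S)) \<le> norm ?E * (?b * (2 * sqrt (?n * ?d)))"
  proof -
    have "norm (\<Delta> ** (H + S)) \<le> ?b * norm (H + S)" by (rule norm_le_onorm_mult)
    also have "\<dots> \<le> ?b * (2 * sqrt (?n * ?d))"
      using norm_triangle_ineq[of H S] norm_orth_stack[OF H] norm_orth_stack[OF S]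
        onorm_pos_le[OF matrix_vector_mul_bounded_linear] by (intro mult_left_mono) auto
    finally have "norm ?E * norm (\<Delta> ** (H + S)) \<le> norm ?E * (?b * (2 * sqrt (?n * ?d)))"
      by (rule mult_left_mono) simp
    with norm_cauchy_schwarz show ?thesis by (rule order_trans)
  qed
  ultimately have "?n * (norm ?E)\<^sup>2 \<le> 2 * (norm ?E * (?b * (2 * sqrt (?n * ?d))))"
    unfolding tr by linarith
  then have "norm ?E * (?n * norm ?E) \<le> norm ?E * (4 * ?b * sqrt (?n * ?d))"
    by (simp add: power2_eq_square mult_ac)
  moreover have "0 \<le> 4 * ?b * sqrt (?n * ?d)"
    using onorm_pos_le[OF matrix_vector_mul_bounded_linear, of \<Delta>] by (simp add: mult_nonneg_nonneg)
  ultimately show "?n * norm ?E \<le> 4 * ?b * sqrt (?n * ?d)"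
    by (cases "norm ?E = 0") (auto simp: mult_le_cancel_left)
qed

section \<open>Optimality conditions at single blocks\<close>

lemma maximizer_critical:
  fixes H :: "('n::finite, 'd::finite) stack"
  assumes H: "H \<in> orth_stack" and max: "\<And>X. X \<in> orth_stack \<Longrightarrow> fbar C X \<le> fbar C H"
    and sym: "transpose C = C" and w: "w \<in> tangent orth_stack H"
  shows "(C ** H) \<bullet> w = 0"
proof -
  obtain \<gamma> where \<gamma>: "curve_at orth_stack H \<gamma>" "w = velocity \<gamma>"
    using w unfolding tangent_def by blast
  obtain e where e: "e > 0" "\<And>t. t \<in> {-e<..<e} \<Longrightarrow> \<gamma> t \<in> orth_stack" "\<gamma> 0 = H"
    using curve_atE[OF \<gamma>(1)] by metis
  have "((\<lambda>t. fbar C (\<gamma> t)) has_real_derivative (2 *\<^sub>R (C ** \<gamma> 0)) \<bullet> w) (at 0)"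
    unfolding \<gamma>(2) by (rule fbar_has_derivative_along_curve[OF sym curve_at_velocity[OF \<gamma>(1)]])
  then have "(2 *\<^sub>R (C ** \<gamma> 0)) \<bullet> w = 0"
    by (rule DERIV_local_max[OF _ e(1)]) (use max e in \<open>auto simp: abs_less_iff\<close>)
  then show ?thesis by (simp add: e(3))
qed

lemma inner_embed_block: "X \<bullet> embed_block i A = block X i \<bullet> A"
proof -
  have "block X j \<bullet> block (embed_block i A) j = (if j = i then block X i \<bullet> A else 0)" for j by simp
  then show ?thesis by (simp add: inner_blocks)
qed

lemma norm_embed_block: "norm (embed_block i A) = norm A"
  by (simp add: norm_eq_sqrt_inner inner_embed_block)

text \<open>Moving only block \<open>i\<close>, in the direction \<open>A ** block H i\<close> with
  \<open>A\<close> skew, makes the multiplier orthogonal to every skew matrix.\<close>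

lemma maximizer_block_symmetric:
  fixes H :: "('n::finite, 'd::finite) stack"
  assumes H: "H \<in> orth_stack" and max: "\<And>X. X \<in> orth_stack \<Longrightarrow> fbar C X \<le> fbar C H"
    and sym: "transpose C = C"
  shows "transpose (block (C ** H) i ** transpose (block H i)) = block (C ** H) i ** transpose (block H i)"
proof (rule symmetric_if_orthogonal_to_skew)
  fix A :: "real^'d^'d" assume A: "skew A"
  have "embed_block i (A ** block H i) \<in> tangent orth_stack H"
    using A unfolding tangent_orth_stack[OF H] by (auto simp: mm_simps matrix_mul_assoc mm.zero_right)
  from maximizer_critical[OF H max sym this]
  have "block (C ** H) i \<bullet> (A ** block H i) = 0" by (simp add: inner_embed_block)
  then show "(block (C ** H) i ** transpose (block H i)) \<bullet> A = 0"
    using inner_mult_right[of A "block H i" "block (C ** H) i"] by (simp add: inner_commute)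
qed

text \<open>Compare \<open>H\<close> with the configuration obtained by reflecting its \<open>i\<close>-th block along a unit vector.\<close>

lemma maximizer_block_lower_bound:
  fixes S H :: "('n::finite, 'd::finite) stack" and \<Delta> :: "real^('n \<times> 'd)^('n \<times> 'd)"
  defines "C \<equiv> S ** transpose S + \<Delta>"
  assumes H: "H \<in> orth_stack" and max: "\<And>X. X \<in> orth_stack \<Longrightarrow> fbar C X \<le> fbar C H"
    and sym: "transpose C = C"
  shows "- onorm ((*v) \<Delta>) * (norm v)\<^sup>2 \<le> v \<bullet> ((block (C ** H) i ** transpose (block H i)) *v v)"
proof (cases v rule: unit_vector_cases)
  case (1 u)
  let ?D = "block (C ** H) i ** transpose (block H i)" and ?b = "onorm ((*v) \<Delta>)"
  define Y where "Y = embed_block i (- 2 *\<^sub>R (outer u ** block H i))"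
  have "H + Y \<in> orth_stack"
  proof -
    have "block (H + Y) j = (if j = i then (mat 1 - 2 *\<^sub>R outer u) ** block H i else block H j)" for j
      by (simp add: Y_def mm_simps)
    then show ?thesis
      using orth_stackD[OF H] orthogonal_householder[OF 1(1)]
      by (auto simp: orth_stack_def orthogonal_matrix_mult)
  qed
  then have "fbar C (H + Y) \<le> fbar C H" by (rule max)
  moreover have "H \<bullet> (C ** Y) = Y \<bullet> (C ** H)"
    using inner_mult_left[of C Y H] sym by (simp add: inner_commute)
  ultimately have le: "2 * (Y \<bullet> (C ** H)) + Y \<bullet> (C ** Y) \<le> 0"
    by (simp add: fbar_inner mm.add_right inner_add_left inner_add_right)
  have YCH: "Y \<bullet> (C ** H) = - 2 * (u \<bullet> (?D *v u))"
  proof -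
    have "Y \<bullet> (C ** H) = (C ** H) \<bullet> Y" by (rule inner_commute)
    also have "\<dots> = - 2 * (block (C ** H) i \<bullet> (outer u ** block H i))"
      by (simp add: Y_def inner_embed_block)
    also have "block (C ** H) i \<bullet> (outer u ** block H i) = ?D \<bullet> outer u"
      using inner_mult_right[of "outer u" "block H i" "block (C ** H) i"] by (simp add: inner_commute)
    finally show ?thesis by (simp add: inner_outer)
  qed
  have "(norm (outer u))\<^sup>2 = 1"
  proof -
    have "(norm (outer u))\<^sup>2 = trace (outer u ** outer u)"
      using trace_transpose_mult[of "outer u" "outer u"] by (simp add: power2_norm_eq_inner transpose_outer)
    also have "\<dots> = u \<bullet> u" unfolding outer_mult_outer[OF 1(1)] by (simp add: trace_def outer_def inner_vec_def)
    finally show ?thesis using 1(1) power2_norm_eq_inner[of u] by simp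
  qed
  then have nY: "norm Y = 2"
    by (simp add: Y_def norm_embed_block norm_mult_orthogonal[OF orth_stackD[OF H]])
       (metis norm_ge_zero power2_eq_1_iff add_le_same_cancel1 abs_norm_cancel abs_of_nonneg zero_le_one one_power2 power2_eq_imp_eq)
  have "Y \<bullet> (C ** Y) = (norm (transpose S ** Y))\<^sup>2 + Y \<bullet> (\<Delta> ** Y)"
    using inner_mult_left[of S "transpose S ** Y" Y]
    by (simp add: C_def mm.add_left inner_add_right power2_norm_eq_inner matrix_mul_assoc inner_commute)
  moreover have "\<bar>Y \<bullet> (\<Delta> ** Y)\<bar> \<le> norm Y * (?b * norm Y)"
    using Cauchy_Schwarz_ineq2[of Y "\<Delta> ** Y"] mult_left_mono[OF norm_le_onorm_mult[of \<Delta> Y] norm_ge_zero[of Y]]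
    by linarith
  \<comment> \<open>The signal contributes a nonnegative square, which is dropped, and
    \<open>norm Y = 2\<close> gives the factor 4. It cancels against the 4 in the cross terms 2 Y .
    C H = -4 u . D u.\<close>
  ultimately have "- 4 * ?b \<le> Y \<bullet> (C ** Y)"
    unfolding nY using zero_le_power2[of "norm (transpose S ** Y)"] by linarith
  with le YCH have u: "- ?b \<le> u \<bullet> (?D *v u)" by linarith
  have "v \<bullet> (?D *v v) = (norm v)\<^sup>2 * (u \<bullet> (?D *v u))"
    by (subst 1(2), subst (2) 1(2)) (simp only: matrix_vector_mult_scaleR inner_scaleR_left inner_scaleR_right power2_eq_square mult.assoc)
  then show ?thesis
    using mult_left_mono[OF u, of "(norm v)\<^sup>2"] by (simp add: mult.commute)
qed simp

text \<open>A symmetric matrix close to \<open>n\<close> times an orthogonal matrix has eigenvalues near \<open>\<plusminus>n\<close>; a weak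
  lower bound excludes the negative ones. Eigenvectors are avoided by testing with \<open>u = (n - D) v\<close>,
  for which \<open>D u = - n u + (n\<^sup>2 - D\<^sup>2) v\<close>.\<close>

lemma near_scalar_if_near_orthogonal:
  fixes D R N :: "real^'d^'d"
  assumes n: "n > 0" and D: "transpose D = D" "D = n *\<^sub>R R + N" and R: "orthogonal_matrix R"
    and N: "norm N \<le> 8/100 * n" and lower: "\<And>u. - (n/20) * (norm u)\<^sup>2 \<le> u \<bullet> (D *v u)"
  shows "norm ((D - n *\<^sub>R mat 1) *v v) \<le> 18/100 * n * norm v"
proof -
  define u where "u = n *\<^sub>R v - D *v v"
  have selfadj: "x \<bullet> (D *v y) = (D *v x) \<bullet> y" for x y
    using dot_lmul_matrix[of x D y] transpose_matrix_vector[of D x] D(1) by simp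
  have Dv: "D *v x = n *\<^sub>R (R *v x) + N *v x" for x
    by (simp add: D(2) matrix_vector_mult_add_rdistrib scaleR_matrix_vector_assoc)
  have Nv: "norm (N *v x) \<le> 8/100 * n * norm x" for x
    using norm_matrix_vector_le[of N x] mult_right_mono[OF N, of "norm x"] by simp
  have RR: "(R *v x) \<bullet> (R *v y) = x \<bullet> y" for x y
  proof -
    have "orthogonal_transformation ((*v) R)" using R by (simp add: orthogonal_transformation_matrix)
    then show ?thesis by (simp add: orthogonal_transformation_def)
  qed
  have ip: "x \<bullet> y \<le> a * b" if "norm x \<le> a" "norm y \<le> b" for x y :: "real^'d" and a b
    using norm_cauchy_schwarz[of x y] mult_mono'[OF that] by auto
  have Du: "u \<bullet> (D *v u) = - n * (norm u)\<^sup>2 + (n\<^sup>2 * (u \<bullet> v) - (D *v u) \<bullet> (D *v v))"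
  proof -
    have "D *v u = n *\<^sub>R (D *v v) - D *v (D *v v)"
      by (simp add: u_def matrix_vector_mult_diff_distrib matrix_vector_mult_scaleR)
    also have "\<dots> = - n *\<^sub>R u + n\<^sup>2 *\<^sub>R v - D *v (D *v v)"
      by (simp add: u_def power2_eq_square algebra_simps)
    finally have "u \<bullet> (D *v u) = - n * (u \<bullet> u) + n\<^sup>2 * (u \<bullet> v) - u \<bullet> (D *v (D *v v))"
      by (simp add: inner_diff_right inner_add_right)
    then show ?thesis by (simp add: selfadj[of u] power2_norm_eq_inner)
  qed
  \<comment> \<open>\<open>R\<close> preserves inner products, so the pure n^2 terms cancel and only
    products with the noise \<open>N\<close> remain.\<close>
  have "n\<^sup>2 * (u \<bullet> v) - (D *v u) \<bullet> (D *v v)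
      = n * ((- (R *v u)) \<bullet> (N *v v)) + n * ((- (N *v u)) \<bullet> (R *v v)) + (- (N *v u)) \<bullet> (N *v v)"
    unfolding Dv by (simp add: inner_add_left inner_add_right RR power2_eq_square algebra_simps)
  also have "\<dots> \<le> n * (norm u * (8/100 * n * norm v)) + n * ((8/100 * n * norm u) * norm v)
      + (8/100 * n * norm u) * (8/100 * n * norm v)"
    using n Nv by (intro add_mono mult_left_mono ip) (auto simp: norm_orthogonal_vector[OF R])
  also have "\<dots> = 1664/10000 * n\<^sup>2 * norm u * norm v" by (simp add: power2_eq_square)
  finally have "- (n/20) * (norm u)\<^sup>2 \<le> - n * (norm u)\<^sup>2 + 1664/10000 * n\<^sup>2 * norm u * norm v"
    using lower[of u] Du by linarith
  \<comment> \<open>0.95 is 1 - 1/20, and 0.1664 is 2 (0.08) + 0.08^2; their quotient stays below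
    0.18.\<close>
  then have "(n * norm u) * (95/100 * norm u) \<le> (n * norm u) * (1664/10000 * n * norm v)"
    by (simp add: power2_eq_square algebra_simps)
  then have "95/100 * norm u \<le> 1664/10000 * n * norm v \<or> norm u = 0"
    using n by (auto simp: mult_le_cancel_left)
  moreover have "0 \<le> n * norm v" using n by simp
  ultimately have "norm u \<le> 18/100 * n * norm v" by auto
  moreover have "(D - n *\<^sub>R mat 1) *v v = - u"
    by (simp add: u_def matrix_vector_mult_diff_rdistrib scaleR_matrix_vector_assoc[symmetric])
  ultimately show ?thesis by simp
qed

section \<open>The gradient bound\<close>

text \<open>Expand \<open>W = X + G X\<^sup>T X / 2\<close> blockwise, where \<open>X = H - G\<close>.\<close>

lemma gradient_test_identity:
  fixes G H :: "('n::finite, 'd::finite) stack" and D :: "'n \<Rightarrow> real^'d^'d"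
  defines "X \<equiv> H - G"
  assumes G: "G \<in> orth_stack" and H: "H \<in> orth_stack"
    and D: "\<And>i. transpose (D i) = D i" "\<And>i. block (C ** H) i = D i ** block H i"
  shows "(C ** G) \<bullet> tproj G X = (1/2) * (\<Sum>i\<in>UNIV. (D i ** block X i) \<bullet> block X i) - (C ** X) \<bullet> X
    + (1/2) * (\<Sum>i\<in>UNIV. block (C ** G) i \<bullet> (block G i ** (transpose (block X i) ** block X i)))"
proof -
  have tX: "block (tproj G X) i = block X i + (1/2) *\<^sub>R (block G i ** (transpose (block X i) ** block X i))" for i
  proof -
    note O = orth_tr[OF orth_stackD[OF G, of i]] orth_tr[OF orth_stackD[OF H, of i]]
    have e1: "block G i ** (transpose (block X i) ** block X i)
        = 2 *\<^sub>R block G i - block H i - block G i ** transpose (block H i) ** block G i"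
      by (simp only: X_def block_linear_simps mm.diff_left mm.diff_right transpose_linear_simps
          matrix_mul_assoc O matrix_mul_rid matrix_mul_lid) (simp add: vec_eq_iff)
    have e2: "block (tproj G X) i = (1/2) *\<^sub>R (block H i - block G i ** transpose (block H i) ** block G i)"
      by (simp add: tproj_def X_def mm.diff_left mm.diff_right transpose_linear_simps matrix_mul_assoc O)
    show ?thesis unfolding e1 e2 by (simp add: X_def vec_eq_iff field_simps)
  qed
  have 1: "(D i ** block H i) \<bullet> block X i = (1/2) * ((D i ** block X i) \<bullet> block X i)" for i
  proof -
    note O = orth_tr[OF orth_stackD[OF G, of i]] orth_tr[OF orth_stackD[OF H, of i]]
    let ?P = "block X i ** transpose (block H i)"
    have "(D i ** block H i) \<bullet> block X i = D i \<bullet> ?P" by (rule inner_mult_right)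
    moreover have "D i \<bullet> transpose ?P = D i \<bullet> ?P"
      using inner_transpose[of "D i" ?P] D(1) by simp
    moreover have "block X i ** transpose (block X i) = ?P + transpose ?P"
      by (simp add: X_def mm_simps matrix_mul_assoc O)
    moreover have "(D i ** block X i) \<bullet> block X i = D i \<bullet> (block X i ** transpose (block X i))"
      by (rule inner_mult_right)
    ultimately show ?thesis by (simp add: inner_add_right)
  qed
  have "(C ** G) \<bullet> tproj G X = (C ** G) \<bullet> X
      + (1/2) * (\<Sum>i\<in>UNIV. block (C ** G) i \<bullet> (block G i ** (transpose (block X i) ** block X i)))"
    unfolding inner_blocks[of "C ** G"] tX
    by (simp add: inner_add_right sum.distrib sum_divide_distrib)
  moreover have "(C ** G) \<bullet> X = (C ** H) \<bullet> X - (C ** X) \<bullet> X"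
    by (simp add: X_def mm.diff_right inner_diff_left)
  moreover have "(C ** H) \<bullet> X = (1/2) * (\<Sum>i\<in>UNIV. (D i ** block X i) \<bullet> block X i)"
    unfolding inner_blocks[of "C ** H"] D(2) 1 by (simp add: sum_distrib_left)
  ultimately show ?thesis by simp
qed

lemma inner_ge_minus_norms: "norm x \<le> a \<Longrightarrow> norm y \<le> b \<Longrightarrow> - (a * b) \<le> x \<bullet> y"
proof -
  assume a: "norm x \<le> a" "norm y \<le> b"
  have "\<bar>x \<bullet> y\<bar> \<le> norm x * norm y" by (rule Cauchy_Schwarz_ineq2)
  also have "\<dots> \<le> a * b" using a by (intro mult_mono) (auto intro: order_trans[OF norm_ge_zero])
  finally show ?thesis by linarith
qed

text \<open>\<open>D ** H - K\<close> is meant to be a block of C G. In the decomposition n (G + X)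
  + (D - n) H - K the term n G gives n |X|^2, and the others cost 0.25, 0.18 and 0.125 of it,
  leaving 0.445.\<close>

lemma gradient_test_block_bound:
  fixes G H X D K :: "real^'d^'d"
  assumes G: "orthogonal_matrix G" and X: "X = H - G" "norm X \<le> 1/4" and n: "n > 0"
    and D: "\<And>v. norm ((D - n *\<^sub>R mat 1) *v v) \<le> 18/100 * n * norm v" 
    and K: "norm K \<le> 125/1000 * n" and H: "orthogonal_matrix H"
  shows "445/1000 * n * (norm X)\<^sup>2 \<le> (D ** H - K) \<bullet> (G ** (transpose X ** X))"
    "82/100 * n * (norm X)\<^sup>2 \<le> (D ** X) \<bullet> X"
proof -
  let ?E = "D - n *\<^sub>R mat 1"
  have E: "norm (?E ** Y) \<le> 18/100 * n * norm Y" for Y :: "real^'d^'d"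
    by (rule norm_mult_le_of_vector[OF D]) (use n in simp)
  have XX: "norm (G ** (transpose X ** X)) \<le> (norm X)\<^sup>2"
    using norm_matrix_mult_le[of "transpose X" X]
    by (simp add: norm_orthogonal_mult[OF G] norm_transpose power2_eq_square)
  have GG: "G \<bullet> (G ** (transpose X ** X)) = (norm X)\<^sup>2"
  proof -
    have "G \<bullet> (G ** (transpose X ** X)) = (X ** transpose G) \<bullet> (X ** transpose G)"
      using inner_mult_right[of "G ** transpose X" X G] by (simp add: matrix_mul_assoc inner_commute[of G])
         (metis inner_transpose matrix_transpose_mul transpose_transpose)
    also have "\<dots> = (norm X)\<^sup>2"
      using norm_mult_orthogonal[of "transpose G" X] G by (simp add: power2_norm_eq_inner[symmetric])
    finally show ?thesis .
  qed
  have XG: "- (1/4 * (norm X)\<^sup>2) \<le> X \<bullet> (G ** (transpose X ** X))"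
    by (rule inner_ge_minus_norms[OF X(2) XX])
  \<comment> \<open>\<open>?E\<close> is bounded as an operator. Moving \<open>transpose X\<close>
    next to \<open>H\<close> first lets \<open>?E\<close> act on a matrix of Frobenius norm |X|,
    which avoids the factor sqrt d that the norm of \<open>H\<close> would bring.\<close>
  have EH: "- (18/100 * n * (norm X)\<^sup>2) \<le> (?E ** H) \<bullet> (G ** (transpose X ** X))"
  proof -
    have "(?E ** H) \<bullet> (G ** (transpose X ** X)) = (?E ** (H ** transpose X)) \<bullet> (G ** transpose X)"
      using inner_mult_right[of "G ** transpose X" X "?E ** H"]
      by (simp add: matrix_mul_assoc inner_commute)
    moreover have a: "norm (?E ** (H ** transpose X)) \<le> 18/100 * n * norm X"
      using E[of "H ** transpose X"] by (simp add: norm_orthogonal_mult[OF H] norm_transpose)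
    moreover have b: "norm (G ** transpose X) \<le> norm X"
      by (simp add: norm_orthogonal_mult[OF G] norm_transpose)
    ultimately show ?thesis
      using inner_ge_minus_norms[OF a b] by (simp add: power2_eq_square mult.assoc)
  qed
  have Kb: "- (125/1000 * n * (norm X)\<^sup>2) \<le> (- K) \<bullet> (G ** (transpose X ** X))"
    by (rule inner_ge_minus_norms[OF _ XX]) (use K in simp)
  have "D ** H - K = n *\<^sub>R (G + X) + ?E ** H + (- K)"
    by (simp add: X(1) mm_simps)
  then have "(D ** H - K) \<bullet> (G ** (transpose X ** X)) = n * (norm X)\<^sup>2 + n * (X \<bullet> (G ** (transpose X ** X)))
      + (?E ** H) \<bullet> (G ** (transpose X ** X)) + (- K) \<bullet> (G ** (transpose X ** X))"
    by (simp only: inner_add_left inner_scaleR_left GG distrib_left)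
  moreover have "n * (- (1/4 * (norm X)\<^sup>2)) \<le> n * (X \<bullet> (G ** (transpose X ** X)))"
    using XG n by (intro mult_left_mono) auto
  ultimately show "445/1000 * n * (norm X)\<^sup>2 \<le> (D ** H - K) \<bullet> (G ** (transpose X ** X))"
    using EH Kb by (simp add: algebra_simps)
  have "D ** X = n *\<^sub>R X + ?E ** X" by (simp add: mm_simps)
  then have "(D ** X) \<bullet> X = n * (norm X)\<^sup>2 + (?E ** X) \<bullet> X"
    by (simp only: inner_add_left inner_scaleR_left power2_norm_eq_inner)
  moreover have "- (18/100 * n * norm X * norm X) \<le> (?E ** X) \<bullet> X"
    by (rule inner_ge_minus_norms[OF E]) simp
  ultimately show "82/100 * n * (norm X)\<^sup>2 \<le> (D ** X) \<bullet> X"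
    by (simp add: power2_eq_square algebra_simps)
qed

text \<open>Here \<open>r = n\<^bsup>1/4\<^esup>\<close>, and \<open>S\<close> is the signal rotated into alignment with the maximizer \<open>H\<close>.\<close>

lemma gradient_lower_bound_aligned:
  fixes S H G :: "('n::finite, 'd::finite) stack" and \<Delta> :: "real^('n \<times> 'd)^('n \<times> 'd)"
  defines "n \<equiv> real CARD('n)" and "d \<equiv> real CARD('d)" and "b \<equiv> onorm ((*v) \<Delta>)"
    and "C \<equiv> S ** transpose S + \<Delta>" and "X \<equiv> H - G"
  assumes S: "S \<in> orth_stack" and H: "H \<in> orth_stack" and G: "G \<in> orth_stack"
    and sym: "transpose \<Delta> = \<Delta>" and max: "\<And>X. X \<in> orth_stack \<Longrightarrow> fbar C X \<le> fbar C H"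
    and Z: "transpose (transpose S ** H) = transpose S ** H" "\<And>v. 0 \<le> v \<bullet> ((transpose S ** H) *v v)"
    and al: "transpose (transpose G ** H) = transpose G ** H"
    and r: "n = r ^ 4" "1 \<le> r" and b: "b * sqrt d \<le> r ^ 3 / 20"
    and noise: "\<And>i. norm (block (\<Delta> ** S) i) \<le> n / 20"
    and near: "norm X \<le> r\<^sup>2 / 10" "b * norm X \<le> n / 10" "\<And>i. norm (block X i) \<le> 1/4"
  shows "52/100 * n * (norm X)\<^sup>2 \<le> (C ** G) \<bullet> tproj G X"
proof -
  let ?E = "H - S"
  have n0: "n > 0" and d1: "1 \<le> sqrt d" by (simp_all add: n_def d_def Suc_leI)
  have b0: "0 \<le> b" by (simp add: b_def onorm_pos_le)
  have bX: "norm (\<Delta> ** Y) \<le> b * norm Y" for Y :: "('n, 'd) stack" unfolding b_def by (rule norm_le_onorm_mult)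
  have symC: "transpose C = C" by (simp add: C_def mm_simps sym)
  note near_signal = maximizer_near_signal[OF S H sym max[OF S, unfolded C_def] Z]
  \<comment> \<open>With n = r^4 and sqrt n = r^2, dividing 4 (r^3 / 20) r^2 by n leaves r /
    5.\<close>
  have E: "norm ?E \<le> r / 5"
  proof -
    have "n * norm ?E \<le> 4 * (b * sqrt d) * sqrt n"
      using near_signal(1) by (simp add: n_def d_def b_def real_sqrt_mult mult_ac)
    also have "\<dots> \<le> 4 * (r ^ 3 / 20) * sqrt n"
      using b n0 by (intro mult_right_mono mult_left_mono) auto
    also have "sqrt n = r\<^sup>2" using r real_sqrt_unique[of "r\<^sup>2" n] by simp
    also have "4 * (r ^ 3 / 20) * r\<^sup>2 = n * (r / 5)" using r(1) by (simp add: eval_nat_numeral)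
    finally show ?thesis using n0 by simp
  qed
  have b1: "b \<le> r ^ 3 / 20" using b mult_left_mono[OF d1 b0] by simp
  have rn: "r ^ 3 \<le> n" "r\<^sup>2 \<le> n" unfolding r(1) using r(2) by (intro power_increasing; simp)+
  have bn: "b \<le> n / 20" using b1 rn by simp
  have bE: "b * norm ?E \<le> n / 100"
  proof -
    have "b * norm ?E \<le> (r ^ 3 / 20) * (r / 5)"
      using b1 E b0 r(2) by (intro mult_mono) auto
    then show ?thesis using r(1) by (simp add: eval_nat_numeral)
  qed
  \<comment> \<open>The deviation of S^T H from n I is half of the Gram matrix of \<open>?E\<close>,
    so at most r^2 / 50, and r^2 \<le> n.\<close>
  have nZ: "norm (transpose S ** H - n *\<^sub>R mat 1) \<le> n / 50"
  proof -
    have "norm (transpose ?E ** ?E) \<le> norm ?E * norm ?E"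
      using norm_matrix_mult_le[of "transpose ?E" ?E] by (simp add: norm_transpose)
    also have "\<dots> \<le> (r / 5) * (r / 5)" by (intro mult_mono E) (use r in auto)
    finally have "norm (transpose ?E ** ?E) \<le> n / 25" using rn(2) by (simp add: power2_eq_square)
    then show ?thesis unfolding near_signal(2) by (simp add: n_def)
  qed
  define D where "D = (\<lambda>i. block (C ** H) i ** transpose (block H i))"
  have Dsym: "transpose (D i) = D i" for i
    unfolding D_def by (rule maximizer_block_symmetric[OF H max symC])
  have DH: "block (C ** H) i = D i ** block H i" for i
    by (simp add: D_def orth_tr orth_stackD[OF H])
  have CY: "C ** Y = S ** (transpose S ** Y) + \<Delta> ** Y" for Y :: "('n, 'd) stack"
    by (simp add: C_def mm.add_left matrix_mul_assoc)
  have Dn: "norm ((D i - n *\<^sub>R mat 1) *v v) \<le> 18/100 * n * norm v" for i v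
  proof (rule near_scalar_if_near_orthogonal[OF n0 Dsym])
    note Oi = orth_stackD[OF S, of i] orth_stackD[OF H, of i]
    let ?R = "block S i ** transpose (block H i)"
    let ?N = "(block S i ** (transpose S ** H - n *\<^sub>R mat 1) + block (\<Delta> ** H) i) ** transpose (block H i)"
    show "orthogonal_matrix ?R" using Oi by (simp add: orthogonal_matrix_mult)
    show "D i = n *\<^sub>R ?R + ?N"
      unfolding D_def CY by (simp add: mm_simps) 
    have "norm (block (\<Delta> ** H) i) \<le> norm (block (\<Delta> ** S) i) + norm (block (\<Delta> ** ?E) i)"
      using norm_triangle_ineq[of "block (\<Delta> ** S) i" "block (\<Delta> ** ?E) i"] by (simp add: mm.diff_right)
    moreover have "norm (block (\<Delta> ** ?E) i) \<le> n / 100"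
      using norm_block_le[of "\<Delta> ** ?E" i] bX[of ?E] bE by linarith
    \<comment> \<open>The sum 1/20 + 1/100 gives 6/100; the deviation n / 50 of S^T H from n I
      raises it to the 8/100 below.\<close>
    ultimately have "norm (block (\<Delta> ** H) i) \<le> 6/100 * n" using noise[of i] by linarith
    then have "norm (block S i ** (transpose S ** H - n *\<^sub>R mat 1) + block (\<Delta> ** H) i) \<le> 8/100 * n"
      using norm_triangle_ineq[of "block S i ** (transpose S ** H - n *\<^sub>R mat 1)" "block (\<Delta> ** H) i"]
        norm_orthogonal_mult[OF Oi(1), of "transpose S ** H - n *\<^sub>R mat 1"] nZ by linarith
    then show "norm ?N \<le> 8/100 * n"
      by (simp only: norm_mult_orthogonal[OF iffD2[OF orthogonal_matrix_transpose Oi(2)]])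
    show "- (n/20) * (norm u)\<^sup>2 \<le> u \<bullet> (D i *v u)" for u
    proof -
      have "- b * (norm u)\<^sup>2 \<le> u \<bullet> (D i *v u)"
        unfolding D_def b_def C_def
        by (rule maximizer_block_lower_bound[OF H max[unfolded C_def] symC[unfolded C_def]])
      moreover have "b * (norm u)\<^sup>2 \<le> n / 20 * (norm u)\<^sup>2" using bn by (intro mult_right_mono) auto
      ultimately show ?thesis by linarith
    qed
  qed
  \<comment> \<open>Alignment of \<open>G\<close> with \<open>H\<close> bounds H^T X by (r^2 / 20)
    |X|. Replacing \<open>H\<close> by \<open>S\<close> costs r / 5 \<le> r^2 / 5, and 1/20 + 1/5 =
    1/4.\<close>
  have SX: "norm (transpose S ** X) \<le> r\<^sup>2 / 4 * norm X"
  proof -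
    have HG: "transpose H ** G = transpose G ** H" using al by (simp add: matrix_transpose_mul)
    have "transpose X ** X = (2 * n) *\<^sub>R mat 1 - (transpose G ** H + transpose G ** H)"
      unfolding X_def gram_diff[OF H G] HG n_def by simp
    moreover have "transpose H ** X = n *\<^sub>R mat 1 - transpose G ** H"
      by (simp add: X_def mm.diff_right orth_stack_gram[OF H] HG n_def)
    ultimately have "transpose X ** X = 2 *\<^sub>R (transpose H ** X)"
      by (simp add: vec_eq_iff)
    then have "norm (transpose H ** X) = norm (transpose X ** X) / 2" by simp
    also have "\<dots> \<le> norm X * norm X / 2"
      using norm_matrix_mult_le[of "transpose X" X] by (simp add: norm_transpose)
    also have "\<dots> \<le> r\<^sup>2 / 20 * norm X"
      using mult_right_mono[OF near(1) norm_ge_zero[of X]] by simp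
    finally have 1: "norm (transpose H ** X) \<le> r\<^sup>2 / 20 * norm X" .
    have "norm (transpose ?E ** X) \<le> norm ?E * norm X"
      using norm_matrix_mult_le[of "transpose ?E" X] by (simp add: norm_transpose)
    also have "\<dots> \<le> r\<^sup>2 / 5 * norm X"
      using E r(2) by (intro mult_right_mono) (auto simp: power2_eq_square intro: order_trans)
    finally have 2: "norm (transpose ?E ** X) \<le> r\<^sup>2 / 5 * norm X" .
    have "transpose S ** X = transpose H ** X - transpose ?E ** X" by (simp add: mm_simps)
    then show ?thesis using norm_triangle_ineq4[of "transpose H ** X" "transpose ?E ** X"] 1 2 by simp
  qed
  \<comment> \<open>1/16 comes from the signal, as (r^2 / 4)^2 = n / 16, and 1/20 from the
    noise.\<close>
  have CX: "(C ** X) \<bullet> X \<le> 1125/10000 * n * (norm X)\<^sup>2"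
  proof -
    have "(C ** X) \<bullet> X = (norm (transpose S ** X))\<^sup>2 + (\<Delta> ** X) \<bullet> X"
      unfolding CY inner_add_left inner_mult_left[of S] power2_norm_eq_inner by simp
    moreover have "(norm (transpose S ** X))\<^sup>2 \<le> n / 16 * (norm X)\<^sup>2"
      using power_mono[OF SX norm_ge_zero, of 2] r(1) by (simp add: power_mult_distrib power_divide)
    moreover have "(\<Delta> ** X) \<bullet> X \<le> n / 20 * (norm X)\<^sup>2"
    proof -
      have "(\<Delta> ** X) \<bullet> X \<le> norm (\<Delta> ** X) * norm X" by (rule norm_cauchy_schwarz)
      also have "\<dots> \<le> (b * norm X) * norm X" by (intro mult_right_mono bX) auto
      also have "\<dots> \<le> (n / 20 * norm X) * norm X" by (intro mult_right_mono bn) auto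
      finally show ?thesis by (simp add: power2_eq_square)
    qed
    ultimately show ?thesis by linarith
  qed
  \<comment> \<open>Both radius conditions enter: |X| \<le> r^2 / 10 gives n / 40 for the signal,
    and b |X| \<le> n / 10 bounds the noise.\<close>
  have K: "norm (block (C ** X) i) \<le> 125/1000 * n" for i
  proof -
    have "block (C ** X) i = block S i ** (transpose S ** X) + block (\<Delta> ** X) i" unfolding CY by simp
    then have "norm (block (C ** X) i) \<le> norm (transpose S ** X) + norm (block (\<Delta> ** X) i)"
      using norm_triangle_ineq[of "block S i ** (transpose S ** X)" "block (\<Delta> ** X) i"]
      by (simp add: norm_orthogonal_mult[OF orth_stackD[OF S]])
    moreover have "norm (block (\<Delta> ** X) i) \<le> n / 10"
      using norm_block_le[of "\<Delta> ** X" i] bX[of X] near(2) by linarith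
    moreover have "norm (transpose S ** X) \<le> n / 40"
    proof -
      have "r\<^sup>2 / 4 * norm X \<le> r\<^sup>2 / 4 * (r\<^sup>2 / 10)" by (intro mult_left_mono near) auto
      then show ?thesis using SX r(1) by (simp add: eval_nat_numeral)
    qed
    ultimately show ?thesis by linarith
  qed
  have CG: "block (C ** G) i = D i ** block H i - block (C ** X) i" for i
    unfolding DH[symmetric] by (simp add: X_def mm.diff_right)
  have bX': "block X i = block H i - block G i" for i by (simp add: X_def)
  note blockwise = gradient_test_block_bound[OF orth_stackD[OF G] bX' near(3) n0 Dn K orth_stackD[OF H]]
  have s1: "82/100 * n * (norm X)\<^sup>2 \<le> (\<Sum>i\<in>UNIV. (D i ** block X i) \<bullet> block X i)"
    unfolding norm_blocks sum_distrib_left by (intro sum_mono blockwise(2))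
  have s2: "445/1000 * n * (norm X)\<^sup>2 \<le>
      (\<Sum>i\<in>UNIV. block (C ** G) i \<bullet> (block G i ** (transpose (block X i) ** block X i)))"
    unfolding norm_blocks sum_distrib_left CG by (intro sum_mono blockwise(1))
  \<comment> \<open>0.82 / 2 + 0.445 / 2 - 0.1125 = 0.52.\<close>
  show ?thesis
    using gradient_test_identity[OF G H Dsym DH] s1 s2 CX unfolding X_def[symmetric] by linarith
qed

theorem corollary5p3:
  fixes Gstar Ghat G :: "real^'d^('n::finite \<times> 'd::finite)"
    and \<Delta> C :: "real^('n \<times> 'd)^('n \<times> 'd)"
    and Qhat :: "real^'d^'d"
    and n d \<rho>F \<rho>inf :: real
  assumes n: "n = real CARD('n)" and d: "d = real CARD('d)"
    and Gstar: "Gstar \<in> orth_stack"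
    and sym: "transpose \<Delta> = \<Delta>"
    and C: "C = Gstar ** transpose Gstar + \<Delta>"
    and Ghat: "is_arg_max (fbar C) (\<lambda>X. X \<in> orth_stack) Ghat"
    and noise: "onorm ((*v) \<Delta>) \<le> n powr (3/4) / (20 * d powr (1/2))"
    and noise_inf: "norm_inf (\<Delta> ** Gstar) \<le> n / 20"
    and rhoF: "\<rho>F = 1/10 * (if \<Delta> = 0 then sqrt n else min (sqrt n) (n / onorm ((*v) \<Delta>)))"
    and rhoinf: "\<rho>inf = 1/4"
    and G: "G \<in> orth_stack"
    and Qhat: "orthogonal_matrix Qhat" "dF G Ghat = norm (G ** Qhat - Ghat)"
    and near: "dF G Ghat \<le> \<rho>F"
    and near_inf: "norm_inf (G ** Qhat - Ghat) \<le> \<rho>inf"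
  shows "ereal (dF G Ghat) \<le> dist_Q (orbit G) (orbit Ghat)
       \<and> dist_Q (orbit G) (orbit Ghat)
           \<le> ereal (10 / n * norm_Q (orbit G) (grad_Q (f_Q C) (orbit G)))
       \<and> 10 / n * norm_Q (orbit G) (grad_Q (f_Q C) (orbit G))
           \<le> 10 / n * norm (grad_sub orth_stack (fbar C) G)"
proof -
  define r where "r = n powr (1/4)"
  let ?b = "onorm ((*v) \<Delta>)"
  have n1: "1 \<le> n" and d1: "1 \<le> d" by (simp_all add: n d Suc_leI)
  have r: "n = r ^ 4" "1 \<le> r" "n powr (3/4) = r ^ 3"
    using n1 by (simp_all add: r_def powr_realpow[symmetric] powr_powr ge_one_powr_ge_zero)
  have b0: "0 \<le> ?b" by (simp add: onorm_pos_le)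
  have bd: "?b * sqrt (real CARD('d)) \<le> r ^ 3 / 20"
    using noise d1 unfolding r(3) powr_half_sqrt[OF order_trans[OF zero_le_one d1]] d[symmetric]
    by (simp add: field_simps)
  have symC: "transpose C = C" unfolding C by (simp add: mm_simps sym)
  have H: "Ghat \<in> orth_stack" and max: "\<And>X. X \<in> orth_stack \<Longrightarrow> fbar C X \<le> fbar C Ghat"
    using Ghat by (auto simp: is_arg_max_def not_less)

  \<comment> \<open>The maximizing rotation makes S^T \<open>Ghat\<close> symmetric and positive
    semidefinite for the rotated signal \<open>S\<close>.\<close>
  obtain Qs where Qs: "orthogonal_matrix Qs"
    "\<And>R. orthogonal_matrix R \<Longrightarrow> (transpose Gstar ** Ghat) \<bullet> R \<le> (transpose Gstar ** Ghat) \<bullet> Qs"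
    using orthogonal_maximizer_exists by metis
  define S where "S = Gstar ** Qs"
  have S: "S \<in> orth_stack" unfolding S_def by (rule orth_stack_mult[OF Gstar Qs(1)])
  have CS: "C = S ** transpose S + \<Delta>"
    by (simp add: C S_def mm_simps matrix_mul_assoc orth_tr[OF Qs(1)])
  have "(transpose S ** Ghat) \<bullet> Q \<le> (transpose S ** Ghat) \<bullet> mat 1" if "orthogonal_matrix Q" for Q
    using Qs(2)[OF orthogonal_matrix_mult[OF Qs(1) that]]
      inner_mult_left[of "transpose Qs" "transpose Gstar ** Ghat"]
    by (simp add: S_def matrix_transpose_mul matrix_mul_assoc)
  note Z = symmetric_psd_if_aligned[OF this]

  define G' where "G' = G ** Qhat"
  have G': "G' \<in> orth_stack" unfolding G'_def by (rule orth_stack_mult[OF G Qhat(1)])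
  have orb: "orbit G' = orbit G" unfolding G'_def by (rule orbit_mult[OF Qhat(1)])
  have dG': "dF G Ghat = norm (G' - Ghat)" using Qhat(2) by (simp add: G'_def)
  \<comment> \<open>\<open>Qhat\<close> attains \<open>dF G Ghat\<close>, so no further rotation
    brings \<open>G'\<close> closer to \<open>Ghat\<close>.\<close>
  have al: "transpose (transpose G' ** Ghat) = transpose G' ** Ghat"
  proof (rule symmetric_psd_if_aligned(1), rule aligned_if_norm_minimal[OF G'])
    fix Q :: "real^'d^'d" assume "orthogonal_matrix Q"
    then show "norm (G' - Ghat) \<le> norm (G' ** Q - Ghat)"
      using dF_le_mult_left[OF orthogonal_matrix_mult[OF Qhat(1)], of Q G Ghat] dG'
      by (simp add: G'_def matrix_mul_assoc)
  qed
  let ?X = "Ghat - G'"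
  have X: "norm ?X = dF G Ghat" by (simp add: dG' norm_minus_commute)
  have near1: "norm ?X \<le> r\<^sup>2 / 10"
  proof -
    have "sqrt n = r\<^sup>2" using r real_sqrt_unique[of "r\<^sup>2" n] by simp
    then show ?thesis using near unfolding X rhoF by (simp split: if_splits)
  qed
  have near2: "?b * norm ?X \<le> n / 10"
  \<comment> \<open>If \<open>?b\<close> is nonzero then so is \<Delta>, which selects the branch of
    \<open>\<rho>F\<close> containing \<open>n / ?b\<close>.\<close>
  proof (cases "?b = 0")
    case False
    have "\<Delta> \<noteq> 0"
    proof
      assume "\<Delta> = 0"
      then have "(*v) \<Delta> = (\<lambda>_. 0)" by (simp add: fun_eq_iff)
      with False show False by (simp add: onorm_zero)
    qed
    then have "norm ?X \<le> 1/10 * (n / ?b)" using near unfolding X rhoF by simp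
    then show ?thesis using False b0 by (simp add: field_simps)
  qed (use n1 in simp)
  have near3: "norm (block ?X i) \<le> 1/4" for i
    using norm_le_norm_inf[of "G ** Qhat - Ghat" i] near_inf rhoinf
    by (simp add: G'_def norm_minus_commute)
  have noise': "norm (block (\<Delta> ** S) i) \<le> n / 20" for i
    using norm_le_norm_inf[of "\<Delta> ** Gstar" i] noise_inf
    by (simp add: S_def matrix_mul_assoc norm_mult_orthogonal[OF Qs(1)])

  have lower: "52/100 * n * (norm ?X)\<^sup>2 \<le> (C ** G') \<bullet> tproj G' ?X"
    using gradient_lower_bound_aligned[OF S H G' sym max[unfolded CS] Z al r(1)[unfolded n] r(2) bd
        noise'[unfolded n] near1 near2[unfolded n] near3]
    unfolding CS n .
  let ?g = "norm (tproj G' (2 *\<^sub>R (C ** G')))"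
  \<comment> \<open>Pairing with a tangent vector ignores the normal part of 2 C G', so the
    projected gradient may replace it.\<close>
  have "2 * ((C ** G') \<bullet> tproj G' ?X) = tproj G' (2 *\<^sub>R (C ** G')) \<bullet> tproj G' ?X"
    using inner_tproj[OF G' tproj_tangent[OF G']] by simp
  also have "\<dots> \<le> ?g * norm (tproj G' ?X)" by (rule norm_cauchy_schwarz)
  also have "\<dots> \<le> ?g * norm ?X" by (intro mult_left_mono norm_tproj_le G') simp
  finally have "norm ?X * (104/100 * n * norm ?X) \<le> norm ?X * ?g"
    using lower by (simp add: power2_eq_square mult_ac)
  then have "104/100 * n * norm ?X \<le> ?g"
    by (cases "norm ?X = 0") (auto simp: mult_le_cancel_left)
  moreover have "0 \<le> n * norm ?X" using n1 by simp
  ultimately have "8/7 * norm ?X * n \<le> 10 * ?g" by simp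
  then have bound: "8/7 * norm ?X \<le> 10 / n * ?g" using n1 by (simp add: field_simps)

  \<comment> \<open>The gradient norm in the quotient depends only on the orbit and may be computed
    at the rotated representative.\<close>
  have normQ: "norm_Q (orbit G) (grad_Q (f_Q C) (orbit G)) = ?g"
    using norm_grad_Q_fbar[OF G' symC] orb by simp
  have "dist_Q (orbit G) (orbit Ghat) \<le> ereal (8/7 * norm ?X)"
    using dist_Q_le_norm_diff[OF G' H] near3 orb by simp
  also have "\<dots> \<le> ereal (10 / n * norm_Q (orbit G) (grad_Q (f_Q C) (orbit G)))"
    using bound by (simp add: normQ)
  finally show ?thesis
    using dF_le_dist_Q norm_grad_Q_fbar[OF G symC] grad_sub_fbar[OF G symC] by auto
qed

end
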